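(* Let $k\ge0$, $(E_\eta)_{\eta\in\mathbb N_0^n}$ the non-symmetric and $(P_\lambda)_{\lambda\in\Lambda_n^+}$ the symmetric Jack polynomials of index $1/k$. Then for all $\mu\in\mathbb C$ and all $x\in\mathbb R^n$ with $x_i\ne0$ for $i=1,\dots,n$: (1) $E_\eta(T)\Delta^{-\mu}(x)=(-1)^{|\eta|}[\mu]_{\eta_+}\,E_\eta\bigl(\tfrac1x\bigr)\,\Delta(x)^{-\mu}$ for all $\eta\in\mathbb N_0^n$; (2) $P_\lambda(T)\Delta^{-\mu}(x)=(-1)^{|\lambda|}[\mu]_{\lambda}\,P_\lambda\bigl(\tfrac1x\bigr)\,\Delta(x)^{-\mu}$ for all $\lambda\in\Lambda_n^+$.
   Context: $s_{ij}$ is the transposition of coordinates $i,j$. Dunkl operators of type $A_{n-1}$, multiplicity $k\ge0$: $T_\xi f(x)=\partial_\xi f(x)+k\sum_{i<j}(\xi_i-\xi_j)\frac{f(x)-f(s_{ij}x)}{x_i-x_j}$, $T_j=T_{e_j}$; they commute and for a polynomial $p$, $p(T)=p(T_1,\dots,T_n)$. $\Delta(x)=\prod_jx_j$ and $\Delta(x)^{-\mu}=\exp(-\mu\,\mathrm{Log}\,\Delta(x))$ (principal branch; smooth on the set where all $x_i\neq0$). $1/x$ is componentwise. $[\mu]_\eta=\prod_{j=1}^n(\mu-k(j-1))_{\eta_j}$ with Pochhammer symbols $(a)_m=a(a+1)\cdots(a+m-1)$. Jack polynomials: $\Lambda_n^+=\{\lambda\in\mathbb N_0^n:\lambda_1\ge\dots\ge\lambda_n\}$;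 $\eta_+$ decreasing rearrangement of $\eta$, $|\eta|=\sum\eta_i$. Dominance: $\mu\le_D\lambda$ iff $|\mu|=|\lambda|$ and partial sums of $\mu$ $\le$ those of $\lambda$. On $\mathbb N_0^n$: $\kappa\prec\eta$ iff $\kappa_+\le_D\eta_+$, $\kappa_+\ne\eta_+$, or $\kappa_+=\eta_+$ and $w_\eta<w_\kappa$ in Bruhat order, $w_\eta$ the shortest permutation with $w_\eta\eta_+=\eta$. Let $\mathcal D_j=x_jT_j+k(1-n)+k\sum_{i>j}s_{ij}$, $\overline\eta_j=\eta_j-k\#\{i<j:\eta_i\ge\eta_j\}-k\#\{i>j:\eta_i>\eta_j\}$. $E_\eta$ is the unique polynomial $x^\eta+\sum_{\kappa\prec\eta}c_{\eta\kappa}x^\kappa$ with $\mathcal D_jE_\eta=\overline\eta_jE_\eta$ for all $j$. $P_\lambda$ is the unique multiple of $\sum_{\sigma\in\mathcal S_n}E_\lambda(\sigma x)$ whose coefficient of $x^\lambda$ equals $1$. *)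

theory Defs
  imports "HOL-Analysis.Analysis" "HOL-Combinatorics.Combinatorics"
begin

(* Conventions: n :: nat is the dimension; coordinates are indexed 0..n-1
   (paper: 1..n). Points of R^n are functions x :: nat => real, only the
   coordinates i < n matter. Multi-indices eta in N_0^n are lists of length n.
   Polynomials are finitely supported coefficient functions nat list => complex. *)

type_synonym pt = "nat \<Rightarrow> real"
type_synonym fn = "pt \<Rightarrow> complex"

definition unitv :: "nat \<Rightarrow> pt" where
  "unitv j = (\<lambda>m. if m = j then 1 else 0)"

definition sw :: "nat \<Rightarrow> nat \<Rightarrow> pt \<Rightarrow> pt" where
  "sw i j x = x(i := x j, j := x i)"

definition dirderiv :: "pt \<Rightarrow> fn \<Rightarrow> pt \<Rightarrow> complex" where
  "dirderiv xi f x = vector_derivative (\<lambda>t::real. f (\<lambda>m. x m + t * xi m)) (at 0)"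

text \<open>Difference quotient (f(x) - f(s_ij x))/(x_i - x_j), with its continuous
  extension (d_i - d_j) f (x) on the hyperplane x_i = x_j.\<close>
definition dq :: "fn \<Rightarrow> nat \<Rightarrow> nat \<Rightarrow> pt \<Rightarrow> complex" where
  "dq f i j x = (if x i = x j then dirderiv (\<lambda>m. unitv i m - unitv j m) f x
                 else (f x - f (sw i j x)) / of_real (x i - x j))"

definition dunkl_dir :: "real \<Rightarrow> nat \<Rightarrow> pt \<Rightarrow> fn \<Rightarrow> fn" where
  "dunkl_dir k n xi f = (\<lambda>x. dirderiv xi f x +
      of_real k * (\<Sum>i<n. \<Sum>j\<in>{i<..<n}. of_real (xi i - xi j) * dq f i j x))"

definition dunkl :: "real \<Rightarrow> nat \<Rightarrow> nat \<Rightarrow> fn \<Rightarrow> fn" where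
  "dunkl k n j = dunkl_dir k n (unitv j)"

definition dunkl_mono :: "real \<Rightarrow> nat \<Rightarrow> nat list \<Rightarrow> fn \<Rightarrow> fn" where
  "dunkl_mono k n kappa = foldr (\<lambda>j g. (dunkl k n j ^^ (kappa ! j)) \<circ> g) [0..<n] id"

definition mono :: "nat \<Rightarrow> nat list \<Rightarrow> (nat \<Rightarrow> real) \<Rightarrow> complex" where
  "mono n kappa x = (\<Prod>i<n. of_real (x i) ^ (kappa ! i))"

definition peval :: "nat \<Rightarrow> (nat list \<Rightarrow> complex) \<Rightarrow> fn" where
  "peval n c x = (\<Sum>kappa\<in>{kappa. c kappa \<noteq> 0}. c kappa * mono n kappa x)"

definition polyT :: "real \<Rightarrow> nat \<Rightarrow> (nat list \<Rightarrow> complex) \<Rightarrow> fn \<Rightarrow> fn" where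
  "polyT k n c f = (\<lambda>x. \<Sum>kappa\<in>{kappa. c kappa \<noteq> 0}. c kappa * dunkl_mono k n kappa f x)"

definition Delta :: "nat \<Rightarrow> pt \<Rightarrow> real" where
  "Delta n x = (\<Prod>j<n. x j)"

definition Delta_pow :: "nat \<Rightarrow> complex \<Rightarrow> fn" where
  "Delta_pow n mu x = exp (- mu * Ln (of_real (Delta n x)))"

definition gen_poch :: "real \<Rightarrow> nat \<Rightarrow> complex \<Rightarrow> nat list \<Rightarrow> complex" where
  "gen_poch k n mu eta = (\<Prod>j<n. pochhammer (mu - of_real (k * real j)) (eta ! j))"

definition dec_rearr :: "nat list \<Rightarrow> nat list" where
  "dec_rearr eta = rev (sort eta)"

definition dom_le :: "nat list \<Rightarrow> nat list \<Rightarrow> bool" where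
  "dom_le mu lam \<longleftrightarrow> sum_list mu = sum_list lam \<and>
     (\<forall>m. sum_list (take m mu) \<le> sum_list (take m lam))"

definition inv_len :: "nat \<Rightarrow> (nat \<Rightarrow> nat) \<Rightarrow> nat" where
  "inv_len n w = card {(i, j). i < j \<and> j < n \<and> w i > w j}"

definition bruhat_step :: "nat \<Rightarrow> ((nat \<Rightarrow> nat) \<times> (nat \<Rightarrow> nat)) set" where
  "bruhat_step n = {(w, w \<circ> Transposition.transpose i j) | w i j. w permutes {..<n} \<and> i < n \<and> j < n \<and> i \<noteq> j
       \<and> inv_len n w < inv_len n (w \<circ> Transposition.transpose i j)}"

definition bruhat_less :: "nat \<Rightarrow> (nat \<Rightarrow> nat) \<Rightarrow> (nat \<Rightarrow> nat) \<Rightarrow> bool" where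
  "bruhat_less n u v \<longleftrightarrow> (u, v) \<in> (bruhat_step n)\<^sup>+"

definition w_of :: "nat \<Rightarrow> nat list \<Rightarrow> (nat \<Rightarrow> nat)" where
  "w_of n eta = (ARG_MIN (inv_len n) w. w permutes {..<n} \<and> permute_list w (dec_rearr eta) = eta)"

definition prec :: "nat \<Rightarrow> nat list \<Rightarrow> nat list \<Rightarrow> bool" where
  "prec n kappa eta \<longleftrightarrow> length kappa = n \<and> length eta = n \<and>
     ((dom_le (dec_rearr kappa) (dec_rearr eta) \<and> dec_rearr kappa \<noteq> dec_rearr eta) \<or>
      (dec_rearr kappa = dec_rearr eta \<and> bruhat_less n (w_of n eta) (w_of n kappa)))"

definition jackD :: "real \<Rightarrow> nat \<Rightarrow> nat \<Rightarrow> fn \<Rightarrow> fn" where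
  "jackD k n j f = (\<lambda>x. of_real (x j) * dunkl k n j f x + of_real (k * (1 - real n)) * f x
       + of_real k * (\<Sum>i\<in>{j<..<n}. f (sw i j x)))"

definition ebar :: "real \<Rightarrow> nat list \<Rightarrow> nat \<Rightarrow> real" where
  "ebar k eta j = real (eta ! j) - k * real (card {i. i < j \<and> eta ! i \<ge> eta ! j})
       - k * real (card {i. j < i \<and> i < length eta \<and> eta ! i > eta ! j})"

definition E_coeff :: "real \<Rightarrow> nat \<Rightarrow> nat list \<Rightarrow> (nat list \<Rightarrow> complex)" where
  "E_coeff k n eta = (THE c. c eta = 1 \<and> (\<forall>kappa. c kappa \<noteq> 0 \<longrightarrow> kappa = eta \<or> prec n kappa eta)
      \<and> (\<forall>j<n. \<forall>x. jackD k n j (peval n c) x = of_real (ebar k eta j) * peval n c x))"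

text \<open>Coefficients of sum over sigma of E_lam(sigma x).\<close>
definition symm_coeff :: "nat \<Rightarrow> (nat list \<Rightarrow> complex) \<Rightarrow> (nat list \<Rightarrow> complex)" where
  "symm_coeff n c = (\<lambda>kappa. \<Sum>s\<in>{s. s permutes {..<n}}. c (permute_list s kappa))"

definition P_coeff :: "real \<Rightarrow> nat \<Rightarrow> nat list \<Rightarrow> (nat list \<Rightarrow> complex)" where
  "P_coeff k n lam = (THE c. (\<exists>a. c = (\<lambda>kappa. a * symm_coeff n (E_coeff k n lam) kappa)) \<and> c lam = 1)"

end

theory Submission
  imports Defs
begin

text \<open>
  Writing functions on the complement of the coordinate hyperplanes as
  \<open>Delta(x)^(-mu) g(1/x)\<close>, the Dunkl operator \<open>T_j\<close> acts on \<open>g\<close> as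
  \<open>S_j = - y_j (mu + D_j + k \<Sum>i<j. s_ij)\<close>. Hence \<open>p(T) Delta^(-mu)\<close> corresponds to
  \<open>L p = p(S) 1\<close>, where \<open>L\<close> commutes with permutations and satisfies \<open>L (y_j p) = S_j (L p)\<close>.
  All \<open>E_eta\<close> arise from \<open>1\<close> by two kinds of steps: \<open>f \<mapsto> s_i f + a f\<close>, which \<open>L\<close> respects, and the
  affine shift \<open>f \<mapsto> x_n f(x_n, x_1, \<dots>, x_(n-1))\<close>, on which \<open>L\<close> picks up the factor
  \<open>-(mu + ebar_1)\<close>, because \<open>S_n\<close> composed with the rotation is \<open>-y_n\<close> times the rotation of
  \<open>mu + D_1\<close>. The product of these factors is the generalised Pochhammer symbol up to sign.

  The operators \<open>D_j\<close> are triangular on monomials and the eigenvalue tuples separate exponents.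
  So every exponent of a joint eigenfunction that is maximal for \<open>prec\<close> is the one labelling its eigenvalues,
  which gives both the uniqueness and the triangular shape required of \<open>E_eta\<close>.
\<close>

subsection \<open>Ranks of compositions and the order on exponents\<close>

text \<open>\<open>Delta_pow\<close> is differentiable only off the coordinate hyperplanes, so
  identities about it hold there only, and yet the operators are iterated. The substitution y = 1/x
  removes this obstacle: the conjugated operators act on polynomials in y, where equality off the
  hyperplanes implies equality. The rule L (y_j p) = S_j (L p) presupposes that the S_j commute,
  because \<open>dunkl_mono\<close> composes the operators in a fixed order. This rests on the cross
  relations between T_j and the coordinates: since the twist inverts coordinates, multiplication by
  x_m lowers the degree in y and leads back to constants. The shift k(1-n) in \<open>jackD\<close>
  is the contribution of the n-1 identity terms in -k times the sum of 1 - s_jl, which is how D_j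
  appears inside S_j. The condition k >= 0 enters through eigenvalue gaps: unequal entries have
  eigenvalues at least 1 + k apart, so the constant a of a swap step, k divided by a gap, satisfies
  |a| < 1. Hence no swap step produces 0, and the factors 1 + a cannot annihilate the
  symmetrisation, which is what allows P_lam to be normalised.\<close>

abbreviation tau :: "nat \<Rightarrow> nat \<Rightarrow> nat \<Rightarrow> nat" where
  "tau \<equiv> Transposition.transpose"

lemmas tau_def = Transposition.transpose_def

text \<open>The total order on positions used by a stable decreasing sort. Leading coefficients of
  the operators D_j are governed by this order.\<close>

definition precedes :: "nat list \<Rightarrow> nat \<Rightarrow> nat \<Rightarrow> bool" where
  "precedes eta i j \<longleftrightarrow> eta ! j < eta ! i \<or> eta ! i = eta ! j \<and> i < j"

text \<open>The position that a stable decreasing sort assigns to j. It turns out to be the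
  permutation w_eta and also the multiple of k subtracted in \<open>ebar\<close>. The value j
  outside the list makes it a permutation in the sense of \<open>permutes\<close>.\<close>

definition rank_of :: "nat list \<Rightarrow> nat \<Rightarrow> nat" where
  "rank_of eta j = (if j < length eta then card {i. i < length eta \<and> precedes eta i j} else j)"

definition swap_list :: "nat \<Rightarrow> nat \<Rightarrow> nat list \<Rightarrow> nat list" where
  "swap_list i j eta = permute_list (tau i j) eta"

lemma precedes_irrefl [simp]: "\<not> precedes eta i i"
  by (simp add: precedes_def)

lemma precedes_trans: "precedes eta i j \<Longrightarrow> precedes eta j l \<Longrightarrow> precedes eta i l"
  by (auto simp: precedes_def)

lemma precedes_linear: "i \<noteq> j \<Longrightarrow> precedes eta i j \<or> precedes eta j i"
  by (auto simp: precedes_def)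

lemma rank_of_mono:
  assumes "precedes eta i j" "i < length eta" "j < length eta"
  shows "rank_of eta i < rank_of eta j"
proof -
  let ?A = "\<lambda>j. {l. l < length eta \<and> precedes eta l j}"
  have "?A i \<subseteq> ?A j" using precedes_trans[OF _ assms(1)] by blast
  moreover have "i \<in> ?A j" "i \<notin> ?A i" using assms by auto
  ultimately have "?A i \<subset> ?A j" by blast
  then show ?thesis
    using assms by (simp add: rank_of_def psubset_card_mono)
qed

lemma rank_of_less_iff:
  assumes "i < length eta" "j < length eta"
  shows "rank_of eta i < rank_of eta j \<longleftrightarrow> precedes eta i j"
  using assms rank_of_mono precedes_linear by (metis less_asym nat_neq_iff)

lemma rank_of_less_length:
  assumes "j < length eta"
  shows "rank_of eta j < length eta"
proof -
  have "card {i. i < length eta \<and> precedes eta i j} \<le> card ({..<length eta} - {j})"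
    by (rule card_mono) auto
  then show ?thesis
    using assms by (simp add: rank_of_def)
qed

lemma rank_of_permutes: "rank_of eta permutes {..<length eta}"
proof (rule bij_imp_permutes)
  have "inj_on (rank_of eta) {..<length eta}"
    by (rule inj_onI) (metis lessThan_iff less_irrefl precedes_linear rank_of_mono)
  then show "bij_betw (rank_of eta) {..<length eta} {..<length eta}"
    by (intro bij_betw_imageI endo_inj_surj) (auto simp: rank_of_less_length)
qed (simp add: rank_of_def)

section \<open>Decreasing rearrangements\<close>

lemma length_dec_rearr [simp]: "length (dec_rearr eta) = length eta"
  by (simp add: dec_rearr_def)

lemma mset_dec_rearr [simp]: "mset (dec_rearr eta) = mset eta"
  by (simp add: dec_rearr_def)

lemma dec_rearr_eq_iff: "dec_rearr xs = dec_rearr ys \<longleftrightarrow> mset xs = mset ys"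
proof
  assume "dec_rearr xs = dec_rearr ys"
  then show "mset xs = mset ys" using mset_dec_rearr[of xs] mset_dec_rearr[of ys] by simp
next
  assume "mset xs = mset ys"
  then show "dec_rearr xs = dec_rearr ys"
    using properties_for_sort[of "sort ys" xs] by (simp add: dec_rearr_def)
qed

lemma sorted_dec_rearr: "sorted_wrt (\<ge>) (dec_rearr eta)"
  by (simp add: dec_rearr_def sorted_wrt_rev)

lemma dec_rearr_eqI: "sorted_wrt (\<ge>) xs \<Longrightarrow> mset xs = mset eta \<Longrightarrow> dec_rearr eta = xs"
  using properties_for_sort[of "rev xs" eta] by (simp add: dec_rearr_def sorted_wrt_rev)

lemma dec_rearr_nth_mono:
  "i \<le> j \<Longrightarrow> j < length eta \<Longrightarrow> dec_rearr eta ! j \<le> dec_rearr eta ! i"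
  using sorted_dec_rearr[of eta] by (cases "i = j") (auto simp: sorted_wrt_iff_nth_less)

text \<open>Entries listed by rank are weakly decreasing with the same multiset, so this list is
  \<open>dec_rearr eta\<close>; composing with \<open>rank_of eta\<close> undoes the sort.\<close>

lemma permute_list_rank_of: "permute_list (rank_of eta) (dec_rearr eta) = eta"
proof -
  let ?n = "length eta"
  let ?r = "rank_of eta"
  note p = rank_of_permutes[of eta]
  have pi: "inv ?r permutes {..<?n}" by (rule permutes_inv[OF p])
  have "dec_rearr eta = permute_list (inv ?r) eta"
  proof (rule dec_rearr_eqI)
    show "mset (permute_list (inv ?r) eta) = mset eta"
      using pi by simp
    show "sorted_wrt (\<ge>) (permute_list (inv ?r) eta)"
      unfolding sorted_wrt_iff_nth_less
    proof (intro allI impI)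
      fix i j assume ij: "i < j" "j < length (permute_list (inv ?r) eta)"
      have b: "inv ?r i < ?n" "inv ?r j < ?n"
        using ij permutes_in_image[OF pi] by auto
      have "?r (inv ?r i) < ?r (inv ?r j)"
        using ij p by (simp add: permutes_inverses)
      then have "precedes eta (inv ?r i) (inv ?r j)"
        using b rank_of_less_iff by blast
      then show "permute_list (inv ?r) eta ! j \<le> permute_list (inv ?r) eta ! i"
        using ij pi by (auto simp: permute_list_nth precedes_def)
    qed
  qed
  then have "permute_list ?r (dec_rearr eta) = permute_list (inv ?r \<circ> ?r) eta"
    using permute_list_compose[OF p] by simp
  then show ?thesis
    using permutes_inv_o(2)[OF p] by simp
qed

lemma dec_rearr_nth_rank_of: "j < length eta \<Longrightarrow> dec_rearr eta ! rank_of eta j = eta ! j"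
  using permute_list_rank_of[of eta] rank_of_permutes[of eta]
    permute_list_nth[of "rank_of eta" "dec_rearr eta" j] by simp

text \<open>Conjugating by the transposition sends inversions to inversions, except for those
  pairs whose order it reverses; these remain inversions themselves.\<close>
lemma inv_len_transpose_less:
  assumes ij: "i < j" "j < n" "w i < w j"
  shows "inv_len n w < inv_len n (w \<circ> tau i j)"
proof -
  let ?t = "tau i j"
  define I where "I = {(p, q). p < q \<and> q < n \<and> w p > w q}"
  define I' where "I' = {(p, q). p < q \<and> q < n \<and> (w \<circ> ?t) p > (w \<circ> ?t) q}"
  define F where "F = (\<lambda>(p, q). if ?t p < ?t q then (?t p, ?t q) else (p, q))"
  have fin: "finite I'"
    by (rule finite_subset[of _ "{..<n} \<times> {..<n}"]) (auto simp: I'_def)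
  have ij': "(i, j) \<in> I'"
    using ij by (simp add: I'_def)
  have tn: "?t p < n" if "p < n" for p
    using that ij by (auto simp: tau_def)
  have sub: "F ` I \<subseteq> I' - {(i, j)}"
  proof (rule image_subsetI)
    fix a assume "a \<in> I"
    moreover obtain p q where a: "a = (p, q)" by (cases a)
    ultimately have h: "p < q" "q < n" "w p > w q" by (auto simp: I_def)
    show "F a \<in> I' - {(i, j)}"
    proof (cases "?t p < ?t q")
      case True
      have "(?t p, ?t q) \<noteq> (i, j)"
        using h ij by (auto simp: tau_def split: if_splits)
      then show ?thesis
        using True h tn by (simp add: a F_def I'_def)
    next
      case False
      \<comment> \<open>Only pairs formed by i or j and a position between them can be reversed. For
        (i, q) one gets w j > w i > w q, for (p, j) one gets w p > w j > w i; the pair (i, j) is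
        itself no inversion of w.\<close>
      then have "(p = i \<and> i < q \<and> q \<le> j) \<or> (q = j \<and> i \<le> p \<and> p < j)"
        using h ij by (auto simp: tau_def split: if_splits)
      then have "w (?t p) > w (?t q) \<and> (p, q) \<noteq> (i, j)"
        using h ij by (auto simp: tau_def)
      then show ?thesis
        using False h by (simp add: a F_def I'_def)
    qed
  qed
  have inj: "inj_on F I"
  proof (rule inj_onI)
    fix a b assume ab: "a \<in> I" "b \<in> I" "F a = F b"
    obtain p q p' q' where [simp]: "a = (p, q)" "b = (p', q')" by (cases a, cases b)
    have h: "p < q" "p' < q'" using ab by (auto simp: I_def)
    have tt: "?t (?t x) = x" for x by simp
    show "a = b"
      \<comment> \<open>In the mixed case (p', q') = (t p, t q), so t p' = p < q = t q', against the
        branch taken for the second pair.\<close>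
      using ab(3) h unfolding F_def by (simp split: if_splits) (metis tt order_less_asym)+
  qed
  have "card I = card (F ` I)" using inj by (simp add: card_image)
  also have "\<dots> \<le> card (I' - {(i, j)})" using sub fin by (intro card_mono) auto
  also have "\<dots> < card I'" using ij' fin by (meson card_Diff1_less)
  finally show ?thesis by (simp add: inv_len_def I_def I'_def)
qed

section \<open>Bruhat order and shortest sorting permutations\<close>

lemma bruhat_less_imp_inv_len_less:
  assumes "bruhat_less n u v"
  shows "inv_len n u < inv_len n v"
proof -
  have step: "inv_len n u < inv_len n v" if "(u, v) \<in> bruhat_step n" for u v
    using that unfolding bruhat_step_def by blast
  show ?thesis
    using assms unfolding bruhat_less_def
    by (induction rule: trancl_induct) (auto dest: step)
qed

text \<open>A shortest w must increase along equal entries: otherwise composing with a transposition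
  still sorts and removes inversions. Between unequal entries the order is dictated by the
  decreasing list. So w compares positions exactly as \<open>precedes\<close> does, which pins it
  down, and the choice hidden in \<open>ARG_MIN\<close> becomes harmless.\<close>

lemma w_of_eq_rank_of:
  assumes n: "length eta = n"
  shows "w_of n eta = rank_of eta"
proof -
  define P where "P = (\<lambda>w. w permutes {..<n} \<and> permute_list w (dec_rearr eta) = eta)"
  have P0: "P (rank_of eta)"
    using rank_of_permutes permute_list_rank_of n by (auto simp: P_def)
  have uniq: "w = rank_of eta" if am: "is_arg_min (inv_len n) P w" for w
  proof -
    have Pw: "P w" and least: "\<And>v. P v \<Longrightarrow> \<not> inv_len n v < inv_len n w"
      using am by (auto simp: is_arg_min_def)
    have w: "w permutes {..<n}" and weq: "permute_list w (dec_rearr eta) = eta"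
      using Pw by (auto simp: P_def)
    have nth: "eta ! i = dec_rearr eta ! w i" if "i < n" for i
      using that weq w n permute_list_nth[of w "dec_rearr eta" i] by simp
    have wn: "w i < n" if "i < n" for i
      using that permutes_in_image[OF w] by auto
    have injw: "w i = w j \<longleftrightarrow> i = j" for i j
      using permutes_inj[OF w] by (auto dest: injD)
    have incr: "w i < w j" if ij: "i < j" "j < n" "eta ! i = eta ! j" for i j
    proof (rule ccontr)
      assume "\<not> w i < w j"
      then have "w j < w i" using ij injw[of i j] by auto
      let ?t = "tau i j"
      have t: "?t permutes {..<n}" using ij by (intro permutes_swap_id) auto
      have wt: "w \<circ> ?t permutes {..<n}" by (rule permutes_compose[OF t w])
      have "inv_len n (w \<circ> ?t) < inv_len n (w \<circ> ?t \<circ> ?t)"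
        by (rule inv_len_transpose_less) (use ij \<open>w j < w i\<close> in auto)
      then have "inv_len n (w \<circ> ?t) < inv_len n w"
        by (simp add: comp_assoc)
      moreover have "P (w \<circ> ?t)"
      proof -
        have "permute_list (w \<circ> ?t) (dec_rearr eta) = permute_list ?t eta"
          using permute_list_compose[of ?t "dec_rearr eta" w] t n weq by simp
        also have "\<dots> = eta"
          using t n ij by (intro nth_equalityI) (auto simp: permute_list_nth tau_def)
        finally show ?thesis using wt by (simp add: P_def)
      qed
      ultimately show False using least by blast
    qed
    have iff: "w i < w j \<longleftrightarrow> precedes eta i j" if ij: "i < n" "j < n" for i j
    proof -
      have 1: "w i < w j" if "precedes eta i j" "i < n" "j < n" for i j
      proof (cases "eta ! i = eta ! j")
        case True then show ?thesis using that incr by (auto simp: precedes_def)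
      next
        case False
        then have "dec_rearr eta ! w j < dec_rearr eta ! w i"
          using that nth by (auto simp: precedes_def)
        then show ?thesis
          using dec_rearr_nth_mono[of "w j" "w i" eta] wn n that by (metis leD leI)
      qed
      show ?thesis using 1 ij precedes_linear by (metis less_asym less_irrefl)
    qed
    show ?thesis
    proof
      fix j show "w j = rank_of eta j"
      proof (cases "j < n")
        case True
        \<comment> \<open>As w is a bijection, w j is the number of positions with a smaller value,
          which is the count defining the rank.\<close>
        have "w ` {i. i < n \<and> w i < w j} = {..<w j}"
        proof (intro equalityI subsetI)
          fix p assume p: "p \<in> {..<w j}"
          then have "p < n" using wn[OF True] by simp
          then have "inv w p < n" using permutes_in_image[OF permutes_inv[OF w]] by auto
          then show "p \<in> w ` {i. i < n \<and> w i < w j}"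
            using p w by (intro image_eqI[of _ _ "inv w p"]) (auto simp: permutes_inverses)
        qed auto
        then have "w j = card (w ` {i. i < n \<and> w i < w j})" by simp
        also have "\<dots> = card {i. i < n \<and> w i < w j}"
          by (rule card_image) (auto simp: inj_on_def injw)
        also have "{i. i < n \<and> w i < w j} = {i. i < n \<and> precedes eta i j}"
          using iff True by auto
        finally show ?thesis using True n by (simp add: rank_of_def)
      next
        case False then show ?thesis using permutes_not_in[OF w] n by (simp add: rank_of_def)
      qed
    qed
  qed
  obtain w where "P w" "\<And>v. P v \<Longrightarrow> inv_len n w \<le> inv_len n v"
    using ex_has_least_nat[of P, OF P0] by metis
  then have "is_arg_min (inv_len n) P w"
    by (auto simp: is_arg_min_def not_less)
  then have "is_arg_min (inv_len n) P (arg_min (inv_len n) P)"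
    unfolding arg_min_def by (rule someI[where P = "is_arg_min (inv_len n) P"])
  then have "arg_min (inv_len n) P = rank_of eta" by (rule uniq)
  then show ?thesis by (simp add: w_of_def P_def)
qed

section \<open>Swapping two entries of an exponent\<close>

lemma transpose_permutes: "i < n \<Longrightarrow> j < n \<Longrightarrow> tau i j permutes {..<n}"
  by (rule permutes_swap_id) auto

lemma length_swap_list [simp]: "length (swap_list i j eta) = length eta"
  by (simp add: swap_list_def)

lemma mset_swap_list [simp]:
  "i < length eta \<Longrightarrow> j < length eta \<Longrightarrow> mset (swap_list i j eta) = mset eta"
  by (simp add: swap_list_def transpose_permutes)

lemma swap_list_nth:
  assumes "i < length eta" "j < length eta" "m < length eta"
  shows "swap_list i j eta ! m = eta ! tau i j m"
  using assms by (simp add: swap_list_def permute_list_nth transpose_permutes)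

text \<open>Ties are the only danger, as they are broken by position. Since no entry strictly
  between i and j equals a swapped value, the transposition preserves the order of tied positions
  and hence carries \<open>precedes\<close> over.\<close>

lemma rank_of_swap_list:
  assumes ij: "i < j" "j < length eta" "eta ! i \<noteq> eta ! j"
    and between: "\<And>m. i < m \<Longrightarrow> m < j \<Longrightarrow> eta ! m \<noteq> eta ! i \<and> eta ! m \<noteq> eta ! j"
  shows "rank_of (swap_list i j eta) = rank_of eta \<circ> tau i j"
proof
  fix l
  let ?t = "tau i j"
  let ?n = "length eta"
  show "rank_of (swap_list i j eta) l = (rank_of eta \<circ> ?t) l"
  proof (cases "l < ?n")
    case False
    then show ?thesis using ij by (simp add: rank_of_def)
  next
    case True
    have bt: "m \<le> i \<or> j \<le> m \<or> eta ! m \<noteq> eta ! i \<and> eta ! m \<noteq> eta ! j" for m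
      using between[of m] by linarith
    have tl: "?t l < ?n" using True ij by (auto simp: tau_def)
    have iff: "precedes (swap_list i j eta) m l \<longleftrightarrow> precedes eta (?t m) (?t l)" if "m < ?n" for m
    proof (cases "eta ! ?t m = eta ! ?t l")
      case eq: True
      have "m < l \<longleftrightarrow> ?t m < ?t l"
        using eq ij bt[of m] bt[of l] that True
        by (auto simp: tau_def split: if_splits)
      then show ?thesis using ij that True by (simp add: precedes_def swap_list_nth)
    next
      case False
      then show ?thesis using ij that True by (simp add: precedes_def swap_list_nth)
    qed
    have "bij_betw ?t {m. m < ?n \<and> precedes (swap_list i j eta) m l}
            {m. m < ?n \<and> precedes eta m (?t l)}"
    proof (rule bij_betwI[where g = ?t])
      show "?t \<in> {m. m < ?n \<and> precedes (swap_list i j eta) m l} \<rightarrow> {m. m < ?n \<and> precedes eta m (?t l)}"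
        using iff ij by (auto simp: tau_def)
      show "?t \<in> {m. m < ?n \<and> precedes eta m (?t l)} \<rightarrow> {m. m < ?n \<and> precedes (swap_list i j eta) m l}"
      proof
        fix m assume m: "m \<in> {m. m < ?n \<and> precedes eta m (?t l)}"
        then have "?t m < ?n" using ij by (auto simp: tau_def)
        then show "?t m \<in> {m. m < ?n \<and> precedes (swap_list i j eta) m l}"
          using iff[of "?t m"] m by simp
      qed
    qed auto
    from bij_betw_same_card[OF this] show ?thesis
      using True tl by (simp add: rank_of_def)
  qed
qed

text \<open>If a value strictly between the positions \<open>i\<close> and \<open>j\<close> equals one of the two swapped
  values, the swap factors into two swaps over shorter distances.\<close>
lemma bruhat_less_swap_list:
  assumes "i < j" "j < length eta" "eta ! j < eta ! i"
  shows "bruhat_less (length eta) (rank_of eta) (rank_of (swap_list i j eta))"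
  using assms
proof (induction "j - i" arbitrary: i j eta rule: less_induct)
  case less
  let ?n = "length eta"
  have step: ?case if m: "i < m" "m < j" and
      e: "eta ! m = eta ! i \<or> eta ! m = eta ! j" for m
  proof -
    consider "eta ! m = eta ! i" | "eta ! m = eta ! j" using e by blast
    then show ?thesis
    proof cases
      case 1
      let ?k = "swap_list m j eta"
      have "bruhat_less ?n (rank_of eta) (rank_of ?k)"
        using less.hyps[of j m eta] less.prems m 1 by auto
      moreover have "bruhat_less ?n (rank_of ?k) (rank_of (swap_list i m ?k))"
        using less.hyps[of m i ?k] less.prems m 1 by (auto simp: swap_list_nth tau_def)
      moreover have "swap_list i m ?k = swap_list i j eta"
        using less.prems m 1 by (intro nth_equalityI) (auto simp: swap_list_nth tau_def)
      ultimately show ?thesis unfolding bruhat_less_def by (metis trancl_trans)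
    next
      case 2
      let ?k = "swap_list i m eta"
      have "bruhat_less ?n (rank_of eta) (rank_of ?k)"
        using less.hyps[of m i eta] less.prems m 2 by auto
      moreover have "bruhat_less ?n (rank_of ?k) (rank_of (swap_list m j ?k))"
        using less.hyps[of j m ?k] less.prems m 2 by (auto simp: swap_list_nth tau_def)
      moreover have "swap_list m j ?k = swap_list i j eta"
        using less.prems m 2 by (intro nth_equalityI) (auto simp: swap_list_nth tau_def)
      ultimately show ?thesis unfolding bruhat_less_def by (metis trancl_trans)
    qed
  qed
  show ?case
  proof (cases "\<exists>m. i < m \<and> m < j \<and> (eta ! m = eta ! i \<or> eta ! m = eta ! j)")
    case True then show ?thesis using step by blast
  next
    case False
    then have "rank_of (swap_list i j eta) = rank_of eta \<circ> tau i j"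
      using less.prems by (intro rank_of_swap_list) auto
    moreover have "rank_of eta i < rank_of eta j"
      using less.prems by (intro rank_of_mono) (auto simp: precedes_def)
    then have "inv_len ?n (rank_of eta) < inv_len ?n (rank_of eta \<circ> tau i j)"
      using less.prems by (intro inv_len_transpose_less) auto
    then have "(rank_of eta, rank_of eta \<circ> tau i j) \<in> bruhat_step ?n"
      unfolding bruhat_step_def mem_Collect_eq using less.prems rank_of_permutes[of eta]
      by (intro exI[of _ "rank_of eta"] exI[of _ i] exI[of _ j]) simp
    ultimately show ?thesis unfolding bruhat_less_def by auto
  qed
qed

lemma prec_swap_list:
  assumes "length eta = n" "i < j" "j < n" "eta ! j < eta ! i"
  shows "prec n (swap_list i j eta) eta"
proof -
  have "dec_rearr (swap_list i j eta) = dec_rearr eta"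
    using assms by (simp add: dec_rearr_eq_iff)
  then show ?thesis
    using assms bruhat_less_swap_list[of i j eta] by (simp add: prec_def w_of_eq_rank_of)
qed

section \<open>Dominance and the strict order on exponents\<close>

lemma dom_le_trans: "dom_le a b \<Longrightarrow> dom_le b c \<Longrightarrow> dom_le a c"
  by (auto simp: dom_le_def intro: order_trans)

lemma dom_le_antisym:
  assumes "dom_le a b" "dom_le b a" "length a = length b"
  shows "a = b"
proof (rule nth_equalityI)
  fix i assume i: "i < length a"
  have t: "sum_list (take m a) = sum_list (take m b)" for m
    using assms by (auto simp: dom_le_def intro: antisym)
  show "a ! i = b ! i"
    using t[of i] t[of "Suc i"] i assms(3) by (simp add: take_Suc_conv_app_nth)
qed (use assms in simp)

lemma prec_irrefl: "\<not> prec n eta eta"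
  using bruhat_less_imp_inv_len_less by (auto simp: prec_def)

lemma prec_trans:
  assumes "prec n a b" "prec n b c"
  shows "prec n a c"
proof -
  have len: "length a = n" "length b = n" "length c = n"
    using assms by (auto simp: prec_def)
  consider "dec_rearr a = dec_rearr b" "dec_rearr b = dec_rearr c"
    | "dec_rearr a \<noteq> dec_rearr b" | "dec_rearr b \<noteq> dec_rearr c" by blast
  then show ?thesis
  proof cases
    case 1
    then have "bruhat_less n (w_of n b) (w_of n a)" "bruhat_less n (w_of n c) (w_of n b)"
      using assms by (auto simp: prec_def)
    then have "bruhat_less n (w_of n c) (w_of n a)"
      unfolding bruhat_less_def by (rule trancl_trans[rotated])
    then show ?thesis using 1 len by (simp add: prec_def)
  next
    case 2
    then have ab: "dom_le (dec_rearr a) (dec_rearr b)" using assms(1) by (auto simp: prec_def)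
    have bc: "dom_le (dec_rearr b) (dec_rearr c)" using assms(2) by (auto simp: prec_def dom_le_def)
    have "dec_rearr a \<noteq> dec_rearr c"
      using dom_le_antisym[OF ab] bc 2 len by auto
    then show ?thesis using dom_le_trans[OF ab bc] len by (simp add: prec_def)
  next
    case 3
    then have bc: "dom_le (dec_rearr b) (dec_rearr c)" using assms(2) by (auto simp: prec_def)
    have ab: "dom_le (dec_rearr a) (dec_rearr b)" using assms(1) by (auto simp: prec_def dom_le_def)
    have "dec_rearr a \<noteq> dec_rearr c"
      using dom_le_antisym[OF bc] ab 3 len by auto
    then show ?thesis using dom_le_trans[OF ab bc] len by (simp add: prec_def)
  qed
qed

text \<open>Dominance expressed without sorting, through the excess over a threshold t (truncated
  subtraction). Any m entries sum to at most m * t plus the total excess over t, with equality for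
  the m largest when t is entry m of the sorted list, counted from 0.\<close>

lemma dom_le_dec_rearrI:
  assumes len: "length kappa = length eta" and sum: "sum_list kappa = sum_list eta"
    and excess: "\<And>t. (\<Sum>a\<leftarrow>kappa. a - t) \<le> (\<Sum>a\<leftarrow>eta. a - t)"
  shows "dom_le (dec_rearr kappa) (dec_rearr eta)"
proof -
  have sl: "sum_list (dec_rearr xs) = sum_list xs" for xs :: "nat list"
    by (metis mset_dec_rearr sum_mset_sum_list)
  have ex: "(\<Sum>a\<leftarrow>dec_rearr xs. a - t) = (\<Sum>a\<leftarrow>xs. a - t)" for xs :: "nat list" and t
    by (metis mset_dec_rearr mset_map sum_mset_sum_list)
  have up: "sum_list (take m xs) \<le> m * t + (\<Sum>a\<leftarrow>xs. a - t)" for m t and xs :: "nat list"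
  proof (induction xs arbitrary: m)
    case (Cons x xs)
    show ?case
    proof (cases m)
      case (Suc m')
      then show ?thesis using Cons[of m'] by simp
    qed simp
  qed simp
  have low: "sum_list (take m xs) = m * (xs ! m) + (\<Sum>a\<leftarrow>xs. a - xs ! m)"
    if m: "m < length xs" and s: "sorted_wrt (\<ge>) xs" for m and xs :: "nat list"
  proof -
    let ?t = "xs ! m"
    have drop0: "(\<Sum>a\<leftarrow>drop m xs. a - ?t) = 0"
    proof -
      have "a - ?t = 0" if a: "a \<in> set (drop m xs)" for a
      proof -
        obtain i where "i < length xs - m" "a = xs ! (m + i)"
          using a by (auto simp: in_set_conv_nth)
        then have "a \<le> ?t"
          using s m by (cases "i = 0") (auto simp: sorted_wrt_iff_nth_less)
        then show ?thesis by simp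
      qed
      then show ?thesis by (simp add: sum_list_eq_0_iff)
    qed
    have "sum_list ys = length ys * t + (\<Sum>a\<leftarrow>ys. a - t)" if "\<forall>a\<in>set ys. t \<le> a"
      for ys and t :: nat
      using that by (induction ys) auto
    moreover have "\<forall>a\<in>set (take m xs). ?t \<le> a"
      using s m by (auto simp: in_set_conv_nth sorted_wrt_iff_nth_less)
    ultimately have "sum_list (take m xs) = m * ?t + (\<Sum>a\<leftarrow>take m xs. a - ?t)"
      using m by force
    also have "(\<Sum>a\<leftarrow>take m xs. a - ?t) = (\<Sum>a\<leftarrow>take m xs @ drop m xs. a - ?t)"
      unfolding map_append sum_list_append using drop0 by simp
    finally show ?thesis by simp
  qed
  have "sum_list (take m (dec_rearr kappa)) \<le> sum_list (take m (dec_rearr eta))" for m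
  proof (cases "m < length eta")
    case True
    let ?t = "dec_rearr eta ! m"
    have "sum_list (take m (dec_rearr kappa)) \<le> m * ?t + (\<Sum>a\<leftarrow>kappa. a - ?t)"
      using up[of m "dec_rearr kappa" ?t] by (simp add: ex)
    also have "\<dots> \<le> m * ?t + (\<Sum>a\<leftarrow>eta. a - ?t)" using excess by simp
    also have "\<dots> = sum_list (take m (dec_rearr eta))"
      using low[of m "dec_rearr eta"] True by (simp add: ex sorted_dec_rearr)
    finally show ?thesis .
  next
    case False
    then show ?thesis using len by (simp add: sl sum)
  qed
  then show ?thesis by (simp add: dom_le_def sl sum)
qed

text \<open>The new pair lies strictly between the old entries, so convexity of a - t in a lowers
  every excess. This covers all the intermediate exponents in the difference quotient of a monomial,
  regardless of which of i and j comes first.\<close>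

lemma prec_transfer:
  assumes len: "length eta = n" and ij: "i < n" "j < n" "i \<noteq> j"
    and l: "eta ! i + eta ! j = a + b" "a < eta ! i" "b < eta ! i"
  shows "prec n (eta[i := a, j := b]) eta"
proof -
  let ?k = "eta[i := a, j := b]"
  have split: "(\<Sum>x\<leftarrow>xs. f x) = f (xs ! i) + f (xs ! j) + (\<Sum>m\<in>{..<n}-{i,j}. f (xs ! m))"
    if "length xs = n" for xs :: "nat list" and f :: "nat \<Rightarrow> nat"
  proof -
    have "(\<Sum>x\<leftarrow>xs. f x) = (\<Sum>m<n. f (xs ! m))"
      using that by (simp add: sum_list_sum_nth atLeast0LessThan)
    also have "\<dots> = f (xs ! i) + (\<Sum>m\<in>{..<n}-{i}. f (xs ! m))"
      using ij by (subst sum.remove[of _ i]) auto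
    also have "(\<Sum>m\<in>{..<n}-{i}. f (xs ! m)) = f (xs ! j) + (\<Sum>m\<in>{..<n}-{i}-{j}. f (xs ! m))"
      using ij by (subst sum.remove[of _ j]) auto
    finally show ?thesis by (simp add: Diff_insert2[symmetric])
  qed
  have rest: "(\<Sum>m\<in>{..<n}-{i,j}. f (?k ! m)) = (\<Sum>m\<in>{..<n}-{i,j}. f (eta ! m))"
    for f :: "nat \<Rightarrow> nat"
    by (rule sum.cong) auto
  have kk: "?k ! i = a" "?k ! j = b" using ij len by auto
  have ex: "(\<Sum>x\<leftarrow>?k. x - t) \<le> (\<Sum>x\<leftarrow>eta. x - t)" for t
    using split[of ?k "\<lambda>x. x - t"] split[of eta "\<lambda>x. x - t"] rest[of "\<lambda>x. x - t"] len kk l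
    by auto
  have sm: "sum_list ?k = sum_list eta"
    using split[of ?k "\<lambda>x. x"] split[of eta "\<lambda>x. x"] rest[of "\<lambda>x. x"] len kk l by auto
  have "mset ?k \<noteq> mset eta"
  proof
    assume "mset ?k = mset eta"
    then have "(\<Sum>x\<leftarrow>?k. x - t) = (\<Sum>x\<leftarrow>eta. x - t)" for t
      by (metis mset_map sum_mset_sum_list)
    \<comment> \<open>At this threshold the old entry at i has excess 1, while both new entries have
      excess 0.\<close>
    from this[of "eta ! i - 1"] show False
      using split[of ?k "\<lambda>x. x - (eta ! i - 1)"] split[of eta "\<lambda>x. x - (eta ! i - 1)"]
        rest[of "\<lambda>x. x - (eta ! i - 1)"] len kk l by auto
  qed
  then show ?thesis
    using dom_le_dec_rearrI[of ?k eta] ex sm len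
    by (simp add: prec_def dec_rearr_eq_iff)
qed

section \<open>Eigenvalues in terms of ranks\<close>

lemma ebar_eq:
  assumes "j < length eta"
  shows "ebar k eta j = real (eta ! j) - k * real (rank_of eta j)"
proof -
  let ?A = "{i. i < j \<and> eta ! i \<ge> eta ! j}"
  let ?B = "{i. j < i \<and> i < length eta \<and> eta ! i > eta ! j}"
  have "finite ?A" "finite ?B" "?A \<inter> ?B = {}" by auto
  then have "card (?A \<union> ?B) = card ?A + card ?B" by (rule card_Un_disjoint)
  moreover have "{i. i < length eta \<and> precedes eta i j} = ?A \<union> ?B"
    using assms by (auto simp: precedes_def) (metis nat_neq_iff)
  ultimately have "rank_of eta j = card ?A + card ?B"
    using assms by (simp only: rank_of_def if_True)
  then show ?thesis by (simp add: ebar_def algebra_simps)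
qed

lemma ebar_less:
  assumes "k > 0" "precedes eta i j" "i < length eta" "j < length eta"
  shows "ebar k eta j < ebar k eta i"
proof -
  have "real (rank_of eta i) < real (rank_of eta j)" using assms rank_of_mono by simp
  then have "k * real (rank_of eta i) < k * real (rank_of eta j)" using assms(1) by simp
  moreover have "real (eta ! j) \<le> real (eta ! i)" using assms by (auto simp: precedes_def)
  ultimately show ?thesis
    unfolding ebar_eq[OF assms(3)] ebar_eq[OF assms(4)] by linarith
qed

text \<open>For k > 0 the eigenvalues decrease along \<open>precedes\<close>, so their tuple reveals
  the ranks and then the entries. For k = 0 the eigenvalues are the entries.\<close>

lemma ebar_inj:
  assumes k: "k \<ge> 0" and len: "length eta = n" "length kappa = n"
    and eq: "\<And>j. j < n \<Longrightarrow> ebar k kappa j = ebar k eta j"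
  shows "kappa = eta"
proof (rule nth_equalityI)
  fix j assume "j < length kappa"
  then have j: "j < n" using len by simp
  show "kappa ! j = eta ! j"
  proof (cases "k = 0")
    case True
    then show ?thesis using eq[OF j] j len by (simp add: ebar_eq)
  next
    case False
    then have k: "k > 0" using k by simp
    have iff: "precedes xs i j \<longleftrightarrow> i \<noteq> j \<and> ebar k xs j < ebar k xs i"
      if "length xs = n" "i < n" for xs i
      using ebar_less[OF k, of xs i j] ebar_less[OF k, of xs j i] precedes_linear[of i j xs] that j
      by auto
    have "{i. i < n \<and> precedes kappa i j} = {i. i < n \<and> precedes eta i j}"
      using iff len eq j by auto
    then have "rank_of kappa j = rank_of eta j" using j len by (simp add: rank_of_def)
    then show ?thesis using eq[OF j] j len by (simp add: ebar_eq)
  qed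
qed (use len in simp)

text \<open>Indexing the product by positions of the unsorted exponent isolates the factor affected
  when a single entry changes.\<close>

lemma gen_poch_dec_rearr:
  assumes "length eta = n"
  shows "gen_poch k n mu (dec_rearr eta) =
    (\<Prod>j<n. pochhammer (mu - of_real (k * real (rank_of eta j))) (eta ! j))"
  unfolding gen_poch_def using assms rank_of_permutes[of eta]
  by (subst prod.permute[of "rank_of eta"]) (auto simp: dec_rearr_nth_rank_of intro!: prod.cong)

text \<open>Insertion sort behind a growing fixed prefix: the tail is arranged by induction, then
  the head is carried right to its place by adjacent swaps.\<close>

lemma adjacent_swaps_connected:
  assumes swap: "\<And>eta i. length eta = n \<Longrightarrow> Suc i < n \<Longrightarrow> Q eta \<Longrightarrow> Q (swap_list i (Suc i) eta)"
    and "length eta = n" "mset kappa = mset eta" "Q eta"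
  shows "Q kappa"
proof -
  have sw: "Q (xs @ b # a # ys)" if "Q (xs @ a # b # ys)" "length (xs @ a # b # ys) = n" for xs a b ys
  proof -
    have "swap_list (length xs) (Suc (length xs)) (xs @ a # b # ys) = xs @ b # a # ys"
      using that(2) by (intro nth_equalityI) (auto simp: swap_list_nth tau_def nth_append nth_Cons')
    then show ?thesis using swap[of "xs @ a # b # ys" "length xs"] that by simp
  qed
  have move: "Q (xs @ as @ a # bs)" if "Q (xs @ a # as @ bs)" "length (xs @ a # as @ bs) = n" for xs a as bs
    using that
  proof (induction as arbitrary: xs)
    case (Cons c as)
    have "Q (xs @ c # a # as @ bs)" using sw[of xs a c "as @ bs"] Cons.prems by simp
    then show ?case using Cons.IH[of "xs @ [c]"] Cons.prems by simp
  qed simp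
  have "Q (xs @ zs)" if "mset ys = mset zs" "Q (xs @ ys)" "length (xs @ ys) = n" for xs ys zs
    using that
  proof (induction ys arbitrary: xs zs)
    case (Cons y ys)
    from Cons.prems(1) have "y \<in> set zs" by (metis list.set_intros(1) mset_eq_setD)
    then obtain as bs where zs: "zs = as @ y # bs" by (meson split_list)
    then have m: "mset ys = mset (as @ bs)" using Cons.prems(1) by simp
    then have "length ys = length (as @ bs)" by (metis size_mset)
    then show ?case
      using Cons.IH[of "as @ bs" "xs @ [y]"] m Cons.prems move[of xs y as bs] zs by simp
  qed simp
  from this[of eta kappa "[]"] show ?thesis using assms by simp
qed

subsection \<open>Pointwise calculus of Dunkl operators\<close>

text \<open>Only derivatives along single lines enter \<open>dirderiv\<close>. Additivity in the
  direction is not part of this notion; scaling of the direction is derived in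
  \<open>dirderiv_scale\<close> and suffices for the antisymmetry of \<open>dq\<close>.\<close>

definition line_diff :: "fn \<Rightarrow> pt \<Rightarrow> bool" where
  "line_diff f x \<longleftrightarrow> (\<forall>v. (\<lambda>t::real. f (\<lambda>m. x m + t * v m)) differentiable (at 0))"

lemma line_diffI:
  assumes "\<And>v. ((\<lambda>t::real. f (\<lambda>m. x m + t * v m)) has_vector_derivative D v) (at 0)"
  shows "line_diff f x"
  unfolding line_diff_def using assms differentiableI_vector by blast

lemma line_diffD:
  assumes "line_diff f x"
  shows "((\<lambda>t::real. f (\<lambda>m. x m + t * v m)) has_vector_derivative dirderiv v f x) (at 0)"
  using assms unfolding line_diff_def dirderiv_def by (simp add: vector_derivative_works)

lemma dirderivI:
  assumes "((\<lambda>t::real. f (\<lambda>m. x m + t * v m)) has_vector_derivative D) (at 0)"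
  shows "dirderiv v f x = D"
  using assms unfolding dirderiv_def by (rule vector_derivative_at)

lemma has_vector_derivative_add_lines:
  assumes "line_diff f x" "line_diff g x"
  shows "((\<lambda>t::real. f (\<lambda>m. x m + t * v m) + g (\<lambda>m. x m + t * v m))
    has_vector_derivative (dirderiv v f x + dirderiv v g x)) (at 0)"
  using assms by (intro has_vector_derivative_add line_diffD)

lemma line_diff_add: "line_diff f x \<Longrightarrow> line_diff g x \<Longrightarrow> line_diff (\<lambda>x. f x + g x) x"
  by (rule line_diffI, rule has_vector_derivative_add_lines)

lemma dirderiv_add:
  "line_diff f x \<Longrightarrow> line_diff g x \<Longrightarrow> dirderiv v (\<lambda>x. f x + g x) x = dirderiv v f x + dirderiv v g x"
  by (rule dirderivI, rule has_vector_derivative_add_lines)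

lemma has_vector_derivative_cmult_lines:
  assumes "line_diff f x"
  shows "((\<lambda>t::real. c * f (\<lambda>m. x m + t * v m)) has_vector_derivative (c * dirderiv v f x)) (at 0)"
  using assms by (intro has_vector_derivative_mult_right line_diffD)

lemma line_diff_cmult: "line_diff f x \<Longrightarrow> line_diff (\<lambda>x. c * f x) x"
  by (rule line_diffI, rule has_vector_derivative_cmult_lines)

lemma dirderiv_cmult: "line_diff f x \<Longrightarrow> dirderiv v (\<lambda>x. c * f x) x = c * dirderiv v f x"
  by (rule dirderivI, rule has_vector_derivative_cmult_lines)

lemma has_vector_derivative_coord_lines:
  assumes "line_diff f x"
  shows "((\<lambda>t::real. of_real (x l + t * v l) * f (\<lambda>m. x m + t * v m))
    has_vector_derivative (of_real (v l) * f x + of_real (x l) * dirderiv v f x)) (at 0)"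
proof -
  have "((\<lambda>t::real. complex_of_real (x l + t * v l)) has_vector_derivative of_real (v l)) (at 0)"
    by (rule has_vector_derivative_of_real)
       (auto intro!: derivative_eq_intros simp: has_real_derivative_iff_has_vector_derivative[symmetric])
  from has_vector_derivative_mult[OF this line_diffD[OF assms, of v]]
  show ?thesis by (simp add: add.commute)
qed

lemma line_diff_coord: "line_diff f x \<Longrightarrow> line_diff (\<lambda>x. of_real (x l) * f x) x"
  by (rule line_diffI, rule has_vector_derivative_coord_lines)

lemma dirderiv_coord:
  "line_diff f x \<Longrightarrow> dirderiv v (\<lambda>x. of_real (x l) * f x) x
     = of_real (v l) * f x + of_real (x l) * dirderiv v f x"
  by (rule dirderivI, rule has_vector_derivative_coord_lines)

lemma dirderiv_scale:
  assumes "line_diff f x"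
  shows "dirderiv (\<lambda>m. c * v m) f x = of_real c * dirderiv v f x"
proof (rule dirderivI)
  have "((\<lambda>t::real. f (\<lambda>m. x m + t * v m)) has_vector_derivative dirderiv v f x) (at (c * 0))"
    using line_diffD[OF assms] by simp
  moreover have "((\<lambda>t. c * t) has_vector_derivative c) (at 0)"
    by (auto intro!: derivative_eq_intros simp: has_real_derivative_iff_has_vector_derivative[symmetric])
  ultimately have "((\<lambda>t::real. f (\<lambda>m. x m + t * v m)) \<circ> (\<lambda>t. c * t)
      has_vector_derivative c *\<^sub>R dirderiv v f x) (at 0)"
    by (intro vector_diff_chain_at) auto
  then show "((\<lambda>t::real. f (\<lambda>m. x m + t * (c * v m))) has_vector_derivative
      of_real c * dirderiv v f x) (at 0)"
    by (simp add: o_def mult.assoc mult.left_commute scaleR_conv_of_real)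
qed

lemma dirderiv_perm: "dirderiv v (\<lambda>x. f (x \<circ> s)) x = dirderiv (v \<circ> s) f (x \<circ> s)"
  by (simp add: dirderiv_def o_def)

lemma line_diff_perm: "line_diff f (x \<circ> s) \<Longrightarrow> line_diff (\<lambda>x. f (x \<circ> s)) x"
proof (rule line_diffI)
  fix v assume "line_diff f (x \<circ> s)"
  from line_diffD[OF this, of "v \<circ> s"]
  show "((\<lambda>t::real. f ((\<lambda>m. x m + t * v m) \<circ> s)) has_vector_derivative dirderiv (v \<circ> s) f (x \<circ> s)) (at 0)"
    by (simp add: o_def)
qed

section \<open>Reflections, difference quotients and Dunkl operators\<close>

lemma sw_eq: "sw i j x = x \<circ> tau i j"
  by (auto simp: sw_def fun_eq_iff tau_def)

lemma sw_commute: "sw i j x = sw j i x"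
  by (auto simp: sw_def fun_eq_iff)

lemma sw_sw [simp]: "sw i j (sw i j x) = x"
  by (auto simp: sw_def fun_eq_iff)

lemma sw_same: "x i = x j \<Longrightarrow> sw i j x = x"
  by (auto simp: sw_def fun_eq_iff)

lemma sw_comp: "inj s \<Longrightarrow> sw (s i) (s j) x \<circ> s = sw i j (x \<circ> s)"
  by (auto simp: sw_def fun_eq_iff inj_eq)

lemma dq_swap:
  assumes "line_diff f x"
  shows "dq f j i x = - dq f i j x"
proof (cases "x i = x j")
  case True
  have "(\<lambda>m. unitv j m - unitv i m) = (\<lambda>m. (-1) * (unitv i m - unitv j m))" by auto
  then show ?thesis
    using True dirderiv_scale[OF assms, of "-1" "\<lambda>m. unitv i m - unitv j m"] by (simp add: dq_def)
next
  case False
  then show ?thesis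
    by (auto simp: dq_def sw_commute[of j i] divide_simps) (simp add: algebra_simps)
qed

lemma dq_add:
  "line_diff f x \<Longrightarrow> line_diff g x \<Longrightarrow> dq (\<lambda>x. f x + g x) i j x = dq f i j x + dq g i j x"
  by (simp add: dq_def dirderiv_add add_divide_distrib diff_divide_distrib)

lemma dq_cmult: "line_diff f x \<Longrightarrow> dq (\<lambda>x. c * f x) i j x = c * dq f i j x"
  by (simp add: dq_def dirderiv_cmult right_diff_distrib)

text \<open>Twisted Leibniz rule: the extra term is f(sx) times (x_m - (sx)_m)/(x_i - x_j), a
  quotient equal to 1, -1 or 0. On the hyperplane it is the ordinary product rule, where 1, -1, 0
  are the coordinates of the direction and sx = x.\<close>

lemma dq_coord:
  assumes "line_diff f x" "i \<noteq> j"
  shows "dq (\<lambda>x. of_real (x m) * f x) i j x = of_real (x m) * dq f i j x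
    + (if m = i then f (sw i j x) else if m = j then - f (sw i j x) else 0)"
proof (cases "x i = x j")
  case True
  then show ?thesis
    using assms by (simp add: dq_def dirderiv_coord sw_same unitv_def)
next
  case False
  then have ne: "complex_of_real (x i) - of_real (x j) \<noteq> 0" by simp
  show ?thesis
    using False assms(2) ne
    by (auto simp: dq_def sw_def divide_simps) (simp_all add: algebra_simps)
qed

lemma dq_perm:
  assumes "inj s"
  shows "dq (\<lambda>x. f (x \<circ> s)) (s i) (s j) x = dq f i j (x \<circ> s)"
proof -
  have "(\<lambda>m. unitv (s i) m - unitv (s j) m) \<circ> s = (\<lambda>m. unitv i m - unitv j m)"
    using assms by (auto simp: unitv_def fun_eq_iff inj_eq)
  then show ?thesis by (simp add: dq_def dirderiv_perm sw_comp[OF assms])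
qed

text \<open>Only pairs containing j have a nonzero factor in the double sum; pairs with j in second
  place have factor -1, which the antisymmetry of \<open>dq\<close> absorbs.\<close>

lemma dunkl_eq:
  assumes j: "j < n" and f: "line_diff f x"
  shows "dunkl k n j f x = dirderiv (unitv j) f x + of_real k * (\<Sum>l\<in>{..<n}-{j}. dq f j l x)"
proof -
  have inner: "(\<Sum>l\<in>{i<..<n}. of_real (unitv j i - unitv j l) * dq f i l x) =
      (if i = j then \<Sum>l\<in>{j<..<n}. dq f j l x else if i < j then dq f j i x else 0)" for i
  proof (cases "i < j")
    case True
    then have "(\<Sum>l\<in>{i<..<n}. of_real (unitv j i - unitv j l) * dq f i l x)
       = (\<Sum>l\<in>{i<..<n}. if l = j then dq f j i x else 0)"
      by (intro sum.cong) (auto simp: unitv_def dq_swap[OF f, of j i])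
    then show ?thesis using True j by simp
  next
    case False
    then have "of_real (unitv j i - unitv j l) * dq f i l x = (if i = j then dq f j l x else 0)"
      if "l \<in> {i<..<n}" for l
      using that by (auto simp: unitv_def)
    then have "(\<Sum>l\<in>{i<..<n}. of_real (unitv j i - unitv j l) * dq f i l x)
       = (\<Sum>l\<in>{i<..<n}. if i = j then dq f j l x else 0)"
      by (rule sum.cong[OF refl])
    then show ?thesis using False by (cases "i = j") simp_all
  qed
  have "(\<Sum>i<n. \<Sum>l\<in>{i<..<n}. of_real (unitv j i - unitv j l) * dq f i l x)
     = (\<Sum>i<n. (if i = j then \<Sum>l\<in>{j<..<n}. dq f j l x else if i < j then dq f j i x else 0))"
    by (simp only: inner)
  also have "\<dots> = (\<Sum>i<n. (if i = j then \<Sum>l\<in>{j<..<n}. dq f j l x else 0))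
      + (\<Sum>i<n. if i \<in> {..<j} then dq f j i x else 0)"
    by (subst sum.distrib[symmetric]) (auto intro!: sum.cong)
  also have "(\<Sum>i<n. if i \<in> {..<j} then dq f j i x else 0) = (\<Sum>i\<in>{..<n} \<inter> {..<j}. dq f j i x)"
    by (rule sum.inter_restrict[symmetric]) simp
  also have "{..<n} \<inter> {..<j} = {..<j}" using j by auto
  also have "(\<Sum>i<n. (if i = j then \<Sum>l\<in>{j<..<n}. dq f j l x else 0)) = (\<Sum>l\<in>{j<..<n}. dq f j l x)"
    using j by simp
  also have "(\<Sum>l\<in>{j<..<n}. dq f j l x) + (\<Sum>i<j. dq f j i x) = (\<Sum>l\<in>{j<..<n} \<union> {..<j}. dq f j l x)"
    by (rule sum.union_disjoint[symmetric]) auto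
  also have "{j<..<n} \<union> {..<j} = {..<n} - {j}" using j by auto
  finally show ?thesis by (simp add: dunkl_def dunkl_dir_def)
qed

lemma dunkl_add:
  assumes "j < n" "line_diff f x" "line_diff g x"
  shows "dunkl k n j (\<lambda>x. f x + g x) x = dunkl k n j f x + dunkl k n j g x"
  using assms by (simp add: dunkl_eq line_diff_add dirderiv_add dq_add sum.distrib algebra_simps)

lemma dunkl_cmult:
  assumes "j < n" "line_diff f x"
  shows "dunkl k n j (\<lambda>x. c * f x) x = c * dunkl k n j f x"
  using assms
  by (simp add: dunkl_eq line_diff_cmult dirderiv_cmult dq_cmult sum_distrib_left algebra_simps)

lemma line_diff_const: "line_diff (\<lambda>_. c) x"
  by (rule line_diffI[where D = "\<lambda>_. 0"]) simp

lemma dirderiv_const: "dirderiv v (\<lambda>_. c) x = 0"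
  by (rule dirderivI) simp

lemma dunkl_const: "dunkl k n j (\<lambda>_. c) x = 0"
proof -
  have "dq (\<lambda>_. c) i l x = 0" for i l by (simp only: dq_def dirderiv_const) simp
  then show ?thesis by (simp add: dunkl_def dunkl_dir_def dirderiv_const)
qed

lemma line_diff_sum: "(\<And>a. a \<in> A \<Longrightarrow> line_diff (f a) x) \<Longrightarrow> line_diff (\<lambda>x. \<Sum>a\<in>A. f a x) x"
  by (induction A rule: infinite_finite_induct) (simp_all add: line_diff_const line_diff_add)

lemma dunkl_sum:
  assumes "j < n" "\<And>a. a \<in> A \<Longrightarrow> line_diff (f a) x"
  shows "dunkl k n j (\<lambda>x. \<Sum>a\<in>A. f a x) x = (\<Sum>a\<in>A. dunkl k n j (f a) x)"
  using assms
  by (induction A rule: infinite_finite_induct) (simp_all add: dunkl_const dunkl_add line_diff_sum)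

text \<open>With \<open>dunkl_coord_self\<close> this forms the cross relations of the rational
  Cherednik algebra. In the sum over l, the twisted Leibniz rule leaves a correction only at the
  reflections that move x_m.\<close>

lemma dunkl_coord_other:
  assumes "j < n" "m < n" "m \<noteq> j" "line_diff f x"
  shows "dunkl k n j (\<lambda>x. of_real (x m) * f x) x
    = of_real (x m) * dunkl k n j f x - of_real k * f (sw j m x)"
proof -
  have "(\<Sum>l\<in>{..<n}-{j}. dq (\<lambda>x. of_real (x m) * f x) j l x)
      = (\<Sum>l\<in>{..<n}-{j}. of_real (x m) * dq f j l x + (if l = m then - f (sw j m x) else 0))"
    using assms by (intro sum.cong) (auto simp: dq_coord)
  also have "\<dots> = of_real (x m) * (\<Sum>l\<in>{..<n}-{j}. dq f j l x) - f (sw j m x)"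
    using assms by (simp add: sum.distrib sum_distrib_left)
  finally have *: "(\<Sum>l\<in>{..<n}-{j}. dq (\<lambda>x. of_real (x m) * f x) j l x)
      = of_real (x m) * (\<Sum>l\<in>{..<n}-{j}. dq f j l x) - f (sw j m x)" .
  have u: "unitv j m = 0" using assms by (simp add: unitv_def)
  show ?thesis
    unfolding dunkl_eq[OF assms(1) line_diff_coord[OF assms(4)]] dunkl_eq[OF assms(1,4)] *
      dirderiv_coord[OF assms(4)]
    using u by (simp add: algebra_simps)
qed

lemma dunkl_coord_self:
  assumes "j < n" "line_diff f x"
  shows "dunkl k n j (\<lambda>x. of_real (x j) * f x) x
    = of_real (x j) * dunkl k n j f x + f x + of_real k * (\<Sum>l\<in>{..<n}-{j}. f (sw j l x))"
proof -
  have "(\<Sum>l\<in>{..<n}-{j}. dq (\<lambda>x. of_real (x j) * f x) j l x)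
      = (\<Sum>l\<in>{..<n}-{j}. of_real (x j) * dq f j l x + f (sw j l x))"
    using assms by (intro sum.cong) (auto simp: dq_coord)
  then have *: "(\<Sum>l\<in>{..<n}-{j}. dq (\<lambda>x. of_real (x j) * f x) j l x)
      = of_real (x j) * (\<Sum>l\<in>{..<n}-{j}. dq f j l x) + (\<Sum>l\<in>{..<n}-{j}. f (sw j l x))"
    by (simp add: sum.distrib sum_distrib_left)
  have u: "unitv j j = 1" by (simp add: unitv_def)
  show ?thesis
    unfolding dunkl_eq[OF assms(1) line_diff_coord[OF assms(2)]] dunkl_eq[OF assms] *
      dirderiv_coord[OF assms(2)]
    using u by (simp add: algebra_simps)
qed

lemma dunkl_perm:
  assumes s: "s permutes {..<n}" and j: "j < n" and f: "line_diff f (x \<circ> s)"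
  shows "dunkl k n (s j) (\<lambda>x. f (x \<circ> s)) x = dunkl k n j f (x \<circ> s)"
proof -
  have inj: "inj s" by (rule permutes_inj[OF s])
  have sj: "s j < n" using permutes_in_image[OF s] j by auto
  have "unitv (s j) \<circ> s = unitv j"
    using inj by (auto simp: unitv_def fun_eq_iff inj_eq)
  then have d: "dirderiv (unitv (s j)) (\<lambda>x. f (x \<circ> s)) x = dirderiv (unitv j) f (x \<circ> s)"
    by (simp add: dirderiv_perm)
  have "s ` ({..<n} - {j}) = {..<n} - {s j}"
    using permutes_image[OF s] inj by (simp add: image_set_diff)
  then have sums: "(\<Sum>l\<in>{..<n}-{s j}. dq (\<lambda>x. f (x \<circ> s)) (s j) l x)
      = (\<Sum>l\<in>{..<n}-{j}. dq (\<lambda>x. f (x \<circ> s)) (s j) (s l) x)"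
    using sum.reindex[OF inj_on_subset[OF inj subset_UNIV], of _ "{..<n} - {j}"]
    by (metis (no_types, lifting) o_apply sum.cong)
  show ?thesis
    unfolding dunkl_eq[OF sj line_diff_perm[OF f]] dunkl_eq[OF j f] d
    by (simp only: sums dq_perm[OF inj])
qed

lemma dunkl_sw:
  assumes ab: "a < n" "b < n" and j: "j < n" and f: "line_diff f (sw a b x)"
  shows "dunkl k n (tau a b j) (\<lambda>x. f (sw a b x)) x = dunkl k n j f (sw a b x)"
  using dunkl_perm[OF transpose_permutes[OF ab] j] f by (simp add: sw_eq)

lemma line_diff_sw: "line_diff f (sw a b x) \<Longrightarrow> line_diff (\<lambda>x. f (sw a b x)) x"
  using line_diff_perm by (simp add: sw_eq)

section \<open>Locality off the coordinate hyperplanes\<close>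

lemma dirderiv_cong:
  assumes "\<forall>\<^sub>F t in at (0::real). f (\<lambda>m. x m + t * v m) = g (\<lambda>m. x m + t * v m)" "f x = g x"
  shows "dirderiv v f x = dirderiv v g x"
proof -
  have "\<forall>\<^sub>F t in nhds (0::real). f (\<lambda>m. x m + t * v m) = g (\<lambda>m. x m + t * v m)"
    using assms by (simp add: eventually_nhds_conv_at)
  then show ?thesis
    unfolding dirderiv_def by (intro vector_derivative_cong_eq) auto
qed

text \<open>The domain where \<open>Delta_pow\<close> is differentiable. It is stable under
  permutations and contains short line segments around each of its points.\<close>

definition off_axes :: "nat \<Rightarrow> pt set" where
  "off_axes n = {x. \<forall>i<n. x i \<noteq> 0}"

lemma off_axes_perm:
  assumes "s permutes {..<n}" "x \<in> off_axes n"
  shows "x \<circ> s \<in> off_axes n"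
  using assms(2) permutes_in_image[OF assms(1)] by (auto simp: off_axes_def)

lemma off_axes_sw: "i < n \<Longrightarrow> j < n \<Longrightarrow> x \<in> off_axes n \<Longrightarrow> sw i j x \<in> off_axes n"
  by (auto simp: off_axes_def sw_def)

lemma eventually_off_axes:
  assumes "x \<in> off_axes n"
  shows "\<forall>\<^sub>F t in nhds (0::real). (\<lambda>m. x m + t * v m) \<in> off_axes n"
proof -
  have "\<forall>\<^sub>F t in nhds (0::real). x i + t * v i \<noteq> 0" if "i < n" for i
  proof -
    have "((\<lambda>t. x i + t * v i) \<longlongrightarrow> x i + 0 * v i) (nhds (0::real))"
      by (intro tendsto_intros filterlim_ident)
    then show ?thesis
      using assms that by (intro tendsto_imp_eventually_ne) (auto simp: off_axes_def)
  qed
  then have "\<forall>\<^sub>F t in nhds (0::real). \<forall>i\<in>{..<n}. x i + t * v i \<noteq> 0"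
    by (intro eventually_ball_finite) auto
  then show ?thesis by (simp add: off_axes_def lessThan_def)
qed

lemma dirderiv_cong_off_axes:
  assumes "x \<in> off_axes n" "\<And>y. y \<in> off_axes n \<Longrightarrow> f y = g y"
  shows "dirderiv v f x = dirderiv v g x"
proof (rule dirderiv_cong)
  have "\<forall>\<^sub>F t in nhds (0::real). f (\<lambda>m. x m + t * v m) = g (\<lambda>m. x m + t * v m)"
    using eventually_off_axes[OF assms(1)] by eventually_elim (rule assms(2))
  then show "\<forall>\<^sub>F t in at (0::real). f (\<lambda>m. x m + t * v m) = g (\<lambda>m. x m + t * v m)"
    by (simp add: eventually_nhds_conv_at)
qed (use assms in auto)

text \<open>The operator looks at f on short segments through x and at reflected points, all of
  which stay in the domain. This allows identities valid only off the axes to be used under further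
  Dunkl operators.\<close>

lemma dunkl_cong_off_axes:
  assumes x: "x \<in> off_axes n" and eq: "\<And>y. y \<in> off_axes n \<Longrightarrow> f y = g y"
  shows "dunkl k n j f x = dunkl k n j g x"
proof -
  have "dirderiv v f x = dirderiv v g x" for v
    using dirderiv_cong_off_axes[OF x eq] .
  moreover have "dq f i l x = dq g i l x" if "i < n" "l < n" for i l
    using calculation eq[OF x] eq[OF off_axes_sw[OF that x]] by (simp add: dq_def)
  ultimately show ?thesis
    unfolding dunkl_def dunkl_dir_def by (intro arg_cong2[of _ _ _ _ "(+)"] arg_cong2[of _ _ _ _ "(*)"] sum.cong) auto
qed

lemma line_diff_cong_off_axes:
  assumes x: "x \<in> off_axes n" and eq: "\<And>y. y \<in> off_axes n \<Longrightarrow> f y = g y" and g: "line_diff g x"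
  shows "line_diff f x"
proof (rule line_diffI)
  fix v
  have ev: "\<forall>\<^sub>F t in nhds (0::real). f (\<lambda>m. x m + t * v m) = g (\<lambda>m. x m + t * v m)"
    using eventually_off_axes[OF x] by eventually_elim (rule eq)
  have "((\<lambda>t. f (\<lambda>m. x m + t * v m)) has_vector_derivative dirderiv v g x) (at 0) =
      ((\<lambda>t. g (\<lambda>m. x m + t * v m)) has_vector_derivative dirderiv v g x) (at 0)"
    by (rule has_vector_derivative_cong_ev) (use ev eq[OF x] in simp_all)
  then show "((\<lambda>t::real. f (\<lambda>m. x m + t * v m)) has_vector_derivative dirderiv v g x) (at 0)"
    using line_diffD[OF g] by simp
qed

section \<open>Polynomial functions of the first n coordinates\<close>

inductive_set Pol :: "nat \<Rightarrow> fn set" for n where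
  const: "(\<lambda>_. c) \<in> Pol n"
| add: "f \<in> Pol n \<Longrightarrow> g \<in> Pol n \<Longrightarrow> (\<lambda>x. f x + g x) \<in> Pol n"
| coord: "f \<in> Pol n \<Longrightarrow> m < n \<Longrightarrow> (\<lambda>x. of_real (x m) * f x) \<in> Pol n"

lemma Pol_cmult: "f \<in> Pol n \<Longrightarrow> (\<lambda>x. c * f x) \<in> Pol n"
proof (induction rule: Pol.induct)
  case (add f g)
  then show ?case using Pol.add by (simp add: distrib_left)
next
  case (coord f m)
  then show ?case using Pol.coord[of "\<lambda>x. c * f x"] by (simp add: mult.left_commute)
qed (rule Pol.const)

lemma Pol_sum: "(\<And>a. a \<in> A \<Longrightarrow> f a \<in> Pol n) \<Longrightarrow> (\<lambda>x. \<Sum>a\<in>A. f a x) \<in> Pol n"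
  by (induction A rule: infinite_finite_induct) (simp_all add: Pol.const Pol.add)

lemma Pol_diff: "f \<in> Pol n \<Longrightarrow> g \<in> Pol n \<Longrightarrow> (\<lambda>x. f x - g x) \<in> Pol n"
  using Pol.add[of f n "\<lambda>x. (-1) * g x"] Pol_cmult[of g n "-1"] by simp

lemma Pol_perm:
  assumes "f \<in> Pol n" "s permutes {..<n}"
  shows "(\<lambda>x. f (x \<circ> s)) \<in> Pol n"
  using assms(1)
proof (induction rule: Pol.induct)
  case (coord f m)
  then show ?case
    using Pol.coord[of "\<lambda>x. f (x \<circ> s)" n "s m"] permutes_in_image[OF assms(2)] by (simp add: o_def)
qed (rule Pol.const | rule Pol.add; assumption)+

lemma Pol_sw: "f \<in> Pol n \<Longrightarrow> i < n \<Longrightarrow> j < n \<Longrightarrow> (\<lambda>x. f (sw i j x)) \<in> Pol n"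
  using Pol_perm[OF _ transpose_permutes] by (simp add: sw_eq)

text \<open>The derivative along a curve depends only on its position and velocity at 0. Curves more
  general than lines are required because inversion of the coordinates bends lines.\<close>

lemma Pol_chain_rule:
  assumes "f \<in> Pol n"
  shows "\<exists>G. \<forall>g w. (\<forall>m<n. ((\<lambda>t. g t m) has_vector_derivative w m) (at (0::real))) \<longrightarrow>
    ((\<lambda>t. f (g t)) has_vector_derivative G w (g 0)) (at 0)"
  using assms
proof (induction rule: Pol.induct)
  case (const c)
  show ?case by (intro exI[of _ "\<lambda>_ _. 0"]) simp
next
  case (add f1 f2)
  then obtain G1 G2 where
    "\<And>g w. (\<forall>m<n. ((\<lambda>t. g t m) has_vector_derivative w m) (at (0::real))) \<Longrightarrow>
      ((\<lambda>t. f1 (g t)) has_vector_derivative G1 w (g 0)) (at 0)"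
    "\<And>g w. (\<forall>m<n. ((\<lambda>t. g t m) has_vector_derivative w m) (at (0::real))) \<Longrightarrow>
      ((\<lambda>t. f2 (g t)) has_vector_derivative G2 w (g 0)) (at 0)"
    by metis
  then show ?case
    by (intro exI[of _ "\<lambda>w x. G1 w x + G2 w x"] allI impI has_vector_derivative_add) auto
next
  case (coord f l)
  then obtain G where G:
    "\<And>g w. (\<forall>m<n. ((\<lambda>t. g t m) has_vector_derivative w m) (at (0::real))) \<Longrightarrow>
      ((\<lambda>t. f (g t)) has_vector_derivative G w (g 0)) (at 0)"
    by metis
  show ?case
  proof (intro exI[of _ "\<lambda>w x. of_real (x l) * G w x + of_real (w l) * f x"] allI impI)
    fix g :: "real \<Rightarrow> nat \<Rightarrow> real" and w
    assume h: "\<forall>m<n. ((\<lambda>t. g t m) has_vector_derivative w m) (at 0)"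
    have "((\<lambda>t. complex_of_real (g t l)) has_vector_derivative of_real (w l)) (at 0)"
      using h coord.hyps
      by (intro has_vector_derivative_of_real)
         (simp add: has_real_derivative_iff_has_vector_derivative)
    from has_vector_derivative_mult[OF this G[OF h]]
    show "((\<lambda>t. of_real (g t l) * f (g t)) has_vector_derivative
        of_real (g 0 l) * G w (g 0) + of_real (w l) * f (g 0)) (at 0)" .
  qed
qed

lemma affine_has_vector_derivative:
  "((\<lambda>t::real. a + t * b) has_vector_derivative (b::real)) (at 0)"
  by (auto intro!: derivative_eq_intros simp: has_real_derivative_iff_has_vector_derivative[symmetric])

lemma Pol_chain:
  assumes f: "f \<in> Pol n"
    and g: "\<And>m. m < n \<Longrightarrow> ((\<lambda>t. g t m) has_vector_derivative w m) (at (0::real))"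
  shows "((\<lambda>t. f (g t)) has_vector_derivative dirderiv w f (g 0)) (at 0)"
proof -
  obtain G where G: "\<And>g w. (\<forall>m<n. ((\<lambda>t. g t m) has_vector_derivative w m) (at (0::real))) \<Longrightarrow>
      ((\<lambda>t. f (g t)) has_vector_derivative G w (g 0)) (at 0)"
    using Pol_chain_rule[OF f] by metis
  \<comment> \<open>The straight line with the same position and velocity identifies G as the
    directional derivative.\<close>
  have "((\<lambda>t. f (\<lambda>m. g 0 m + t * w m)) has_vector_derivative G w (g 0)) (at 0)"
    using G[of "\<lambda>t m. g 0 m + t * w m" w] affine_has_vector_derivative by simp
  from dirderivI[OF this] show ?thesis using G g by simp
qed

lemma Pol_line_diff: "f \<in> Pol n \<Longrightarrow> line_diff f x"
proof (rule line_diffI)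
  fix v assume f: "f \<in> Pol n"
  have "((\<lambda>t. f (\<lambda>m. x m + t * v m)) has_vector_derivative dirderiv v f (\<lambda>m. x m + 0 * v m)) (at 0)"
    using affine_has_vector_derivative by (intro Pol_chain[OF f])
  then show "((\<lambda>t. f (\<lambda>m. x m + t * v m)) has_vector_derivative dirderiv v f x) (at 0)" by simp
qed

text \<open>The generating cases of \<open>Pol\<close> are those settled by linearity and the cross
  relations, whose right-hand sides contain no denominators.\<close>

lemma dunkl_Pol:
  assumes "f \<in> Pol n" "j < n"
  shows "dunkl k n j f \<in> Pol n"
  using assms(1)
proof (induction rule: Pol.induct)
  case (const c)
  have "dunkl k n j (\<lambda>_. c) = (\<lambda>_. 0)" by (simp add: fun_eq_iff dunkl_const)
  then show ?case using Pol.const by simp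
next
  case (add f g)
  then have "dunkl k n j (\<lambda>x. f x + g x) = (\<lambda>x. dunkl k n j f x + dunkl k n j g x)"
    using assms(2) by (simp add: fun_eq_iff dunkl_add Pol_line_diff)
  then show ?case using Pol.add[OF add.IH] by (simp only:)
next
  case (coord f m)
  show ?case
  proof (cases "m = j")
    case True
    have "dunkl k n j (\<lambda>x. of_real (x m) * f x) = (\<lambda>x. of_real (x j) * dunkl k n j f x + f x
        + of_real k * (\<Sum>l\<in>{..<n}-{j}. f (sw j l x)))"
      using assms(2) coord True by (simp add: fun_eq_iff dunkl_coord_self Pol_line_diff)
    moreover have "\<dots> \<in> Pol n"
      using coord assms(2) by (intro Pol.add Pol.coord Pol_cmult Pol_sum Pol_sw) auto
    ultimately show ?thesis by (simp only:)
  next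
    case False
    have "dunkl k n j (\<lambda>x. of_real (x m) * f x) = (\<lambda>x. of_real (x m) * dunkl k n j f x
        - of_real k * f (sw j m x))"
      using assms(2) coord False by (simp add: fun_eq_iff dunkl_coord_other Pol_line_diff)
    moreover have "\<dots> \<in> Pol n"
      using coord assms(2) by (intro Pol_diff Pol.coord Pol_cmult Pol_sw) auto
    ultimately show ?thesis by (simp only:)
  qed
qed

text \<open>Moving from x along (1, ..., 1) leaves all coordinate hyperplanes at once for small
  nonzero t: vanishing coordinates become t and the others stay away from 0. Continuity along this
  line gives equality at x.\<close>

lemma Pol_eq_off_axes:
  assumes f: "f \<in> Pol n" and g: "g \<in> Pol n" and eq: "\<And>x. x \<in> off_axes n \<Longrightarrow> f x = g x"
  shows "f = g"
proof
  fix x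
  let ?h = "\<lambda>t::real. f (\<lambda>m. x m + t * 1) - g (\<lambda>m. x m + t * 1)"
  have "line_diff (\<lambda>x. f x - g x) x" using Pol_diff[OF f g] by (rule Pol_line_diff)
  from line_diffD[OF this, of "\<lambda>_. 1"] have "isCont ?h 0"
    by (rule has_vector_derivative_continuous)
  then have lim: "(?h \<longlongrightarrow> ?h 0) (at 0)" by (simp add: isCont_def)
  have "\<forall>\<^sub>F t in at (0::real). x i + t * 1 \<noteq> 0" if "i < n" for i
  proof (cases "x i = 0")
    case True
    then show ?thesis by (simp add: eventually_at_filter)
  next
    case False
    have "((\<lambda>t. x i + t * 1) \<longlongrightarrow> x i + 0 * 1) (at (0::real))" by (intro tendsto_intros)
    then show ?thesis using False by (intro tendsto_imp_eventually_ne) auto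
  qed
  then have "\<forall>\<^sub>F t in at (0::real). \<forall>i\<in>{..<n}. x i + t * 1 \<noteq> 0"
    by (intro eventually_ball_finite) auto
  then have "\<forall>\<^sub>F t in at (0::real). ?h t = 0"
    by eventually_elim (auto simp: off_axes_def intro!: eq)
  then have "(?h \<longlongrightarrow> 0) (at 0)" by (rule tendsto_eventually)
  then have "?h 0 = 0" by (rule tendsto_unique[OF at_neq_bot lim])
  then show "f x = g x" by simp
qed

subsection \<open>Coefficients, triangularity and uniqueness\<close>

text \<open>Both conditions are needed for a polynomial to determine its coefficients: a sum over an
  infinite support is 0 by convention, and \<open>mono\<close> ignores entries from position n
  on.\<close>

definition poly_coeffs :: "nat \<Rightarrow> (nat list \<Rightarrow> complex) \<Rightarrow> bool" where
  "poly_coeffs n c \<longleftrightarrow> finite {kappa. c kappa \<noteq> 0} \<and> (\<forall>kappa. c kappa \<noteq> 0 \<longrightarrow> length kappa = n)"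

text \<open>The basis is left open so that the same manipulations of coefficients apply to monomials
  and to their images under the twisted operators.\<close>

definition lin_comb :: "(nat list \<Rightarrow> fn) \<Rightarrow> (nat list \<Rightarrow> complex) \<Rightarrow> fn" where
  "lin_comb B c x = (\<Sum>kappa\<in>{kappa. c kappa \<noteq> 0}. c kappa * B kappa x)"

definition raise_index :: "nat \<Rightarrow> nat list \<Rightarrow> nat list" where
  "raise_index m kappa = kappa[m := Suc (kappa ! m)]"

lemma peval_eq_lin_comb: "peval n c = lin_comb (mono n) c"
  by (simp add: fun_eq_iff peval_def lin_comb_def)

lemma lin_comb_superset:
  assumes "finite A" "{kappa. c kappa \<noteq> 0} \<subseteq> A"
  shows "lin_comb B c x = (\<Sum>kappa\<in>A. c kappa * B kappa x)"
  unfolding lin_comb_def using assms by (intro sum.mono_neutral_left) auto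

lemma poly_coeffs_add: "poly_coeffs n c \<Longrightarrow> poly_coeffs n d \<Longrightarrow> poly_coeffs n (\<lambda>kappa. c kappa + d kappa)"
proof -
  assume h: "poly_coeffs n c" "poly_coeffs n d"
  have sub: "{kappa. c kappa + d kappa \<noteq> 0} \<subseteq> {kappa. c kappa \<noteq> 0} \<union> {kappa. d kappa \<noteq> 0}"
    by force
  moreover have "finite ({kappa. c kappa \<noteq> 0} \<union> {kappa. d kappa \<noteq> 0})"
    using h by (simp add: poly_coeffs_def)
  ultimately have "finite {kappa. c kappa + d kappa \<noteq> 0}" by (rule finite_subset)
  then show ?thesis using h sub unfolding poly_coeffs_def by blast
qed

lemma lin_comb_add:
  assumes "poly_coeffs n c" "poly_coeffs n d"
  shows "lin_comb B (\<lambda>kappa. c kappa + d kappa) x = lin_comb B c x + lin_comb B d x"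
proof -
  let ?A = "{kappa. c kappa \<noteq> 0} \<union> {kappa. d kappa \<noteq> 0}"
  have A: "finite ?A" using assms by (simp add: poly_coeffs_def)
  have sub: "{kappa. c kappa \<noteq> 0} \<subseteq> ?A" "{kappa. d kappa \<noteq> 0} \<subseteq> ?A"
      "{kappa. c kappa + d kappa \<noteq> 0} \<subseteq> ?A" by force+
  show ?thesis
    unfolding lin_comb_superset[OF A sub(1)] lin_comb_superset[OF A sub(2)] lin_comb_superset[OF A sub(3)]
    by (simp add: sum.distrib distrib_right)
qed

lemma poly_coeffs_cmult: "poly_coeffs n c \<Longrightarrow> poly_coeffs n (\<lambda>kappa. a * c kappa)"
  unfolding poly_coeffs_def by (auto intro: finite_subset[of _ "{kappa. c kappa \<noteq> 0}"])

lemma lin_comb_cmult: "lin_comb B (\<lambda>kappa. a * c kappa) x = a * lin_comb B c x"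
  by (cases "a = 0") (simp_all add: lin_comb_def sum_distrib_left mult.assoc)

lemma poly_coeffs_zero: "poly_coeffs n (\<lambda>_. 0)"
  by (simp add: poly_coeffs_def)

lemma lin_comb_zero: "lin_comb B (\<lambda>_. 0) x = 0"
  by (simp add: lin_comb_def)

lemma poly_coeffs_sum:
  "(\<And>a. a \<in> A \<Longrightarrow> poly_coeffs n (c a)) \<Longrightarrow> poly_coeffs n (\<lambda>kappa. \<Sum>a\<in>A. c a kappa)"
  by (induction A rule: infinite_finite_induct) (simp_all add: poly_coeffs_zero poly_coeffs_add)

lemma lin_comb_sum:
  "(\<And>a. a \<in> A \<Longrightarrow> poly_coeffs n (c a)) \<Longrightarrow>
    lin_comb B (\<lambda>kappa. \<Sum>a\<in>A. c a kappa) x = (\<Sum>a\<in>A. lin_comb B (c a) x)"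
  by (induction A rule: infinite_finite_induct)
     (simp_all add: lin_comb_zero lin_comb_add[where n = n] poly_coeffs_sum)

lemma poly_coeffs_single: "length nu = n \<Longrightarrow> poly_coeffs n (\<lambda>kappa. if kappa = nu then a else 0)"
  by (auto simp: poly_coeffs_def intro: finite_subset[of _ "{nu}"])

lemma lin_comb_single: "lin_comb B (\<lambda>kappa. if kappa = nu then a else 0) x = a * B nu x"
  by (subst lin_comb_superset[of "{nu}"]) auto

text \<open>The coefficients of x_m p when c are those of p.\<close>

definition shift_coeffs :: "nat \<Rightarrow> nat \<Rightarrow> (nat list \<Rightarrow> complex) \<Rightarrow> nat list \<Rightarrow> complex" where
  "shift_coeffs n m c kappa =
    (if length kappa = n \<and> 0 < kappa ! m then c (kappa[m := kappa ! m - 1]) else 0)"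

lemma shift_coeffs_support:
  assumes "poly_coeffs n c" "m < n"
  shows "{kappa. shift_coeffs n m c kappa \<noteq> 0} = raise_index m ` {kappa. c kappa \<noteq> 0}"
proof (intro equalityI subsetI)
  fix kappa assume "kappa \<in> {kappa. shift_coeffs n m c kappa \<noteq> 0}"
  then have h: "length kappa = n" "0 < kappa ! m" "c (kappa[m := kappa ! m - 1]) \<noteq> 0"
    by (auto simp: shift_coeffs_def split: if_splits)
  then have "kappa = raise_index m (kappa[m := kappa ! m - 1])"
    using assms by (simp add: raise_index_def)
  then show "kappa \<in> raise_index m ` {kappa. c kappa \<noteq> 0}" using h by blast
next
  fix kappa assume "kappa \<in> raise_index m ` {kappa. c kappa \<noteq> 0}"
  then obtain nu where nu: "c nu \<noteq> 0" "kappa = raise_index m nu" by blast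
  then have "length nu = n" using assms(1) by (simp add: poly_coeffs_def)
  then show "kappa \<in> {kappa. shift_coeffs n m c kappa \<noteq> 0}"
    using nu assms(2) by (simp add: shift_coeffs_def raise_index_def)
qed

lemma poly_coeffs_shift:
  assumes "poly_coeffs n c" "m < n"
  shows "poly_coeffs n (shift_coeffs n m c)"
proof -
  have "finite {kappa. shift_coeffs n m c kappa \<noteq> 0}"
    unfolding shift_coeffs_support[OF assms] using assms(1) by (simp add: poly_coeffs_def)
  then show ?thesis unfolding poly_coeffs_def by (simp add: shift_coeffs_def)
qed

lemma lin_comb_shift:
  assumes "poly_coeffs n c" "m < n"
  shows "lin_comb B (shift_coeffs n m c) x = lin_comb (\<lambda>kappa. B (raise_index m kappa)) c x"
proof -
  have inj: "inj_on (raise_index m) {kappa. c kappa \<noteq> 0}"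
  proof (rule inj_onI)
    fix a b assume ab: "a \<in> {kappa. c kappa \<noteq> 0}" "b \<in> {kappa. c kappa \<noteq> 0}"
      "raise_index m a = raise_index m b"
    have len: "length a = n" "length b = n"
      using ab(1,2) assms(1) unfolding poly_coeffs_def by blast+
    show "a = b"
    proof (rule nth_equalityI)
      fix i assume "i < length a"
      then show "a ! i = b ! i"
        using arg_cong[OF ab(3), of "\<lambda>xs. xs ! i"] len assms(2)
        by (cases "i = m") (auto simp: raise_index_def)
    qed (use len in simp)
  qed
  have val: "shift_coeffs n m c (raise_index m kappa) = c kappa" if "c kappa \<noteq> 0" for kappa
  proof -
    have "length kappa = n" using that assms(1) unfolding poly_coeffs_def by blast
    then show ?thesis using assms(2) by (simp add: shift_coeffs_def raise_index_def)
  qed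
  show ?thesis
    unfolding lin_comb_def shift_coeffs_support[OF assms] sum.reindex[OF inj]
    by (rule sum.cong) (auto simp: val)
qed

lemma permute_list_inverses:
  assumes "s permutes {..<length xs}"
  shows "permute_list (inv s) (permute_list s xs) = xs" "permute_list s (permute_list (inv s) xs) = xs"
  by (simp_all only: permute_list_compose[OF permutes_inv[OF assms], symmetric]
      permute_list_compose[OF assms, symmetric] permutes_inv_o[OF assms] permute_list_id)

lemma poly_coeffs_perm_support:
  assumes c: "poly_coeffs n c" and s: "s permutes {..<n}"
  shows "{kappa. c (permute_list s kappa) \<noteq> 0} = permute_list (inv s) ` {kappa. c kappa \<noteq> 0}"
proof (intro equalityI subsetI)
  fix kappa assume "kappa \<in> {kappa. c (permute_list s kappa) \<noteq> 0}"
  then have h: "c (permute_list s kappa) \<noteq> 0" and "length (permute_list s kappa) = n"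
    using c unfolding poly_coeffs_def by blast+
  then have "length kappa = n" by simp
  then have "kappa = permute_list (inv s) (permute_list s kappa)"
    using s by (simp add: permute_list_inverses)
  then show "kappa \<in> permute_list (inv s) ` {kappa. c kappa \<noteq> 0}"
    using h by (intro image_eqI[of _ _ "permute_list s kappa"]) simp_all
next
  fix kappa assume "kappa \<in> permute_list (inv s) ` {kappa. c kappa \<noteq> 0}"
  then obtain nu where nu: "c nu \<noteq> 0" "kappa = permute_list (inv s) nu" by blast
  then have "length nu = n" using c unfolding poly_coeffs_def by blast
  then have "permute_list s kappa = nu"
    using nu s by (simp add: permute_list_inverses)
  then show "kappa \<in> {kappa. c (permute_list s kappa) \<noteq> 0}" using nu by simp
qed

lemma poly_coeffs_perm:
  assumes c: "poly_coeffs n c" and s: "s permutes {..<n}"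
  shows "poly_coeffs n (\<lambda>kappa. c (permute_list s kappa))"
proof -
  have "finite {kappa. c (permute_list s kappa) \<noteq> 0}"
    unfolding poly_coeffs_perm_support[OF assms] using c by (simp add: poly_coeffs_def)
  moreover have "length kappa = n" if "c (permute_list s kappa) \<noteq> 0" for kappa
    using that c length_permute_list[of s kappa] unfolding poly_coeffs_def by fastforce
  ultimately show ?thesis unfolding poly_coeffs_def by blast
qed

lemma lin_comb_perm:
  assumes c: "poly_coeffs n c" and s: "s permutes {..<n}"
  shows "lin_comb B (\<lambda>kappa. c (permute_list s kappa)) x
    = lin_comb (\<lambda>kappa. B (permute_list (inv s) kappa)) c x"
proof -
  have inv2: "permute_list s (permute_list (inv s) nu) = nu" if "c nu \<noteq> 0" for nu
    using that c s unfolding poly_coeffs_def by (intro permute_list_inverses(2)) auto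
  have inj: "inj_on (permute_list (inv s)) {kappa. c kappa \<noteq> 0}"
    by (rule inj_on_inverseI[of _ "permute_list s"]) (simp add: inv2)
  show ?thesis
    unfolding lin_comb_def poly_coeffs_perm_support[OF assms] sum.reindex[OF inj]
    by (rule sum.cong) (auto simp: inv2)
qed

section \<open>Monomials and their linear independence\<close>

lemma mono_raise_index:
  assumes "length kappa = n" "m < n"
  shows "mono n (raise_index m kappa) x = of_real (x m) * mono n kappa x"
proof -
  have "mono n (raise_index m kappa) x
      = of_real (x m) ^ Suc (kappa ! m) * (\<Prod>i\<in>{..<n}-{m}. of_real (x i) ^ (raise_index m kappa ! i))"
    unfolding mono_def using assms by (subst prod.remove[of _ m]) (auto simp: raise_index_def)
  also have "(\<Prod>i\<in>{..<n}-{m}. complex_of_real (x i) ^ (raise_index m kappa ! i))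
      = (\<Prod>i\<in>{..<n}-{m}. of_real (x i) ^ (kappa ! i))"
    by (rule prod.cong) (auto simp: raise_index_def)
  also have "complex_of_real (x m) ^ Suc (kappa ! m) * \<dots> = of_real (x m) * mono n kappa x"
    unfolding mono_def using assms by (subst prod.remove[of "{..<n}" m]) auto
  finally show ?thesis .
qed

lemma mono_permute_list:
  assumes s: "s permutes {..<n}" and "length kappa = n"
  shows "mono n (permute_list s kappa) (x \<circ> s) = mono n kappa x"
proof -
  have "mono n kappa x = (\<Prod>i<n. of_real (x (s i)) ^ (kappa ! s i))"
    unfolding mono_def using prod.permute[OF s, of "\<lambda>i. complex_of_real (x i) ^ (kappa ! i)"]
    by (simp add: o_def)
  also have "\<dots> = mono n (permute_list s kappa) (x \<circ> s)"
    unfolding mono_def using assms by (intro prod.cong) (auto simp: permute_list_nth)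
  finally show ?thesis by simp
qed

lemma mono_perm:
  assumes s: "s permutes {..<n}" and len: "length kappa = n"
  shows "mono n kappa (x \<circ> s) = mono n (permute_list (inv s) kappa) x"
proof -
  have "permute_list s (permute_list (inv s) kappa) = kappa"
    using s len by (intro permute_list_inverses) simp
  then show ?thesis using mono_permute_list[OF s, of "permute_list (inv s) kappa" x] len by simp
qed

lemma mono_sw:
  assumes "i < n" "j < n" "length kappa = n"
  shows "mono n kappa (sw i j x) = mono n (swap_list i j kappa) x"
  using mono_perm[OF transpose_permutes[OF assms(1,2)] assms(3), of x]
  by (simp add: sw_eq swap_list_def)

lemma Pol_prod_powers:
  assumes "A \<subseteq> {..<n}"
  shows "(\<lambda>x. \<Prod>i\<in>A. of_real (x i) ^ e i) \<in> Pol n"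
proof -
  have pow: "(\<lambda>x. of_real (x i) ^ d * f x) \<in> Pol n" if "i < n" "f \<in> Pol n" for i d f
  proof (induction d)
    case (Suc d)
    then show ?case using Pol.coord[OF Suc, of i] that by (simp add: mult.assoc)
  qed (use that in simp)
  have "finite A" using assms finite_subset by blast
  then show ?thesis using assms
    by (induction A rule: finite_induct) (auto intro: pow Pol.const)
qed

lemma mono_Pol: "mono n kappa \<in> Pol n"
  using Pol_prod_powers[of "{..<n}" n "\<lambda>i. kappa ! i"] unfolding mono_def[abs_def] by simp

lemma lin_comb_Pol: "(\<And>kappa. B kappa \<in> Pol n) \<Longrightarrow> lin_comb B c \<in> Pol n"
  unfolding lin_comb_def[abs_def] by (intro Pol_sum Pol_cmult)

lemma peval_Pol: "peval n c \<in> Pol n"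
  unfolding peval_eq_lin_comb by (intro lin_comb_Pol mono_Pol)

text \<open>A nonzero complex polynomial has finitely many roots, but here every real number is
  one.\<close>

lemma complex_polyfun_eq_0:
  assumes "\<And>t::real. (\<Sum>i\<le>N. b i * of_real t ^ i) = (0::complex)" "i \<le> N"
  shows "b i = 0"
proof (rule ccontr)
  assume "b i \<noteq> 0"
  then have "finite {z. (\<Sum>i\<le>N. b i * z ^ i) = 0}" using polyfun_rootbound assms(2) by blast
  moreover have "range complex_of_real \<subseteq> {z. (\<Sum>i\<le>N. b i * z ^ i) = 0}" using assms(1) by auto
  ultimately have "finite (range complex_of_real)" by (rule finite_subset[rotated])
  then have "finite (UNIV :: real set)" by (rule finite_imageD) (simp add: inj_of_real)
  then show False by (simp add: infinite_UNIV_char_0)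
qed

text \<open>The combination is read as a polynomial in the first variable, grouped by the heads of
  the exponents. Each group vanishes, and within a group the tails are distinct exponents in one
  variable fewer.\<close>

lemma mono_lin_indep:
  assumes "finite A" "\<And>kappa. kappa \<in> A \<Longrightarrow> length kappa = n"
    and "\<And>x. (\<Sum>kappa\<in>A. c kappa * mono n kappa x) = 0" and "kappa \<in> A"
  shows "c kappa = 0"
  using assms
proof (induction n arbitrary: A c kappa)
  case 0
  then have "A = {[]}" "kappa = []" by auto
  then show ?case using "0.prems"(3)[of undefined] by (simp add: mono_def)
next
  case (Suc n)
  define N where "N = Max (hd ` A)"
  have hdN: "hd kappa \<le> N" if "kappa \<in> A" for kappa
    unfolding N_def using that Suc.prems(1) by (intro Max_ge) auto
  define a where "a = hd kappa"
  let ?B = "\<lambda>a. {kappa \<in> A. hd kappa = a}"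
  have ne: "nu = hd nu # tl nu" if "nu \<in> A" for nu
    using Suc.prems(2)[OF that] by (cases nu) auto
  have tail: "(\<Sum>nu\<in>?B a. c nu * mono n (tl nu) y) = 0" for y
  proof -
    have zero: "(\<Sum>a\<le>N. (\<Sum>nu\<in>?B a. c nu * mono n (tl nu) y) * of_real t ^ a) = 0" for t :: real
    proof -
      define x where "x = (\<lambda>i. case i of 0 \<Rightarrow> t | Suc i \<Rightarrow> y i)"
      have m: "mono (Suc n) nu x = of_real t ^ hd nu * mono n (tl nu) y" if "nu \<in> A" for nu
        by (subst ne[OF that]) (simp add: mono_def x_def prod.lessThan_Suc_shift del: prod.lessThan_Suc)
      have "0 = (\<Sum>nu\<in>A. c nu * mono (Suc n) nu x)" using Suc.prems(3) by simp
      also have "\<dots> = (\<Sum>nu\<in>A. c nu * mono n (tl nu) y * of_real t ^ hd nu)"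
        by (rule sum.cong) (simp_all add: m)
      also have "\<dots> = (\<Sum>a\<le>N. \<Sum>nu\<in>?B a. c nu * mono n (tl nu) y * of_real t ^ hd nu)"
        using Suc.prems(1) hdN by (subst sum.group) auto
      also have "\<dots> = (\<Sum>a\<le>N. (\<Sum>nu\<in>?B a. c nu * mono n (tl nu) y) * of_real t ^ a)"
        by (intro sum.cong) (auto simp: sum_distrib_right)
      finally show ?thesis by simp
    qed
    have "a \<le> N" using hdN Suc.prems(4) by (simp add: a_def)
    then show ?thesis
      using complex_polyfun_eq_0[of "\<lambda>a. \<Sum>nu\<in>?B a. c nu * mono n (tl nu) y" N a, OF zero] by blast
  qed
  have inj: "inj_on tl (?B a)"
  proof (rule inj_onI)
    fix p q assume "p \<in> ?B a" "q \<in> ?B a" "tl p = tl q"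
    then show "p = q" using ne[of p] ne[of q] by simp
  qed
  have "(\<lambda>nu. c (a # nu)) (tl kappa) = 0"
  proof (rule Suc.IH[where A = "tl ` ?B a" and c = "\<lambda>nu. c (a # nu)" and kappa = "tl kappa"])
    show "finite (tl ` ?B a)" using Suc.prems(1) by simp
    show "length nu = n" if "nu \<in> tl ` ?B a" for nu using that Suc.prems(2) by auto
    show "tl kappa \<in> tl ` ?B a" using Suc.prems(4) by (auto simp: a_def)
    show "(\<Sum>nu\<in>tl ` ?B a. c (a # nu) * mono n nu x) = 0" for x
    proof -
      have "(\<Sum>nu\<in>tl ` ?B a. c (a # nu) * mono n nu x) = (\<Sum>nu\<in>?B a. c (a # tl nu) * mono n (tl nu) x)"
        by (simp add: sum.reindex[OF inj])
      also have "\<dots> = (\<Sum>nu\<in>?B a. c nu * mono n (tl nu) x)"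
        by (rule sum.cong) (use ne in \<open>auto simp flip: ne\<close>)
      finally show ?thesis using tail by simp
    qed
  qed
  then show ?case using ne[OF Suc.prems(4)] by (simp add: a_def)
qed

lemma peval_zero_imp:
  assumes "poly_coeffs n c" "\<And>x. peval n c x = 0"
  shows "c = (\<lambda>_. 0)"
proof
  fix kappa show "c kappa = 0"
    using mono_lin_indep[of "{kappa. c kappa \<noteq> 0}" n c kappa] assms
    unfolding poly_coeffs_def peval_def by blast
qed

lemma peval_inj:
  assumes "poly_coeffs n c" "poly_coeffs n d" "\<And>x. peval n c x = peval n d x"
  shows "c = d"
proof -
  have "(\<lambda>kappa. c kappa + (-1) * d kappa) = (\<lambda>_. 0)"
  proof (rule peval_zero_imp)
    show "poly_coeffs n (\<lambda>kappa. c kappa + (-1) * d kappa)"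
      using assms by (intro poly_coeffs_add poly_coeffs_cmult)
    show "peval n (\<lambda>kappa. c kappa + (-1) * d kappa) x = 0" for x
      using assms(3) unfolding peval_eq_lin_comb
      by (simp only: lin_comb_add[OF assms(1) poly_coeffs_cmult[OF assms(2)]] lin_comb_cmult) simp
  qed
  then show ?thesis by (simp add: fun_eq_iff)
qed

section \<open>Triangularity of the operators D_j on monomials\<close>

definition lower_span :: "nat \<Rightarrow> nat list \<Rightarrow> fn set" where
  "lower_span n nu = {f. \<exists>d. poly_coeffs n d \<and> (\<forall>kappa. d kappa \<noteq> 0 \<longrightarrow> prec n kappa nu) \<and> f = peval n d}"

lemma lower_span_zero: "(\<lambda>_. 0) \<in> lower_span n nu"
  unfolding lower_span_def
  by (auto intro!: exI[of _ "\<lambda>_. 0"] simp: poly_coeffs_zero peval_eq_lin_comb lin_comb_zero fun_eq_iff)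

lemma lower_span_add:
  assumes "f \<in> lower_span n nu" "g \<in> lower_span n nu"
  shows "(\<lambda>x. f x + g x) \<in> lower_span n nu"
proof -
  obtain c d where c: "poly_coeffs n c" "\<forall>kappa. c kappa \<noteq> 0 \<longrightarrow> prec n kappa nu" "f = peval n c"
    and d: "poly_coeffs n d" "\<forall>kappa. d kappa \<noteq> 0 \<longrightarrow> prec n kappa nu" "g = peval n d"
    using assms by (auto simp: lower_span_def)
  show ?thesis unfolding lower_span_def mem_Collect_eq
  proof (intro exI[of _ "\<lambda>kappa. c kappa + d kappa"] conjI allI impI)
    show "(\<lambda>x. f x + g x) = peval n (\<lambda>kappa. c kappa + d kappa)"
      using c d by (simp add: fun_eq_iff peval_eq_lin_comb lin_comb_add[OF c(1) d(1)])
    show "prec n kappa nu" if "c kappa + d kappa \<noteq> 0" for kappa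
      using that c(2) d(2) by (cases "c kappa = 0") auto
  qed (rule poly_coeffs_add[OF c(1) d(1)])
qed

lemma lower_span_cmult:
  assumes "f \<in> lower_span n nu"
  shows "(\<lambda>x. a * f x) \<in> lower_span n nu"
proof -
  obtain c where c: "poly_coeffs n c" "\<forall>kappa. c kappa \<noteq> 0 \<longrightarrow> prec n kappa nu" "f = peval n c"
    using assms by (auto simp: lower_span_def)
  show ?thesis unfolding lower_span_def mem_Collect_eq
  proof (intro exI[of _ "\<lambda>kappa. a * c kappa"] conjI allI impI)
    show "(\<lambda>x. a * f x) = peval n (\<lambda>kappa. a * c kappa)"
      using c by (simp add: fun_eq_iff peval_eq_lin_comb lin_comb_cmult)
    show "prec n kappa nu" if "a * c kappa \<noteq> 0" for kappa
      using that c(2) by simp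
  qed (rule poly_coeffs_cmult[OF c(1)])
qed

lemma lower_span_mono: "prec n kappa nu \<Longrightarrow> mono n kappa \<in> lower_span n nu"
  unfolding lower_span_def mem_Collect_eq
  by (rule exI[of _ "\<lambda>x. if x = kappa then 1 else 0"])
     (auto simp: poly_coeffs_single prec_def peval_eq_lin_comb lin_comb_single fun_eq_iff)

lemma lower_span_sum:
  "(\<And>a. a \<in> A \<Longrightarrow> f a \<in> lower_span n nu) \<Longrightarrow> (\<lambda>x. \<Sum>a\<in>A. f a x) \<in> lower_span n nu"
  by (induction A rule: infinite_finite_induct) (simp_all add: lower_span_zero lower_span_add)

text \<open>On the hyperplane \<open>dq\<close> is a derivative, so numerators do not help. There
  symmetry gives equality of \<open>dq f j i x\<close> and \<open>dq f i j x\<close>, and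
  antisymmetry makes them negatives of each other.\<close>

lemma dq_symmetric_zero:
  assumes f: "line_diff f x" and sym: "\<And>x. f (sw i j x) = f x"
  shows "dq f i j x = 0"
proof (cases "x i = x j")
  case False
  then show ?thesis by (simp add: dq_def sym)
next
  case True
  let ?t = "tau i j"
  have "(\<lambda>x. f (x \<circ> ?t)) = f" using sym by (simp add: fun_eq_iff flip: sw_eq)
  moreover have "x \<circ> ?t = x" using sw_same[of x i j] True by (simp add: sw_eq)
  ultimately have "dq f j i x = dq f i j x"
    using dq_perm[of ?t f i j x] by simp
  then show ?thesis using dq_swap[OF f, of j i] by simp
qed

text \<open>The geometric sum for the divided difference of a monomial. Induction on d by the
  twisted Leibniz rule treats the hyperplane x_i = x_j together with its complement.\<close>

lemma dq_mono:
  assumes nu: "length nu = n" and ij: "i < n" "j < n" "i \<noteq> j"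
  shows "dq (mono n (nu[i := b + d, j := b])) i j x = (\<Sum>p<d. mono n (nu[i := b + p, j := b + d - Suc p]) x)"
proof (induction d)
  case 0
  have "swap_list i j (nu[i := b, j := b]) = nu[i := b, j := b]"
    using nu ij by (intro nth_equalityI) (auto simp: swap_list_nth tau_def nth_list_update)
  then show ?case
    using nu ij by (simp, intro dq_symmetric_zero Pol_line_diff[OF mono_Pol]) (simp add: mono_sw)
next
  case (Suc d)
  let ?m = "nu[i := b + d, j := b]"
  have r: "raise_index i (nu[i := b + p, j := q]) = nu[i := b + Suc p, j := q]" for p q
    using nu ij by (simp add: raise_index_def list_update_swap)
  have m: "of_real (x i) * mono n (nu[i := b + p, j := q]) x = mono n (nu[i := b + Suc p, j := q]) x" for p q
    using mono_raise_index[of "nu[i := b + p, j := q]" n i x] nu ij r by simp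
  have "mono n (nu[i := b + Suc d, j := b]) = (\<lambda>x. of_real (x i) * mono n ?m x)"
    using mono_raise_index[of ?m n i] nu ij r by (simp add: fun_eq_iff)
  then have "dq (mono n (nu[i := b + Suc d, j := b])) i j x
      = of_real (x i) * dq (mono n ?m) i j x + mono n ?m (sw i j x)"
    using dq_coord[OF Pol_line_diff[OF mono_Pol] ij(3)] by simp
  also have "of_real (x i) * dq (mono n ?m) i j x
      = (\<Sum>p<d. mono n (nu[i := b + Suc p, j := b + Suc d - Suc (Suc p)]) x)"
    unfolding Suc.IH sum_distrib_left
    by (simp only: m diff_Suc_Suc add_Suc_right)
  also have "mono n ?m (sw i j x) = mono n (nu[i := b + 0, j := b + Suc d - Suc 0]) x"
  proof -
    have "swap_list i j ?m = nu[i := b + 0, j := b + Suc d - Suc 0]"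
      using nu ij by (intro nth_equalityI) (auto simp: swap_list_nth tau_def nth_list_update)
    then show ?thesis using mono_sw[of i n j ?m x] nu ij by simp
  qed
  finally show ?case
    unfolding sum.lessThan_Suc_shift by (simp add: add.commute)
qed

lemma coord_dirderiv_mono:
  assumes nu: "length nu = n" and j: "j < n"
  shows "of_real (x j) * dirderiv (unitv j) (mono n nu) x = of_nat (nu ! j) * mono n nu x"
proof -
  have "of_real (x j) * dirderiv (unitv j) (mono n (nu[j := d])) x = of_nat d * mono n (nu[j := d]) x" for d
  proof (induction d)
    case 0
    have "mono n (nu[j := 0]) (\<lambda>m. x m + t * unitv j m) = mono n (nu[j := 0]) x" for t
      unfolding mono_def by (rule prod.cong) (use nu j in \<open>auto simp: unitv_def nth_list_update\<close>)
    then have "dirderiv (unitv j) (mono n (nu[j := 0])) x = 0"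
      by (intro dirderivI) simp
    then show ?case by simp
  next
    case (Suc d)
    have r: "raise_index j (nu[j := d]) = nu[j := Suc d]" using nu j by (simp add: raise_index_def)
    have e: "mono n (nu[j := Suc d]) = (\<lambda>x. of_real (x j) * mono n (nu[j := d]) x)"
      using mono_raise_index[of "nu[j := d]" n j] nu j r by (simp add: fun_eq_iff)
    have "dirderiv (unitv j) (mono n (nu[j := Suc d])) x
        = mono n (nu[j := d]) x + of_real (x j) * dirderiv (unitv j) (mono n (nu[j := d])) x"
      unfolding e using dirderiv_coord[OF Pol_line_diff[OF mono_Pol], of "unitv j" j] by (simp add: unitv_def)
    then show ?case using Suc.IH by (simp add: e algebra_simps)
  qed
  from this[of "nu ! j"] show ?thesis by simp
qed

text \<open>The pair (j, l) contributes leading coefficient 1 if j precedes l and 0 otherwise. If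
  nu_j < nu_l, the quotient yields minus the swapped monomial, which the reflection cancels for j <
  l and which is lower for l < j. If nu_j = nu_l, the quotient vanishes and only the reflection,
  present for j < l, remains. If nu_j > nu_l, the last term of the geometric sum is x^nu, and a
  reflection term is lower. All other terms come from transfers between the two entries.\<close>

lemma coord_dq_mono_triangular:
  assumes nu: "length nu = n" and jl: "j < n" "l < n" "l \<noteq> j"
  shows "(\<lambda>x. of_real (x j) * dq (mono n nu) j l x + (if j < l then mono n nu (sw l j x) else 0)
    - (if precedes nu j l then mono n nu x else 0)) \<in> lower_span n nu" (is "?F \<in> _")
proof -
  define S where "S = swap_list l j nu"
  have sw: "mono n nu (sw l j x) = mono n S x" for x
    using mono_sw nu jl by (simp add: S_def)
  consider "nu ! j < nu ! l" | "nu ! j = nu ! l" | "nu ! l < nu ! j" by linarith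
  then show ?thesis
  proof cases
    case 1
    define d where "d = nu ! l - nu ! j"
    have d: "nu ! l = nu ! j + d" "d > 0" using 1 by (auto simp: d_def)
    have nu_eq: "nu[l := nu ! j + d, j := nu ! j] = nu" using d by (metis list_update_id)
    have S_eq: "nu[l := nu ! j, j := nu ! j + d] = S"
      unfolding S_def using nu jl d
      by (intro nth_equalityI) (auto simp: swap_list_nth tau_def nth_list_update)
    have "of_real (x j) * dq (mono n nu) j l x
       = - (\<Sum>p<d. mono n (nu[l := nu ! j + p, j := nu ! j + d - p]) x)" for x
    proof -
      have "dq (mono n nu) j l x = - dq (mono n nu) l j x"
        by (rule dq_swap[OF Pol_line_diff[OF mono_Pol]])
      also have "dq (mono n nu) l j x = (\<Sum>p<d. mono n (nu[l := nu ! j + p, j := nu ! j + d - Suc p]) x)"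
        using dq_mono[OF nu jl(2,1,3), of "nu ! j" d x] nu_eq by simp
      finally have "of_real (x j) * dq (mono n nu) j l x
        = - (\<Sum>p<d. of_real (x j) * mono n (nu[l := nu ! j + p, j := nu ! j + d - Suc p]) x)"
        by (simp add: sum_distrib_left)
      also have "(\<Sum>p<d. of_real (x j) * mono n (nu[l := nu ! j + p, j := nu ! j + d - Suc p]) x)
        = (\<Sum>p<d. mono n (nu[l := nu ! j + p, j := nu ! j + d - p]) x)"
      proof (rule sum.cong[OF refl])
        fix p assume "p \<in> {..<d}"
        then have "raise_index j (nu[l := nu ! j + p, j := nu ! j + d - Suc p])
            = nu[l := nu ! j + p, j := nu ! j + d - p]"
          using nu jl by (simp add: raise_index_def Suc_diff_Suc)
        then show "of_real (x j) * mono n (nu[l := nu ! j + p, j := nu ! j + d - Suc p]) x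
            = mono n (nu[l := nu ! j + p, j := nu ! j + d - p]) x"
          using mono_raise_index[of "nu[l := nu ! j + p, j := nu ! j + d - Suc p]" n j x] nu jl by simp
      qed
      finally show ?thesis .
    qed
    moreover have "(\<Sum>p<d. mono n (nu[l := nu ! j + p, j := nu ! j + d - p]) x)
        = mono n S x + (\<Sum>p\<in>{..<d}-{0}. mono n (nu[l := nu ! j + p, j := nu ! j + d - p]) x)" for x
      using d S_eq by (subst sum.remove[of _ 0]) auto
    moreover have "\<not> precedes nu j l" using 1 by (simp add: precedes_def)
    ultimately have F: "?F = (\<lambda>x. (-1) * (if j < l then 0 else mono n S x)
        + (-1) * (\<Sum>p\<in>{..<d}-{0}. mono n (nu[l := nu ! j + p, j := nu ! j + d - p]) x))"
      by (simp add: fun_eq_iff sw)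
    have 2: "(\<lambda>x. if j < l then 0 else mono n S x) \<in> lower_span n nu"
    proof (cases "j < l")
      case True then show ?thesis by (simp add: lower_span_zero)
    next
      case False
      then have "prec n S nu" unfolding S_def using prec_swap_list[OF nu, of l j] jl 1 by simp
      then show ?thesis using False lower_span_mono by simp
    qed
    have 3: "prec n (nu[l := nu ! j + p, j := nu ! j + d - p]) nu" if "p \<in> {..<d}-{0}" for p
      using that d nu jl by (intro prec_transfer) auto
    show ?thesis
      unfolding F by (intro lower_span_add lower_span_cmult lower_span_sum 2 lower_span_mono 3)
  next
    case 2
    have "S = nu" unfolding S_def using nu jl 2
      by (intro nth_equalityI) (auto simp: swap_list_nth tau_def)
    moreover from this have "dq (mono n nu) j l x = 0" for x
      using sw by (intro dq_symmetric_zero Pol_line_diff[OF mono_Pol]) (simp add: sw_commute[of j l])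
    moreover have "precedes nu j l \<longleftrightarrow> j < l" using 2 by (simp add: precedes_def)
    ultimately have "?F = (\<lambda>_. 0)" by (simp add: fun_eq_iff sw)
    then show ?thesis by (simp add: lower_span_zero)
  next
    case 3
    define d where "d = nu ! j - nu ! l"
    have d: "nu ! j = nu ! l + d" "d > 0" using 3 by (auto simp: d_def)
    have nu_eq: "nu[j := nu ! l + d, l := nu ! l] = nu" using d by (metis list_update_id)
    have "of_real (x j) * dq (mono n nu) j l x
       = (\<Sum>p<d. mono n (nu[j := nu ! l + Suc p, l := nu ! l + d - Suc p]) x)" for x
    proof -
      have "dq (mono n nu) j l x = (\<Sum>p<d. mono n (nu[j := nu ! l + p, l := nu ! l + d - Suc p]) x)"
        using dq_mono[OF nu jl(1,2) jl(3)[symmetric], of "nu ! l" d x] nu_eq by simp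
      then have "of_real (x j) * dq (mono n nu) j l x
        = (\<Sum>p<d. of_real (x j) * mono n (nu[j := nu ! l + p, l := nu ! l + d - Suc p]) x)"
        by (simp add: sum_distrib_left)
      also have "\<dots> = (\<Sum>p<d. mono n (nu[j := nu ! l + Suc p, l := nu ! l + d - Suc p]) x)"
      proof (rule sum.cong[OF refl])
        fix p
        have "raise_index j (nu[j := nu ! l + p, l := nu ! l + d - Suc p])
            = nu[j := nu ! l + Suc p, l := nu ! l + d - Suc p]"
          using nu jl by (simp add: raise_index_def list_update_swap)
        then show "of_real (x j) * mono n (nu[j := nu ! l + p, l := nu ! l + d - Suc p]) x
            = mono n (nu[j := nu ! l + Suc p, l := nu ! l + d - Suc p]) x"
          using mono_raise_index[of "nu[j := nu ! l + p, l := nu ! l + d - Suc p]" n j x] nu jl by simp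
      qed
      finally show ?thesis .
    qed
    moreover have "(\<Sum>p<d. mono n (nu[j := nu ! l + Suc p, l := nu ! l + d - Suc p]) x)
        = mono n nu x + (\<Sum>p\<in>{..<d}-{d-1}. mono n (nu[j := nu ! l + Suc p, l := nu ! l + d - Suc p]) x)" for x
      using d nu_eq by (subst sum.remove[of _ "d - 1"]) auto
    moreover have "precedes nu j l" using 3 by (simp add: precedes_def)
    ultimately have F: "?F = (\<lambda>x. (if j < l then mono n S x else 0)
        + (\<Sum>p\<in>{..<d}-{d-1}. mono n (nu[j := nu ! l + Suc p, l := nu ! l + d - Suc p]) x))"
      by (simp add: fun_eq_iff sw)
    have 1: "(\<lambda>x. if j < l then mono n S x else 0) \<in> lower_span n nu"
    proof (cases "j < l")
      case True
      have "S = swap_list j l nu" by (simp add: S_def swap_list_def transpose_commute)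
      then have "prec n S nu" using prec_swap_list[OF nu, of j l] jl 3 True by simp
      then show ?thesis using True lower_span_mono by simp
    next
      case False
      then show ?thesis by (simp add: lower_span_zero)
    qed
    have 2: "prec n (nu[j := nu ! l + Suc p, l := nu ! l + d - Suc p]) nu" if "p \<in> {..<d}-{d-1}" for p
      using that d nu jl by (intro prec_transfer) auto
    show ?thesis
      unfolding F by (intro lower_span_add lower_span_sum 1 lower_span_mono 2)
  qed
qed

text \<open>The Euler part gives nu_j. Position j precedes n - 1 - rank others, each contributing k,
  and the shift k(1-n) turns this total into -k times the rank: the diagonal entry is
  \<open>ebar\<close>.\<close>

lemma jackD_mono_triangular:
  assumes nu: "length nu = n" and j: "j < n"
  shows "(\<lambda>x. jackD k n j (mono n nu) x - of_real (ebar k nu j) * mono n nu x) \<in> lower_span n nu"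
proof -
  let ?L = "{..<n} - {j}"
  let ?G = "\<lambda>l x. of_real (x j) * dq (mono n nu) j l x + (if j < l then mono n nu (sw l j x) else 0)
    - (if precedes nu j l then mono n nu x else 0)"
  have above: "(\<Sum>l\<in>{j<..<n}. mono n nu (sw l j x)) = (\<Sum>l\<in>?L. if j < l then mono n nu (sw l j x) else 0)" for x
    by (rule sum.mono_neutral_cong_left) auto
  have split: "{..<n} = insert j ({l\<in>?L. precedes nu j l} \<union> {l. l < n \<and> precedes nu l j})"
  proof (intro equalityI subsetI)
    fix l assume "l \<in> {..<n}"
    then show "l \<in> insert j ({l\<in>?L. precedes nu j l} \<union> {l. l < n \<and> precedes nu l j})"
      using precedes_linear[of j l nu] by auto
  qed (use j in auto)
  have "card {..<n} = Suc (card ({l\<in>?L. precedes nu j l} \<union> {l. l < n \<and> precedes nu l j}))"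
    by (subst split, rule card_insert_disjoint) auto
  also have "card ({l\<in>?L. precedes nu j l} \<union> {l. l < n \<and> precedes nu l j})
      = card {l\<in>?L. precedes nu j l} + card {l. l < n \<and> precedes nu l j}"
    by (rule card_Un_disjoint) (auto simp: precedes_def)
  finally have cnt: "real (card {l\<in>?L. precedes nu j l}) = real n - 1 - real (rank_of nu j)"
    using nu j by (simp add: rank_of_def)
  have prec_sum: "(\<Sum>l\<in>?L. if precedes nu j l then mono n nu x else 0)
      = of_real (real n - 1 - real (rank_of nu j)) * mono n nu x" for x
  proof -
    have "(\<Sum>l\<in>?L. if precedes nu j l then mono n nu x else 0)
       = (\<Sum>l\<in>{l\<in>?L. precedes nu j l}. mono n nu x)"
      by (rule sum.inter_filter[symmetric]) simp
    then show ?thesis by (simp flip: cnt)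
  qed
  have "jackD k n j (mono n nu) x - of_real (ebar k nu j) * mono n nu x = of_real k * (\<Sum>l\<in>?L. ?G l x)" for x
  proof -
    have "jackD k n j (mono n nu) x = of_real (x j) * dirderiv (unitv j) (mono n nu) x
        + of_real k * (\<Sum>l\<in>?L. of_real (x j) * dq (mono n nu) j l x)
        + of_real (k * (1 - real n)) * mono n nu x
        + of_real k * (\<Sum>l\<in>?L. if j < l then mono n nu (sw l j x) else 0)"
      unfolding jackD_def dunkl_eq[OF j Pol_line_diff[OF mono_Pol]] above
      by (simp add: sum_distrib_left algebra_simps)
    also have "\<dots> = of_real (ebar k nu j) * mono n nu x + of_real k * (\<Sum>l\<in>?L. ?G l x)"
      unfolding coord_dirderiv_mono[OF nu j] sum.distrib sum_subtractf prec_sum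
      using nu j by (simp add: ebar_eq algebra_simps)
    finally show ?thesis by simp
  qed
  then have "(\<lambda>x. jackD k n j (mono n nu) x - of_real (ebar k nu j) * mono n nu x)
      = (\<lambda>x. of_real k * (\<Sum>l\<in>?L. ?G l x))" by (simp add: fun_eq_iff)
  moreover have "\<dots> \<in> lower_span n nu"
    using nu j by (intro lower_span_cmult lower_span_sum coord_dq_mono_triangular) auto
  ultimately show ?thesis by (simp only:)
qed

lemma jackD_add:
  assumes "j < n" "f \<in> Pol n" "g \<in> Pol n"
  shows "jackD k n j (\<lambda>x. f x + g x) x = jackD k n j f x + jackD k n j g x"
  unfolding jackD_def using assms
  by (simp add: dunkl_add Pol_line_diff sum.distrib algebra_simps)

lemma jackD_cmult:
  assumes "j < n" "f \<in> Pol n"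
  shows "jackD k n j (\<lambda>x. a * f x) x = a * jackD k n j f x"
  unfolding jackD_def using assms
  by (simp add: dunkl_cmult Pol_line_diff sum_distrib_left algebra_simps)

lemma jackD_sum:
  assumes "j < n" "\<And>a. a \<in> A \<Longrightarrow> f a \<in> Pol n"
  shows "jackD k n j (\<lambda>x. \<Sum>a\<in>A. f a x) x = (\<Sum>a\<in>A. jackD k n j (f a) x)"
  using assms(2)
proof (induction A rule: infinite_finite_induct)
  case (insert a A)
  then show ?case using assms(1) by (simp add: jackD_add Pol_sum)
qed (simp_all add: jackD_def dunkl_const)

section \<open>Joint eigenfunctions and uniqueness\<close>

definition jack_eigen :: "real \<Rightarrow> nat \<Rightarrow> nat list \<Rightarrow> fn \<Rightarrow> bool" where
  "jack_eigen k n eta f \<longleftrightarrow> (\<forall>j<n. \<forall>x. jackD k n j f x = of_real (ebar k eta j) * f x)"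

text \<open>Triangularity forces every maximal exponent of a joint eigenfunction to have the same
  eigenvalues as \<open>eta\<close>, hence to be \<open>eta\<close>.\<close>
lemma jack_eigen_maximal:
  assumes k: "k \<ge> 0" and eta: "length eta = n" and c: "poly_coeffs n c"
    and eig: "jack_eigen k n eta (peval n c)"
    and kappa: "c kappa \<noteq> 0" and maximal: "\<And>nu. c nu \<noteq> 0 \<Longrightarrow> \<not> prec n kappa nu"
  shows "kappa = eta"
proof (rule ebar_inj[OF k eta])
  let ?A = "{nu. c nu \<noteq> 0}"
  have len: "length nu = n" if "nu \<in> ?A" for nu using that c by (simp add: poly_coeffs_def)
  then show "length kappa = n" using kappa by simp
  fix j assume j: "j < n"
  have "\<forall>nu\<in>?A. \<exists>d. poly_coeffs n d \<and> (\<forall>kappa. d kappa \<noteq> 0 \<longrightarrow> prec n kappa nu) \<and>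
     (\<lambda>x. jackD k n j (mono n nu) x - of_real (ebar k nu j) * mono n nu x) = peval n d"
    using jackD_mono_triangular[OF len j, of _ k] unfolding lower_span_def by blast
  from bchoice[OF this] obtain d where d': "\<forall>nu\<in>?A. poly_coeffs n (d nu) \<and>
     (\<forall>kappa. d nu kappa \<noteq> 0 \<longrightarrow> prec n kappa nu) \<and>
     (\<lambda>x. jackD k n j (mono n nu) x - of_real (ebar k nu j) * mono n nu x) = peval n (d nu)"
    by blast
  have d1: "poly_coeffs n (d nu)" if "nu \<in> ?A" for nu using that d' by blast
  have d2: "prec n kappa nu" if "nu \<in> ?A" "d nu kappa \<noteq> 0" for nu kappa using that d' by blast
  have d3: "jackD k n j (mono n nu) x - of_real (ebar k nu j) * mono n nu x = peval n (d nu) x"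
    if "nu \<in> ?A" for nu x
  proof -
    have "(\<lambda>x. jackD k n j (mono n nu) x - of_real (ebar k nu j) * mono n nu x) = peval n (d nu)"
      using d' that by blast
    from fun_cong[OF this, of x] show ?thesis .
  qed
  \<comment> \<open>Coefficients of c nu times (D_j - ebar eta_j) x^nu. Their sum over nu vanishes,
    and at kappa only nu = kappa contributes, because kappa lies below no exponent of the
    support.\<close>
  let ?q = "\<lambda>nu kappa. c nu * ((if kappa = nu then of_real (ebar k nu j - ebar k eta j) else 0) + d nu kappa)"
  have pq: "poly_coeffs n (?q nu)" if "nu \<in> ?A" for nu
    using that len d1 by (intro poly_coeffs_cmult poly_coeffs_add poly_coeffs_single) auto
  have ev: "peval n (?q nu) x = c nu * (jackD k n j (mono n nu) x - of_real (ebar k eta j) * mono n nu x)"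
    if nu: "nu \<in> ?A" for nu x
    unfolding peval_eq_lin_comb lin_comb_cmult
      lin_comb_add[OF poly_coeffs_single[OF len[OF nu]] d1[OF nu]] lin_comb_single
    using d3[OF nu, of x] by (simp add: peval_eq_lin_comb[symmetric] algebra_simps)
  have "peval n (\<lambda>kappa. \<Sum>nu\<in>?A. ?q nu kappa) x = 0" for x
  proof -
    have "peval n (\<lambda>kappa. \<Sum>nu\<in>?A. ?q nu kappa) x = (\<Sum>nu\<in>?A. peval n (?q nu) x)"
      unfolding peval_eq_lin_comb by (rule lin_comb_sum[OF pq])
    also have "\<dots> = (\<Sum>nu\<in>?A. c nu * (jackD k n j (mono n nu) x - of_real (ebar k eta j) * mono n nu x))"
      by (rule sum.cong[OF refl ev])
    also have "\<dots> = (\<Sum>nu\<in>?A. jackD k n j (\<lambda>x. c nu * mono n nu x) x) - of_real (ebar k eta j) * peval n c x"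
      by (simp add: jackD_cmult[OF j mono_Pol] peval_def sum_distrib_left sum_subtractf algebra_simps)
    also have "(\<Sum>nu\<in>?A. jackD k n j (\<lambda>x. c nu * mono n nu x) x) = jackD k n j (peval n c) x"
      unfolding peval_def[abs_def] by (rule jackD_sum[symmetric, OF j]) (intro Pol_cmult mono_Pol)
    also have "\<dots> - of_real (ebar k eta j) * peval n c x = 0"
      using eig j by (simp add: jack_eigen_def)
    finally show ?thesis .
  qed
  then have "(\<lambda>kappa. \<Sum>nu\<in>?A. ?q nu kappa) = (\<lambda>_. 0)"
    by (intro peval_zero_imp[where n = n] poly_coeffs_sum pq)
  then have "0 = (\<Sum>nu\<in>?A. ?q nu kappa)" by (simp add: fun_eq_iff)
  also have "\<dots> = (\<Sum>nu\<in>?A. if nu = kappa then c kappa * of_real (ebar k kappa j - ebar k eta j) else 0)"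
  proof (rule sum.cong[OF refl])
    fix nu assume nu: "nu \<in> ?A"
    then have "d nu kappa = 0" using d2 maximal by blast
    then show "?q nu kappa = (if nu = kappa then c kappa * of_real (ebar k kappa j - ebar k eta j) else 0)"
      by auto
  qed
  also have "\<dots> = c kappa * of_real (ebar k kappa j - ebar k eta j)"
    using kappa c by (simp add: poly_coeffs_def)
  finally show "ebar k kappa j = ebar k eta j" using kappa by simp
qed

lemma prec_asymp: "asymp_on A (prec n)"
  by (rule asymp_onI) (meson prec_irrefl prec_trans)

lemma prec_transp: "transp_on A (prec n)"
  by (rule transp_onI) (rule prec_trans)

text \<open>Above each exponent of the finite support there is a maximal one, and that must be eta.
  In particular a joint eigenfunction whose coefficient at eta is 0 vanishes, which is the source of
  uniqueness.\<close>

lemma jack_eigen_support: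
  assumes k: "k \<ge> 0" and eta: "length eta = n" and c: "poly_coeffs n c"
    and eig: "jack_eigen k n eta (peval n c)" and kappa: "c kappa \<noteq> 0"
  shows "kappa = eta \<or> prec n kappa eta" "c eta \<noteq> 0"
proof -
  let ?B = "{nu. c nu \<noteq> 0 \<and> (nu = kappa \<or> prec n kappa nu)}"
  have "finite ?B" using c by (auto simp: poly_coeffs_def intro: finite_subset)
  moreover have "?B \<noteq> {}" using kappa by blast
  ultimately obtain m where m: "m \<in> ?B" "\<forall>x\<in>?B. x \<noteq> m \<longrightarrow> \<not> prec n m x"
    using Finite_Set.bex_max_element[OF _ prec_asymp prec_transp] by blast
  have "m = eta"
  proof (rule jack_eigen_maximal[OF k eta c eig])
    show "c m \<noteq> 0" using m by simp
    show "\<not> prec n m nu" if "c nu \<noteq> 0" for nu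
    proof
      assume p: "prec n m nu"
      then have "nu \<in> ?B" using m(1) that prec_trans by blast
      moreover have "nu \<noteq> m" using p prec_irrefl by blast
      ultimately show False using m(2) p by blast
    qed
  qed
  then show "kappa = eta \<or> prec n kappa eta" "c eta \<noteq> 0" using m by auto
qed

lemma prec_sum_list: "prec n kappa eta \<Longrightarrow> sum_list kappa = sum_list eta"
proof -
  assume "prec n kappa eta"
  then have "sum_list (dec_rearr kappa) = sum_list (dec_rearr eta)"
    by (auto simp: prec_def dom_le_def)
  then show ?thesis by (metis mset_dec_rearr sum_mset_sum_list)
qed

text \<open>The description inside \<open>E_coeff\<close> does not mention finiteness. It follows
  because \<open>prec\<close> preserves the degree and the length, leaving finitely many
  exponents.\<close>

lemma poly_coeffs_if_prec:
  assumes eta: "length eta = n" and c: "\<And>kappa. c kappa \<noteq> 0 \<Longrightarrow> kappa = eta \<or> prec n kappa eta"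
  shows "poly_coeffs n c"
proof -
  have len: "length kappa = n" if "c kappa \<noteq> 0" for kappa
    using c[OF that] eta by (auto simp: prec_def)
  have "{kappa. c kappa \<noteq> 0} \<subseteq> {xs. set xs \<subseteq> {..sum_list eta} \<and> length xs = n}"
  proof
    fix kappa assume "kappa \<in> {kappa. c kappa \<noteq> 0}"
    then have "sum_list kappa = sum_list eta" "length kappa = n"
      using c prec_sum_list len by auto
    then show "kappa \<in> {xs. set xs \<subseteq> {..sum_list eta} \<and> length xs = n}"
      using member_le_sum_list[of _ kappa] by auto
  qed
  then have "finite {kappa. c kappa \<noteq> 0}"
    using finite_lists_length_eq[of "{..sum_list eta}" n] finite_subset by auto
  then show ?thesis using len by (simp add: poly_coeffs_def)
qed

lemma jack_eigen_unique:
  assumes k: "k \<ge> 0" and eta: "length eta = n" and c: "poly_coeffs n c" and d: "poly_coeffs n d"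
    and eig: "jack_eigen k n eta (peval n c)" "jack_eigen k n eta (peval n d)" and eq: "c eta = d eta"
  shows "c = d"
proof -
  let ?e = "\<lambda>kappa. c kappa + (-1) * d kappa"
  have e: "poly_coeffs n ?e" using c d by (intro poly_coeffs_add poly_coeffs_cmult)
  have ev: "peval n ?e = (\<lambda>x. peval n c x + (-1) * peval n d x)"
    unfolding peval_eq_lin_comb
    by (rule ext) (simp only: lin_comb_add[OF c poly_coeffs_cmult[OF d]] lin_comb_cmult)
  have "jack_eigen k n eta (peval n ?e)"
    unfolding jack_eigen_def ev
  proof (intro allI impI)
    fix j x assume j: "j < n"
    show "jackD k n j (\<lambda>x. peval n c x + (-1) * peval n d x) x
        = of_real (ebar k eta j) * (peval n c x + (-1) * peval n d x)"
      unfolding jackD_add[OF j peval_Pol Pol_cmult[OF peval_Pol]] jackD_cmult[OF j peval_Pol]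
      using eig j by (simp add: jack_eigen_def algebra_simps)
  qed
  from jack_eigen_support(2)[OF k eta e this] have "?e kappa = 0" for kappa using eq by auto
  then show ?thesis by (simp add: fun_eq_iff)
qed

text \<open>The triangular shape comes for free from \<open>jack_eigen_support\<close>, so
  eigenvalues and normalisation alone identify the coefficients.\<close>

lemma E_coeff_eqI:
  assumes k: "k \<ge> 0" and eta: "length eta = n" and c: "poly_coeffs n c"
    and eig: "jack_eigen k n eta (peval n c)" and one: "c eta = 1"
  shows "E_coeff k n eta = c"
  unfolding E_coeff_def
proof (rule the_equality)
  show "c eta = 1 \<and> (\<forall>kappa. c kappa \<noteq> 0 \<longrightarrow> kappa = eta \<or> prec n kappa eta)
      \<and> (\<forall>j<n. \<forall>x. jackD k n j (peval n c) x = of_real (ebar k eta j) * peval n c x)"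
    using one eig jack_eigen_support(1)[OF k eta c eig] by (auto simp: jack_eigen_def)
next
  fix d
  assume d: "d eta = 1 \<and> (\<forall>kappa. d kappa \<noteq> 0 \<longrightarrow> kappa = eta \<or> prec n kappa eta)
      \<and> (\<forall>j<n. \<forall>x. jackD k n j (peval n d) x = of_real (ebar k eta j) * peval n d x)"
  then have "poly_coeffs n d" using poly_coeffs_if_prec[OF eta] by blast
  then show "d = c"
    using d jack_eigen_unique[OF k eta _ c _ eig] one by (auto simp: jack_eigen_def)
qed

subsection \<open>Dunkl operators conjugated by a power of \<open>Delta\<close>\<close>

lemma Delta_perm:
  assumes "s permutes {..<n}"
  shows "Delta n (x \<circ> s) = Delta n x"
  unfolding Delta_def using prod.permute[OF assms, of x] by (simp add: o_def)

lemma Delta_pow_sw: "i < n \<Longrightarrow> j < n \<Longrightarrow> Delta_pow n mu (sw i j x) = Delta_pow n mu x"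
  using Delta_perm[OF transpose_permutes] by (simp add: Delta_pow_def sw_eq)

text \<open>On the negative axis the principal logarithm is ln of the absolute value plus i pi. The
  sign of \<open>Delta\<close> is constant near x, so locally the logarithm is a real sum of
  logarithms plus a constant, 0 or i pi, with zero derivative.\<close>

lemma Delta_pow_has_vector_derivative:
  assumes x: "x \<in> off_axes n"
  shows "((\<lambda>t. Delta_pow n mu (\<lambda>m. x m + t * v m)) has_vector_derivative
    (- mu * of_real (\<Sum>m<n. v m / x m) * Delta_pow n mu x)) (at 0)"
proof -
  let ?p = "\<lambda>t m. x m + t * v m"
  define D where "D = Delta n x"
  define a where "a = (if D < 0 then of_real pi * \<i> else (0::complex))"
  \<comment> \<open>Half the logarithm of the square equals the logarithm of the absolute value, but
    is differentiated without distinguishing signs of coordinates.\<close>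
  define H where "H = (\<lambda>t. \<Sum>m<n. ln ((x m + t * v m)\<^sup>2) / 2)"
  have D0: "D \<noteq> 0" using x by (auto simp: D_def Delta_def off_axes_def)
  have pow: "Delta_pow n mu y = exp (- mu * (of_real (\<Sum>m<n. ln ((y m)\<^sup>2) / 2) + a))"
    if y: "y \<in> off_axes n" and sg: "Delta n y < 0 \<longleftrightarrow> D < 0" for y
  proof -
    have ne: "Delta n y \<noteq> 0" using y by (auto simp: Delta_def off_axes_def)
    have "ln \<bar>Delta n y\<bar> = (\<Sum>m<n. ln \<bar>y m\<bar>)"
      unfolding Delta_def abs_prod using y by (intro ln_prod) (auto simp: off_axes_def)
    also have "\<dots> = (\<Sum>m<n. ln ((y m)\<^sup>2) / 2)"
    proof (rule sum.cong[OF refl])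
      fix m assume "m \<in> {..<n}"
      then have "ln (\<bar>y m\<bar> ^ 2) = 2 * ln \<bar>y m\<bar>"
        using y by (subst ln_realpow) (auto simp: off_axes_def)
      then show "ln \<bar>y m\<bar> = ln ((y m)\<^sup>2) / 2" by simp
    qed
    finally have "Ln (of_real (Delta n y)) = of_real (\<Sum>m<n. ln ((y m)\<^sup>2) / 2) + a"
      using Ln_of_real'[OF ne] sg by (simp add: a_def)
    then show ?thesis by (simp only: Delta_pow_def)
  qed
  have "((\<lambda>t. Delta n (?p t)) \<longlongrightarrow> Delta n (?p 0)) (nhds 0)"
    unfolding Delta_def by (intro tendsto_prod tendsto_intros filterlim_ident)
  then have lim: "((\<lambda>t. Delta n (?p t)) \<longlongrightarrow> D) (nhds 0)" by (simp add: D_def)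
  have sgn_ev: "\<forall>\<^sub>F t in nhds 0. Delta n (?p t) < 0 \<longleftrightarrow> D < 0"
  proof (cases "D < 0")
    case True
    from order_tendstoD(2)[OF lim True] show ?thesis using True by simp
  next
    case False
    then have "0 < D" using D0 by simp
    from order_tendstoD(1)[OF lim this] show ?thesis by eventually_elim (use False in auto)
  qed
  have ev: "\<forall>\<^sub>F t in nhds 0. Delta_pow n mu (?p t) = exp (- mu * (of_real (H t) + a))"
    using sgn_ev eventually_off_axes[OF x, of v]
    by eventually_elim (simp only: H_def pow)
  have "(H has_real_derivative (\<Sum>m<n. v m / x m)) (at 0)"
    unfolding H_def
  proof (rule DERIV_sum)
    fix m assume "m \<in> {..<n}"
    then have "x m \<noteq> 0" using x by (simp add: off_axes_def)
    moreover from this have "0 < x m * x m"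
      using zero_less_power2[of "x m"] by (simp add: power2_eq_square)
    ultimately show "((\<lambda>t. ln ((x m + t * v m)\<^sup>2) / 2) has_real_derivative v m / x m) (at 0)"
      by (auto intro!: derivative_eq_intros simp: power2_eq_square divide_simps)
  qed
  then have H: "((\<lambda>t. complex_of_real (H t)) has_vector_derivative of_real (\<Sum>m<n. v m / x m)) (at 0)"
    by (rule has_vector_derivative_of_real)
  have inner: "((\<lambda>t. - mu * (of_real (H t) + a)) has_vector_derivative - mu * of_real (\<Sum>m<n. v m / x m)) (at 0)"
    using has_vector_derivative_mult_right[OF has_vector_derivative_add[OF H has_vector_derivative_const], of "- mu" a]
    by simp
  have "((exp \<circ> (\<lambda>t. - mu * (of_real (H t) + a))) has_vector_derivative
      (- mu * of_real (\<Sum>m<n. v m / x m)) * exp (- mu * (of_real (H 0) + a))) (at 0)"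
    by (rule field_vector_diff_chain_at[OF inner DERIV_exp])
  then have der: "((\<lambda>t. exp (- mu * (of_real (H t) + a))) has_vector_derivative
      (- mu * of_real (\<Sum>m<n. v m / x m)) * exp (- mu * (of_real (H 0) + a))) (at 0)"
    by (simp only: o_def)
  have at0: "Delta_pow n mu x = exp (- mu * (of_real (H 0) + a))"
    using pow[OF x] by (simp add: H_def D_def)
  have "((\<lambda>t. Delta_pow n mu (?p t)) has_vector_derivative
      (- mu * of_real (\<Sum>m<n. v m / x m)) * exp (- mu * (of_real (H 0) + a))) (at 0) =
    ((\<lambda>t. exp (- mu * (of_real (H t) + a))) has_vector_derivative
      (- mu * of_real (\<Sum>m<n. v m / x m)) * exp (- mu * (of_real (H 0) + a))) (at 0)"
  proof (rule has_vector_derivative_cong_ev)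
    show "\<forall>\<^sub>F t in nhds 0. t \<in> UNIV \<longrightarrow> Delta_pow n mu (?p t) = exp (- mu * (of_real (H t) + a))"
      using ev by simp
    show "Delta_pow n mu (?p 0) = exp (- mu * (of_real (H 0) + a))" using at0 by simp
  qed
  then show ?thesis using der at0 by simp
qed

section \<open>Twisting by a power of \<open>Delta\<close> and inverting coordinates\<close>

definition twist :: "nat \<Rightarrow> complex \<Rightarrow> fn \<Rightarrow> fn" where
  "twist n mu g x = Delta_pow n mu x * g (\<lambda>i. 1 / x i)"

text \<open>The operator that \<open>dunkl k n j\<close> becomes after conjugation with \<open>twist n mu\<close>.\<close>
definition tw_dunkl :: "real \<Rightarrow> nat \<Rightarrow> complex \<Rightarrow> nat \<Rightarrow> fn \<Rightarrow> fn" where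
  "tw_dunkl k n mu j g y = - (of_real (y j) * (mu * g y + of_real (y j) * dunkl k n j g y
     - of_real k * (\<Sum>l\<in>{..<n}-{j}. g y - g (sw j l y))))"

lemma tw_dunkl_Pol:
  assumes "g \<in> Pol n" "j < n"
  shows "tw_dunkl k n mu j g \<in> Pol n"
proof -
  have "(\<lambda>y. (-1) * (of_real (y j) * (mu * g y + of_real (y j) * dunkl k n j g y
     - of_real k * (\<Sum>l\<in>{..<n}-{j}. g y - g (sw j l y))))) \<in> Pol n"
    using assms by (intro Pol_cmult Pol.coord Pol_diff Pol.add Pol_sum Pol_sw dunkl_Pol) auto
  then show ?thesis by (simp add: tw_dunkl_def[abs_def])
qed

lemma tw_dunkl_add:
  assumes "f \<in> Pol n" "g \<in> Pol n" "j < n"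
  shows "tw_dunkl k n mu j (\<lambda>y. f y + g y) y = tw_dunkl k n mu j f y + tw_dunkl k n mu j g y"
proof -
  have "(\<Sum>l\<in>{..<n}-{j}. f y + g y - (f (sw j l y) + g (sw j l y)))
      = (\<Sum>l\<in>{..<n}-{j}. f y - f (sw j l y)) + (\<Sum>l\<in>{..<n}-{j}. g y - g (sw j l y))"
    by (subst sum.distrib[symmetric]) (simp add: algebra_simps)
  then show ?thesis
    unfolding tw_dunkl_def dunkl_add[OF assms(3) Pol_line_diff[OF assms(1)] Pol_line_diff[OF assms(2)]]
    by (simp add: algebra_simps)
qed

lemma tw_dunkl_cmult:
  assumes "g \<in> Pol n" "j < n"
  shows "tw_dunkl k n mu j (\<lambda>y. a * g y) y = a * tw_dunkl k n mu j g y"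
proof -
  have "(\<Sum>l\<in>{..<n}-{j}. a * g y - a * g (sw j l y)) = a * (\<Sum>l\<in>{..<n}-{j}. g y - g (sw j l y))"
    unfolding sum_distrib_left by (simp only: right_diff_distrib)
  then show ?thesis
    unfolding tw_dunkl_def dunkl_cmult[OF assms(2) Pol_line_diff[OF assms(1)]]
    by (simp add: algebra_simps)
qed

lemma tw_dunkl_perm:
  assumes g: "g \<in> Pol n" and s: "s permutes {..<n}" and j: "j < n"
  shows "tw_dunkl k n mu (s j) (\<lambda>y. g (y \<circ> s)) y = tw_dunkl k n mu j g (y \<circ> s)"
proof -
  have inj: "inj s" by (rule permutes_inj[OF s])
  have im: "s ` ({..<n} - {j}) = {..<n} - {s j}"
    using permutes_image[OF s] inj by (simp add: image_set_diff)
  have "(\<Sum>l\<in>s ` ({..<n}-{j}). g (y \<circ> s) - g (sw (s j) l y \<circ> s))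
      = (\<Sum>l\<in>{..<n}-{j}. g (y \<circ> s) - g (sw (s j) (s l) y \<circ> s))"
    by (subst sum.reindex[OF inj_on_subset[OF inj subset_UNIV]]) simp
  also have "\<dots> = (\<Sum>l\<in>{..<n}-{j}. g (y \<circ> s) - g (sw j l (y \<circ> s)))"
    by (simp only: sw_comp[OF inj])
  finally have "(\<Sum>l\<in>{..<n}-{s j}. g (y \<circ> s) - g (sw (s j) l y \<circ> s))
      = (\<Sum>l\<in>{..<n}-{j}. g (y \<circ> s) - g (sw j l (y \<circ> s)))"
    unfolding im .
  then show ?thesis
    unfolding tw_dunkl_def using dunkl_perm[OF s j Pol_line_diff[OF g]]
    by (simp only: o_apply)
qed

lemma twist_has_vector_derivative:
  assumes g: "g \<in> Pol n" and x: "x \<in> off_axes n"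
  shows "((\<lambda>t. twist n mu g (\<lambda>m. x m + t * v m)) has_vector_derivative
    Delta_pow n mu x * (dirderiv (\<lambda>m. - v m / (x m)\<^sup>2) g (\<lambda>i. 1 / x i)
      - mu * of_real (\<Sum>m<n. v m / x m) * g (\<lambda>i. 1 / x i))) (at 0)"
proof -
  have "((\<lambda>t. g (\<lambda>m. 1 / (x m + t * v m))) has_vector_derivative
      dirderiv (\<lambda>m. - v m / (x m)\<^sup>2) g (\<lambda>m. 1 / (x m + 0 * v m))) (at 0)"
  \<comment> \<open>The inverted line is a curve with velocity -v/x^2, taken componentwise, at
    0.\<close>
  proof (rule Pol_chain[OF g])
    fix m assume "m < n"
    then have "x m \<noteq> 0" using x by (simp add: off_axes_def)
    then show "((\<lambda>t. 1 / (x m + t * v m)) has_vector_derivative - v m / (x m)\<^sup>2) (at 0)"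
      by (auto intro!: derivative_eq_intros simp: power2_eq_square
          has_real_derivative_iff_has_vector_derivative[symmetric])
  qed
  from has_vector_derivative_mult[OF Delta_pow_has_vector_derivative[OF x] this, of mu v]
  show ?thesis by (simp add: twist_def algebra_simps)
qed

lemma line_diff_twist: "g \<in> Pol n \<Longrightarrow> x \<in> off_axes n \<Longrightarrow> line_diff (twist n mu g) x"
  by (rule line_diffI, rule twist_has_vector_derivative)

lemma dirderiv_twist:
  assumes "g \<in> Pol n" "x \<in> off_axes n"
  shows "dirderiv v (twist n mu g) x = Delta_pow n mu x *
    (dirderiv (\<lambda>m. - v m / (x m)\<^sup>2) g (\<lambda>i. 1 / x i)
      - mu * of_real (\<Sum>m<n. v m / x m) * g (\<lambda>i. 1 / x i))"
  by (rule dirderivI, rule twist_has_vector_derivative[OF assms])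

lemma sw_inverse: "(\<lambda>i. 1 / sw j l x i) = sw j l (\<lambda>i. 1 / x i)"
  by (auto simp: sw_def fun_eq_iff)

text \<open>The power of \<open>Delta\<close> is symmetric and factors out, and 1/x_j - 1/x_l =
  -(x_j - x_l)/(x_j x_l). On the hyperplane the logarithmic derivative of \<open>Delta\<close> in
  direction e_j - e_l vanishes and inversion scales this direction by -1/x_j^2.\<close>

lemma dq_twist:
  assumes g: "g \<in> Pol n" and x: "x \<in> off_axes n" and jl: "j < n" "l < n"
  shows "dq (twist n mu g) j l x
    = - (Delta_pow n mu x * of_real (1 / x j) * of_real (1 / x l) * dq g j l (\<lambda>i. 1 / x i))"
proof (cases "x j = x l")
  case True
  let ?v = "\<lambda>m. unitv j m - unitv l m"
  have "(\<Sum>m<n. ?v m / x m) = (\<Sum>m<n. unitv j m / x m) - (\<Sum>m<n. unitv l m / x m)"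
    by (simp add: diff_divide_distrib sum_subtractf)
  also have "(\<Sum>m<n. unitv a m / x m) = 1 / x a" if "a < n" for a
  proof -
    have "(\<Sum>m<n. unitv a m / x m) = (\<Sum>m<n. if m = a then 1 / x a else 0)"
      by (rule sum.cong) (auto simp: unitv_def)
    then show ?thesis using that by simp
  qed
  note this[OF jl(1)] also note \<open>\<And>a. a < n \<Longrightarrow> (\<Sum>m<n. unitv a m / x m) = 1 / x a\<close>[OF jl(2)]
  finally have s0: "(\<Sum>m<n. ?v m / x m) = 0" using True by simp
  have dir: "(\<lambda>m. - ?v m / (x m)\<^sup>2) = (\<lambda>m. (- 1 / (x j)\<^sup>2) * ?v m)"
    using True by (auto simp: unitv_def fun_eq_iff)
  have "dirderiv ?v (twist n mu g) x
      = Delta_pow n mu x * (of_real (- 1 / (x j)\<^sup>2) * dirderiv ?v g (\<lambda>i. 1 / x i))"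
    unfolding dirderiv_twist[OF g x] s0 dir dirderiv_scale[OF Pol_line_diff[OF g]] by simp
  then show ?thesis using True by (simp add: dq_def power2_eq_square)
next
  case False
  have nz: "x j \<noteq> 0" "x l \<noteq> 0" using x jl by (auto simp: off_axes_def)
  have ne: "1 / x j \<noteq> 1 / x l" using False by simp
  let ?A = "g (\<lambda>i. 1 / x i) - g (sw j l (\<lambda>i. 1 / x i))"
  have "twist n mu g x - twist n mu g (sw j l x) = Delta_pow n mu x * ?A"
    by (simp add: twist_def Delta_pow_sw[OF jl] sw_inverse right_diff_distrib)
  then have q: "dq (twist n mu g) j l x = Delta_pow n mu x * ?A * (1 / of_real (x j - x l))"
    using False by (simp add: dq_def)
  have q': "dq g j l (\<lambda>i. 1 / x i) = ?A / of_real (1 / x j - 1 / x l)"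
    using ne by (simp add: dq_def)
  have "1 / (x j - x l) = - ((1 / x j) * (1 / x l) * (1 / (1 / x j - 1 / x l)))"
    using nz False by (simp add: field_simps)
  from arg_cong[OF this, of complex_of_real]
  have r: "1 / of_real (x j - x l)
      = - (complex_of_real (1 / x j) * of_real (1 / x l) * (1 / of_real (1 / x j - 1 / x l)))"
    by (simp only: of_real_1 of_real_divide of_real_minus of_real_mult)
  have alg: "D * A * - (u * w * (1 / z)) = - (D * u * w * (A / z))" for D A u w z :: complex
    by simp
  show ?thesis unfolding q q' r by (rule alg)
qed

text \<open>Writing y_l = y_j - (y_j - y_l) trades the factor y_l left by inversion for y_j. The
  difference g - g(s_jl y) released here is the origin of the reflection sum in
  \<open>tw_dunkl\<close>.\<close>

lemma coord_dq_exchange: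
  "of_real (y l) * dq g j l y = of_real (y j) * dq g j l y - (g y - g (sw j l y))"
proof (cases "y j = y l")
  case True then show ?thesis by (simp add: sw_same)
next
  case False
  then have "complex_of_real (y j - y l) * dq g j l y = g y - g (sw j l y)" by (simp add: dq_def)
  then show ?thesis by (simp add: algebra_simps)
qed

lemma dunkl_twist:
  assumes g: "g \<in> Pol n" and x: "x \<in> off_axes n" and j: "j < n"
  shows "dunkl k n j (twist n mu g) x = twist n mu (tw_dunkl k n mu j g) x"
proof -
  let ?y = "\<lambda>i. 1 / x i"
  let ?D = "Delta_pow n mu x"
  let ?L = "{..<n} - {j}"
  have x0: "x j \<noteq> 0" using x j by (simp add: off_axes_def)
  have "(\<Sum>m<n. unitv j m / x m) = (\<Sum>m<n. if m = j then 1 / x j else 0)"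
    by (rule sum.cong) (auto simp: unitv_def)
  then have s: "(\<Sum>m<n. unitv j m / x m) = 1 / x j" using j by simp
  have dir: "(\<lambda>m. - unitv j m / (x m)\<^sup>2) = (\<lambda>m. (- ((1 / x j) * (1 / x j))) * unitv j m)"
    by (auto simp: unitv_def fun_eq_iff power2_eq_square)
  have d: "dirderiv (unitv j) (twist n mu g) x = ?D * (- (of_real (?y j) * of_real (?y j) * dirderiv (unitv j) g ?y)
      - mu * of_real (?y j) * g ?y)"
    unfolding dirderiv_twist[OF g x] s dir dirderiv_scale[OF Pol_line_diff[OF g]] by simp
  have "(\<Sum>l\<in>?L. dq (twist n mu g) j l x) = (\<Sum>l\<in>?L. - (?D * of_real (?y j) * of_real (?y l) * dq g j l ?y))"
    using dq_twist[OF g x j] by (intro sum.cong) auto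
  also have "\<dots> = - (?D * of_real (?y j) * (\<Sum>l\<in>?L. of_real (?y l) * dq g j l ?y))"
    by (simp add: sum_distrib_left sum_negf mult.assoc)
  also have "(\<Sum>l\<in>?L. of_real (?y l) * dq g j l ?y)
      = of_real (?y j) * (\<Sum>l\<in>?L. dq g j l ?y) - (\<Sum>l\<in>?L. g ?y - g (sw j l ?y))"
    unfolding sum_distrib_left sum_subtractf[symmetric]
    by (rule sum.cong[OF refl]) (rule coord_dq_exchange)
  finally have q: "(\<Sum>l\<in>?L. dq (twist n mu g) j l x) = - (?D * of_real (?y j) *
      (of_real (?y j) * (\<Sum>l\<in>?L. dq g j l ?y) - (\<Sum>l\<in>?L. g ?y - g (sw j l ?y))))" .
  have alg: "D * (- (Y * Y * d) - m * Y * b) + K * - (D * Y * (Y * s - t))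
      = D * - (Y * (m * b + Y * (d + K * s) - K * t))" for D Y d m b K s t :: complex
    by (simp add: algebra_simps)
  show ?thesis
    unfolding dunkl_eq[OF j line_diff_twist[OF g x]] d q twist_def tw_dunkl_def
      dunkl_eq[OF j Pol_line_diff[OF g]]
    by (rule alg)
qed

lemma dunkl_cong_twist:
  assumes "g \<in> Pol n" "j < n" "x \<in> off_axes n" "\<And>x. x \<in> off_axes n \<Longrightarrow> f x = twist n mu g x"
  shows "dunkl k n j f x = twist n mu (tw_dunkl k n mu j g) x"
  using dunkl_cong_off_axes[OF assms(3,4)] dunkl_twist[OF assms(1,3,2)] by simp

section \<open>Commutators of Dunkl operators and coordinates\<close>

lemma dunkl_dunkl_coord_other:
  assumes ijm: "i < n" "j < n" "m < n" "i \<noteq> j" "m \<noteq> i" "m \<noteq> j"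
    and f: "\<And>x. x \<in> off_axes n \<Longrightarrow> line_diff f x"
    and Tf: "\<And>x. x \<in> off_axes n \<Longrightarrow> line_diff (dunkl k n j f) x"
    and x: "x \<in> off_axes n"
  shows "dunkl k n i (dunkl k n j (\<lambda>x. of_real (x m) * f x)) x
    = of_real (x m) * dunkl k n i (dunkl k n j f) x
      - of_real k * dunkl k n j f (sw i m x) - of_real k * dunkl k n i f (sw j m x)"
proof -
  have x': "sw j m x \<in> off_axes n" by (rule off_axes_sw[OF ijm(2,3) x])
  have "dunkl k n i (dunkl k n j (\<lambda>x. of_real (x m) * f x)) x
      = dunkl k n i (\<lambda>y. of_real (y m) * dunkl k n j f y + (- of_real k) * f (sw j m y)) x"
    by (rule dunkl_cong_off_axes[OF x]) (simp add: dunkl_coord_other[OF ijm(2,3,6) f])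
  also have "\<dots> = dunkl k n i (\<lambda>y. of_real (y m) * dunkl k n j f y) x
      + dunkl k n i (\<lambda>y. (- of_real k) * f (sw j m y)) x"
    using f[OF x'] Tf[OF x]
    by (intro dunkl_add line_diff_coord line_diff_cmult line_diff_sw ijm(1))
  also have "dunkl k n i (\<lambda>y. (- of_real k) * f (sw j m y)) x = (- of_real k) * dunkl k n i (\<lambda>y. f (sw j m y)) x"
    using f[OF x'] by (intro dunkl_cmult line_diff_sw ijm(1))
  also have "dunkl k n i (\<lambda>y. f (sw j m y)) x = dunkl k n i f (sw j m x)"
    using dunkl_sw[OF ijm(2,3,1) f[OF x']] ijm by simp
  finally show ?thesis
    using dunkl_coord_other[OF ijm(1,3,5) Tf[OF x]] by simp
qed

text \<open>The correction from T_j cancels the summand l = j of the correction from T_i, since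
  conjugation by s_ij turns T_i into T_j. What remains is the remainder found for the opposite order
  of the operators.\<close>

lemma dunkl_dunkl_coord_outer:
  assumes ij: "i < n" "j < n" "i \<noteq> j"
    and f: "\<And>x. x \<in> off_axes n \<Longrightarrow> line_diff f x"
    and Tf: "\<And>x. x \<in> off_axes n \<Longrightarrow> line_diff (dunkl k n j f) x"
    and x: "x \<in> off_axes n"
  shows "dunkl k n i (dunkl k n j (\<lambda>x. of_real (x i) * f x)) x
    = of_real (x i) * dunkl k n i (dunkl k n j f) x + dunkl k n j f x
      + of_real k * (\<Sum>l\<in>{..<n}-{i}-{j}. dunkl k n j f (sw i l x))"
proof -
  have x': "sw j i x \<in> off_axes n" by (rule off_axes_sw[OF ij(2,1) x])
  have "dunkl k n i (dunkl k n j (\<lambda>x. of_real (x i) * f x)) x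
      = dunkl k n i (\<lambda>y. of_real (y i) * dunkl k n j f y + (- of_real k) * f (sw j i y)) x"
    by (rule dunkl_cong_off_axes[OF x]) (simp add: dunkl_coord_other[OF ij(2,1,3) f])
  also have "\<dots> = dunkl k n i (\<lambda>y. of_real (y i) * dunkl k n j f y) x
      + dunkl k n i (\<lambda>y. (- of_real k) * f (sw j i y)) x"
    using f[OF x'] Tf[OF x]
    by (intro dunkl_add line_diff_coord line_diff_cmult line_diff_sw ij(1))
  also have "dunkl k n i (\<lambda>y. (- of_real k) * f (sw j i y)) x = (- of_real k) * dunkl k n i (\<lambda>y. f (sw j i y)) x"
    using f[OF x'] by (intro dunkl_cmult line_diff_sw ij(1))
  also have "dunkl k n i (\<lambda>y. f (sw j i y)) x = dunkl k n j f (sw i j x)"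
    using dunkl_sw[OF ij(2,1) ij(2) f[OF x']] by (simp add: sw_commute[of i j])
  also have "dunkl k n i (\<lambda>y. of_real (y i) * dunkl k n j f y) x = of_real (x i) * dunkl k n i (dunkl k n j f) x
      + dunkl k n j f x + of_real k * (\<Sum>l\<in>{..<n}-{i}. dunkl k n j f (sw i l x))"
    by (rule dunkl_coord_self[OF ij(1) Tf[OF x]])
  also have "(\<Sum>l\<in>{..<n}-{i}. dunkl k n j f (sw i l x))
      = dunkl k n j f (sw i j x) + (\<Sum>l\<in>{..<n}-{i}-{j}. dunkl k n j f (sw i l x))"
    using ij by (intro sum.remove) auto
  finally show ?thesis by (simp add: algebra_simps)
qed

text \<open>The opposite order: now T_j sends f composed with s_ij to T_i f composed with s_ij,
  which cancels the correction from moving x_i past T_j. The other reflections s_il fix j and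
  commute with T_j.\<close>

lemma dunkl_dunkl_coord_inner:
  assumes ij: "i < n" "j < n" "i \<noteq> j"
    and f: "\<And>x. x \<in> off_axes n \<Longrightarrow> line_diff f x"
    and Tf: "\<And>x. x \<in> off_axes n \<Longrightarrow> line_diff (dunkl k n i f) x"
    and x: "x \<in> off_axes n"
  shows "dunkl k n j (dunkl k n i (\<lambda>x. of_real (x i) * f x)) x
    = of_real (x i) * dunkl k n j (dunkl k n i f) x + dunkl k n j f x
      + of_real k * (\<Sum>l\<in>{..<n}-{i}-{j}. dunkl k n j f (sw i l x))"
proof -
  let ?L = "{..<n} - {i}"
  have x': "sw i l x \<in> off_axes n" if "l \<in> ?L" for l
    using that by (intro off_axes_sw[OF ij(1) _ x]) simp
  have fs: "line_diff (\<lambda>y. f (sw i l y)) x" if "l \<in> ?L" for l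
    by (rule line_diff_sw[OF f[OF x'[OF that]]])
  have "dunkl k n j (dunkl k n i (\<lambda>x. of_real (x i) * f x)) x
      = dunkl k n j (\<lambda>y. (of_real (y i) * dunkl k n i f y + f y) + of_real k * (\<Sum>l\<in>?L. f (sw i l y))) x"
    by (rule dunkl_cong_off_axes[OF x]) (simp add: dunkl_coord_self[OF ij(1) f])
  also have "\<dots> = dunkl k n j (\<lambda>y. of_real (y i) * dunkl k n i f y + f y) x
      + dunkl k n j (\<lambda>y. of_real k * (\<Sum>l\<in>?L. f (sw i l y))) x"
    using f[OF x] Tf[OF x] fs
    by (intro dunkl_add line_diff_add line_diff_coord line_diff_cmult line_diff_sum ij(2))
  also have "dunkl k n j (\<lambda>y. of_real (y i) * dunkl k n i f y + f y) x
      = dunkl k n j (\<lambda>y. of_real (y i) * dunkl k n i f y) x + dunkl k n j f x"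
    using f[OF x] Tf[OF x] by (intro dunkl_add line_diff_coord ij(2))
  also have "dunkl k n j (\<lambda>y. of_real (y i) * dunkl k n i f y) x
      = of_real (x i) * dunkl k n j (dunkl k n i f) x - of_real k * dunkl k n i f (sw j i x)"
    by (rule dunkl_coord_other[OF ij(2,1,3) Tf[OF x]])
  also have "dunkl k n j (\<lambda>y. of_real k * (\<Sum>l\<in>?L. f (sw i l y))) x
      = of_real k * dunkl k n j (\<lambda>y. \<Sum>l\<in>?L. f (sw i l y)) x"
    using fs by (intro dunkl_cmult line_diff_sum ij(2))
  also have "dunkl k n j (\<lambda>y. \<Sum>l\<in>?L. f (sw i l y)) x = (\<Sum>l\<in>?L. dunkl k n j (\<lambda>y. f (sw i l y)) x)"
    using fs by (intro dunkl_sum ij(2))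
  also have "\<dots> = dunkl k n j (\<lambda>y. f (sw i j y)) x + (\<Sum>l\<in>?L-{j}. dunkl k n j (\<lambda>y. f (sw i l y)) x)"
    using ij by (intro sum.remove) auto
  also have "dunkl k n j (\<lambda>y. f (sw i j y)) x = dunkl k n i f (sw i j x)"
    using dunkl_sw[OF ij(1,2) ij(1) f[OF x']] ij by simp
  also have "(\<Sum>l\<in>?L-{j}. dunkl k n j (\<lambda>y. f (sw i l y)) x) = (\<Sum>l\<in>?L-{j}. dunkl k n j f (sw i l x))"
  proof (rule sum.cong[OF refl])
    fix l assume l: "l \<in> ?L - {j}"
    then have "l < n" "l \<in> ?L" "tau i l j = j" using ij by auto
    then show "dunkl k n j (\<lambda>y. f (sw i l y)) x = dunkl k n j f (sw i l x)"
      using dunkl_sw[OF ij(1) \<open>l < n\<close> ij(2) f[OF x']] by simp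
  qed
  finally show ?thesis by (simp add: sw_commute[of j i] algebra_simps)
qed

text \<open>In each case both orders of the operators leave identical corrections: by
  \<open>dunkl_dunkl_coord_outer\<close> and \<open>dunkl_dunkl_coord_inner\<close> if m is i or j,
  and by the symmetry of \<open>dunkl_dunkl_coord_other\<close> in i and j otherwise.\<close>

lemma dunkl_commutator_coord:
  assumes ij: "i < n" "j < n" "i \<noteq> j" and m: "m < n"
    and f: "\<And>x. x \<in> off_axes n \<Longrightarrow> line_diff f x"
    and Ti: "\<And>x. x \<in> off_axes n \<Longrightarrow> line_diff (dunkl k n i f) x"
    and Tj: "\<And>x. x \<in> off_axes n \<Longrightarrow> line_diff (dunkl k n j f) x"
    and x: "x \<in> off_axes n"
  shows "dunkl k n i (dunkl k n j (\<lambda>x. of_real (x m) * f x)) x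
      - dunkl k n j (dunkl k n i (\<lambda>x. of_real (x m) * f x)) x
    = of_real (x m) * (dunkl k n i (dunkl k n j f) x - dunkl k n j (dunkl k n i f) x)"
proof -
  consider "m = i" | "m = j" | "m \<noteq> i" "m \<noteq> j" by blast
  then show ?thesis
  proof cases
    case 1
    show ?thesis
      unfolding 1 right_diff_distrib
      by (subst dunkl_dunkl_coord_outer[OF ij f Tj x], assumption+,
          subst dunkl_dunkl_coord_inner[OF ij f Ti x], assumption+) simp
  next
    case 2
    show ?thesis
      unfolding 2 right_diff_distrib
      by (subst dunkl_dunkl_coord_outer[OF ij(2,1) ij(3)[symmetric] f Ti x], assumption+,
          subst dunkl_dunkl_coord_inner[OF ij(2,1) ij(3)[symmetric] f Tj x], assumption+) simp
  next
    case 3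
    show ?thesis
      unfolding right_diff_distrib
      by (subst dunkl_dunkl_coord_other[OF ij(1,2) m ij(3) 3 f Tj x], assumption+,
          subst dunkl_dunkl_coord_other[OF ij(2,1) m ij(3)[symmetric] 3(2,1) f Ti x], assumption+) simp
  qed
qed

lemma tw_dunkl_const: "tw_dunkl k n mu j (\<lambda>_. a) = (\<lambda>y. of_real (y j) * (- (mu * a)))"
  by (simp add: fun_eq_iff tw_dunkl_def dunkl_const)

text \<open>The symmetry of the result in i and j, combined with \<open>tw_dunkl_const\<close>, is
  the commutation on constants.\<close>

lemma tw_dunkl_coord_const:
  assumes "i < n" "j < n" "i \<noteq> j"
  shows "tw_dunkl k n mu i (\<lambda>y. of_real (y j) * a) y = of_real (y i) * of_real (y j) * ((of_real k - mu) * a)"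
proof -
  have "(\<Sum>l\<in>{..<n}-{i}. of_real (y j) * a - of_real (sw i l y j) * a)
      = (\<Sum>l\<in>{..<n}-{i}. if l = j then (of_real (y j) - of_real (y i)) * a else 0)"
    using assms by (intro sum.cong) (auto simp: sw_def algebra_simps)
  also have "\<dots> = (of_real (y j) - of_real (y i)) * a" using assms by simp
  finally have s: "(\<Sum>l\<in>{..<n}-{i}. of_real (y j) * a - of_real (sw i l y j) * a)
      = (of_real (y j) - of_real (y i)) * a" .
  have "dunkl k n i (\<lambda>y. of_real (y j) * a) y = - (of_real k * a)"
    using dunkl_coord_other[OF assms(1,2) assms(3)[symmetric] line_diff_const, of k a y]
    by (simp add: dunkl_const)
  then show ?thesis unfolding tw_dunkl_def s by (simp add: algebra_simps)
qed

text \<open>The commutator of two Dunkl operators commutes with multiplication by coordinates, so it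
  vanishes on all twisted polynomials as soon as it vanishes on twisted constants.\<close>
lemma tw_dunkl_commute:
  assumes g: "g \<in> Pol n" and ij: "i < n" "j < n"
  shows "tw_dunkl k n mu i (tw_dunkl k n mu j g) = tw_dunkl k n mu j (tw_dunkl k n mu i g)"
proof (cases "i = j")
  case False
  let ?S = "\<lambda>j. tw_dunkl k n mu j"
  let ?T = "\<lambda>j. dunkl k n j"
  have TT: "?T a (?T b f) x = twist n mu (?S a (?S b h)) x"
    if "h \<in> Pol n" "a < n" "b < n" "x \<in> off_axes n" "\<And>x. x \<in> off_axes n \<Longrightarrow> f x = twist n mu h x" for a b f h x
    using that by (intro dunkl_cong_twist tw_dunkl_Pol)
  have nz: "Delta_pow n mu x \<noteq> 0" for x by (simp add: Delta_pow_def)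
  from g show ?thesis
  proof (induction rule: Pol.induct)
    case (const a)
    show ?case
      unfolding tw_dunkl_const fun_eq_iff tw_dunkl_coord_const[OF ij False]
        tw_dunkl_coord_const[OF ij(2,1) False[symmetric]]
      by (simp add: mult.commute)
  next
    case (add f g)
    have "?S a (?S b (\<lambda>x. f x + g x)) = (\<lambda>x. ?S a (?S b f) x + ?S a (?S b g) x)" if "a < n" "b < n" for a b
    proof -
      have e: "?S b (\<lambda>x. f x + g x) = (\<lambda>x. ?S b f x + ?S b g x)"
        using add.hyps that by (intro ext tw_dunkl_add)
      show ?thesis
        unfolding e using add.hyps that by (intro ext tw_dunkl_add tw_dunkl_Pol)
    qed
    then show ?case using add.IH ij by simp
  next
    case (coord g m)
    let ?G = "\<lambda>x. of_real (x m) * g x"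
    let ?f = "twist n mu ?G"
    have G: "?G \<in> Pol n" using coord.hyps by (rule Pol.coord)
    have ld: "line_diff (?T a ?f) x" if "a < n" "x \<in> off_axes n" for a x
      by (rule line_diff_cong_off_axes[OF that(2) _ line_diff_twist[OF tw_dunkl_Pol[OF G that(1)] that(2)]])
         (rule dunkl_twist[OF G _ that(1)])
    \<comment> \<open>Here y_m = 1/x_m cancels x_m, so multiplying the twisted function by x_m
      strips one coordinate from the polynomial in y and reaches the induction hypothesis.\<close>
    have xf: "of_real (x m) * ?f x = twist n mu g x" if "x \<in> off_axes n" for x
    proof -
      have "x m \<noteq> 0" using that coord.hyps by (simp add: off_axes_def)
      then show ?thesis by (simp add: twist_def)
    qed
    have C: "?T i (?T j ?f) x = ?T j (?T i ?f) x" if x: "x \<in> off_axes n" for x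
    proof -
      have "?T i (?T j (\<lambda>x. of_real (x m) * ?f x)) x - ?T j (?T i (\<lambda>x. of_real (x m) * ?f x)) x
         = of_real (x m) * (?T i (?T j ?f) x - ?T j (?T i ?f) x)"
        by (rule dunkl_commutator_coord[OF ij False coord.hyps(2) line_diff_twist[OF G] ld[OF ij(1)] ld[OF ij(2)] x])
      moreover have "?T i (?T j (\<lambda>x. of_real (x m) * ?f x)) x = twist n mu (?S i (?S j g)) x"
        by (rule TT[OF coord.hyps(1) ij x xf])
      moreover have "?T j (?T i (\<lambda>x. of_real (x m) * ?f x)) x = twist n mu (?S j (?S i g)) x"
        by (rule TT[OF coord.hyps(1) ij(2,1) x xf])
      moreover have "x m \<noteq> 0" using x coord.hyps by (simp add: off_axes_def)
      ultimately show ?thesis using coord.IH by simp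
    qed
    show ?case
    proof (rule Pol_eq_off_axes)
      show "?S i (?S j ?G) \<in> Pol n" "?S j (?S i ?G) \<in> Pol n"
        using G ij by (simp_all add: tw_dunkl_Pol)
      fix y assume y: "y \<in> off_axes n"
      let ?x = "\<lambda>i. 1 / y i"
      have x: "?x \<in> off_axes n" using y by (simp add: off_axes_def)
      have "twist n mu (?S i (?S j ?G)) ?x = twist n mu (?S j (?S i ?G)) ?x"
        using C[OF x] TT[OF G ij x] TT[OF G ij(2,1) x] by simp
      then show "?S i (?S j ?G) y = ?S j (?S i ?G) y"
        using nz by (simp add: twist_def)
    qed
  qed
qed simp

section \<open>Polynomials in the twisted operators\<close>

definition tw_mono :: "real \<Rightarrow> nat \<Rightarrow> complex \<Rightarrow> nat list \<Rightarrow> fn" where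
  "tw_mono k n mu kappa = foldr (\<lambda>j. tw_dunkl k n mu j ^^ (kappa ! j)) [0..<n] (\<lambda>_. 1)"

lemma funpow_tw_dunkl_Pol:
  assumes "g \<in> Pol n" "j < n"
  shows "(tw_dunkl k n mu j ^^ m) g \<in> Pol n"
  using assms by (induction m) (simp_all add: tw_dunkl_Pol)

lemma foldr_tw_dunkl_Pol:
  assumes "g \<in> Pol n" "set js \<subseteq> {..<n}"
  shows "foldr (\<lambda>j. tw_dunkl k n mu j ^^ e j) js g \<in> Pol n"
  using assms by (induction js) (simp_all add: funpow_tw_dunkl_Pol)

lemma tw_mono_Pol: "tw_mono k n mu kappa \<in> Pol n"
  unfolding tw_mono_def by (rule foldr_tw_dunkl_Pol[OF Pol.const]) auto

lemma funpow_dunkl_twist: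
  assumes "g \<in> Pol n" "j < n" "\<And>x. x \<in> off_axes n \<Longrightarrow> f x = twist n mu g x" "x \<in> off_axes n"
  shows "(dunkl k n j ^^ m) f x = twist n mu ((tw_dunkl k n mu j ^^ m) g) x"
  using assms(4)
proof (induction m arbitrary: x)
  case 0
  then show ?case using assms(3) by simp
next
  case (Suc m)
  then show ?case
    using dunkl_cong_twist[OF funpow_tw_dunkl_Pol[OF assms(1,2)] assms(2) Suc.prems Suc.IH] by simp
qed

lemma dunkl_mono_Delta_pow:
  assumes "x \<in> off_axes n"
  shows "dunkl_mono k n kappa (Delta_pow n mu) x = twist n mu (tw_mono k n mu kappa) x"
proof -
  have "foldr (\<lambda>j g. (dunkl k n j ^^ (kappa ! j)) \<circ> g) js id f x
      = twist n mu (foldr (\<lambda>j. tw_dunkl k n mu j ^^ (kappa ! j)) js (\<lambda>_. 1)) x"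
    if "set js \<subseteq> {..<n}" "\<And>x. x \<in> off_axes n \<Longrightarrow> f x = twist n mu (\<lambda>_. 1) x" "x \<in> off_axes n" for js f x
    using that
  proof (induction js arbitrary: x)
    case (Cons a js)
    have a: "a < n" and js: "set js \<subseteq> {..<n}" using Cons.prems(1) by auto
    have e: "foldr (\<lambda>j g. (dunkl k n j ^^ (kappa ! j)) \<circ> g) (a # js) id f
        = (dunkl k n a ^^ (kappa ! a)) (foldr (\<lambda>j g. (dunkl k n j ^^ (kappa ! j)) \<circ> g) js id f)"
      "foldr (\<lambda>j. tw_dunkl k n mu j ^^ (kappa ! j)) (a # js) (\<lambda>_. 1)
        = (tw_dunkl k n mu a ^^ (kappa ! a)) (foldr (\<lambda>j. tw_dunkl k n mu j ^^ (kappa ! j)) js (\<lambda>_. 1))"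
      by simp_all
    show ?case
      unfolding e
      by (rule funpow_dunkl_twist[OF foldr_tw_dunkl_Pol[OF Pol.const js] a Cons.IH[OF js Cons.prems(2)] Cons.prems(3)])
  qed simp
  from this[of "[0..<n]" "Delta_pow n mu" x] show ?thesis
    using assms unfolding dunkl_mono_def tw_mono_def by (simp add: twist_def subset_iff)
qed

text \<open>By commutation an additional factor moves past the earlier powers to its place in the
  prescribed order.\<close>

lemma tw_dunkl_foldr:
  assumes "g \<in> Pol n" "set js \<subseteq> {..<n}" "distinct js" "m \<in> set js"
  shows "tw_dunkl k n mu m (foldr (\<lambda>j. tw_dunkl k n mu j ^^ e j) js g)
    = foldr (\<lambda>j. tw_dunkl k n mu j ^^ (e(m := Suc (e m))) j) js g"
  using assms(2-4)
proof (induction js)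
  case (Cons a js)
  have a: "a < n" and js: "set js \<subseteq> {..<n}" "distinct js" "a \<notin> set js" using Cons.prems by auto
  let ?h = "foldr (\<lambda>j. tw_dunkl k n mu j ^^ e j) js g"
  have h: "?h \<in> Pol n" by (rule foldr_tw_dunkl_Pol[OF assms(1) js(1)])
  show ?case
  proof (cases "a = m")
    case True
    have "foldr (\<lambda>j. tw_dunkl k n mu j ^^ (e(m := Suc (e m))) j) js g = ?h"
      using True js by (intro foldr_cong) auto
    then show ?thesis using True by simp
  next
    case False
    then have m: "m \<in> set js" "m < n" using Cons.prems by auto
    have comm: "tw_dunkl k n mu m ((tw_dunkl k n mu a ^^ p) ?h)
        = (tw_dunkl k n mu a ^^ p) (tw_dunkl k n mu m ?h)" for p
      by (induction p) (simp_all add: tw_dunkl_commute[OF funpow_tw_dunkl_Pol[OF h a] m(2) a])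
    show ?thesis using False comm[of "e a"] Cons.IH[OF js(1,2) m(1)] by simp
  qed
qed simp

lemma tw_dunkl_tw_mono:
  assumes "length kappa = n" "m < n"
  shows "tw_dunkl k n mu m (tw_mono k n mu kappa) = tw_mono k n mu (raise_index m kappa)"
proof -
  have "tw_dunkl k n mu m (tw_mono k n mu kappa)
      = foldr (\<lambda>j. tw_dunkl k n mu j ^^ ((\<lambda>j. kappa ! j)(m := Suc (kappa ! m))) j) [0..<n] (\<lambda>_. 1)"
    unfolding tw_mono_def using assms by (intro tw_dunkl_foldr Pol.const) auto
  also have "\<dots> = tw_mono k n mu (raise_index m kappa)"
    unfolding tw_mono_def using assms
    by (intro foldr_cong) (auto simp: raise_index_def nth_list_update)
  finally show ?thesis .
qed

lemma tw_dunkl_sum: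
  assumes "\<And>a. a \<in> A \<Longrightarrow> f a \<in> Pol n" "j < n"
  shows "tw_dunkl k n mu j (\<lambda>y. \<Sum>a\<in>A. f a y) y = (\<Sum>a\<in>A. tw_dunkl k n mu j (f a) y)"
  using assms(1)
proof (induction A rule: infinite_finite_induct)
  case (insert a A)
  then show ?case using assms(2) by (simp add: tw_dunkl_add Pol_sum)
qed (simp_all add: tw_dunkl_const)

lemma lin_comb_cong:
  "(\<And>kappa. c kappa \<noteq> 0 \<Longrightarrow> B kappa x = B' kappa x) \<Longrightarrow> lin_comb B c x = lin_comb B' c x"
  unfolding lin_comb_def by (rule sum.cong) auto

text \<open>\<open>tw_rel k n mu f h\<close> says that \<open>h\<close> is obtained from the polynomial \<open>f\<close> by substituting
  the twisted Dunkl operators for the variables and applying the result to \<open>1\<close>.\<close>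
inductive tw_rel :: "real \<Rightarrow> nat \<Rightarrow> complex \<Rightarrow> fn \<Rightarrow> fn \<Rightarrow> bool" for k n mu where
  const: "tw_rel k n mu (\<lambda>_. a) (\<lambda>_. a)"
| add: "tw_rel k n mu f h \<Longrightarrow> tw_rel k n mu f' h' \<Longrightarrow>
    tw_rel k n mu (\<lambda>x. f x + f' x) (\<lambda>x. h x + h' x)"
| coord: "tw_rel k n mu f h \<Longrightarrow> m < n \<Longrightarrow>
    tw_rel k n mu (\<lambda>x. of_real (x m) * f x) (tw_dunkl k n mu m h)"

lemma tw_rel_Pol:
  assumes "tw_rel k n mu f h"
  shows "f \<in> Pol n" "h \<in> Pol n"
proof -
  have "f \<in> Pol n \<and> h \<in> Pol n"
    using assms
    by (induction rule: tw_rel.induct) (auto intro: Pol.intros tw_dunkl_Pol)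
  then show "f \<in> Pol n" "h \<in> Pol n" by auto
qed

lemma tw_rel_cmult:
  assumes "tw_rel k n mu f h"
  shows "tw_rel k n mu (\<lambda>x. a * f x) (\<lambda>x. a * h x)"
  using assms
proof (induction rule: tw_rel.induct)
  case (const b)
  show ?case by (rule tw_rel.const)
next
  case (add f h f' h')
  from tw_rel.add[OF add.IH] show ?case by (simp only: distrib_left)
next
  case (coord f h m)
  have "tw_dunkl k n mu m (\<lambda>x. a * h x) = (\<lambda>x. a * tw_dunkl k n mu m h x)"
    using tw_dunkl_cmult[OF tw_rel_Pol(2)[OF coord.hyps(1)] coord.hyps(2)] by (simp add: fun_eq_iff)
  then show ?case
    using tw_rel.coord[OF coord.IH coord.hyps(2)] by (simp only: mult.left_commute)
qed

lemma tw_rel_perm: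
  assumes s: "s permutes {..<n}" and "tw_rel k n mu f h"
  shows "tw_rel k n mu (\<lambda>x. f (x \<circ> s)) (\<lambda>x. h (x \<circ> s))"
  using assms(2)
proof (induction rule: tw_rel.induct)
  case (const b)
  show ?case by (rule tw_rel.const)
next
  case (add f h f' h')
  from tw_rel.add[OF add.IH] show ?case .
next
  case (coord f h m)
  have "s m < n" using permutes_in_image[OF s] coord.hyps by auto
  note rel = tw_rel.coord[OF coord.IH this]
  have "tw_dunkl k n mu (s m) (\<lambda>x. h (x \<circ> s)) = (\<lambda>x. tw_dunkl k n mu m h (x \<circ> s))"
    by (rule ext) (rule tw_dunkl_perm[OF tw_rel_Pol(2)[OF coord.hyps(1)] s coord.hyps(2)])
  with rel have "tw_rel k n mu (\<lambda>x. of_real (x (s m)) * f (x \<circ> s)) (\<lambda>x. tw_dunkl k n mu m h (x \<circ> s))"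
    by (simp only:)
  moreover have "(\<lambda>x. complex_of_real ((x \<circ> s) m) * f (x \<circ> s)) = (\<lambda>x. of_real (x (s m)) * f (x \<circ> s))"
    by simp
  ultimately show ?case by (simp only:)
qed

lemma tw_rel_sum:
  assumes "\<And>a. a \<in> A \<Longrightarrow> tw_rel k n mu (f a) (h a)"
  shows "tw_rel k n mu (\<lambda>x. \<Sum>a\<in>A. f a x) (\<lambda>x. \<Sum>a\<in>A. h a x)"
  using assms
  by (induction A rule: infinite_finite_induct) (simp_all add: tw_rel.const tw_rel.add)

text \<open>A derivation of \<open>tw_rel\<close> may multiply coordinates in any order, whereas
  \<open>tw_mono\<close> fixes one. Commutation reconciles the two, so h can be computed from
  coefficients of f.\<close>

lemma tw_rel_coeffs:
  assumes "tw_rel k n mu f h"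
  shows "\<exists>c. poly_coeffs n c \<and> f = peval n c \<and> h = lin_comb (tw_mono k n mu) c"
  using assms
proof (induction rule: tw_rel.induct)
  case (const a)
  let ?z = "replicate n (0::nat)"
  have 1: "mono n ?z x = 1" for x by (simp add: mono_def)
  have "tw_mono k n mu ?z = foldr (\<lambda>j. id) [0..<n] (\<lambda>_. 1)"
    unfolding tw_mono_def by (rule foldr_cong) auto
  moreover have "foldr (\<lambda>j. id) js g = g" for js :: "nat list" and g :: fn by (induction js) simp_all
  ultimately have 2: "tw_mono k n mu ?z = (\<lambda>_. 1)" by simp
  show ?case
    by (rule exI[of _ "\<lambda>kappa. if kappa = ?z then a else 0"])
       (simp add: poly_coeffs_single peval_eq_lin_comb lin_comb_single fun_eq_iff 1 2)
next
  case (add f h f' h')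
  then obtain c d where c: "poly_coeffs n c" "f = peval n c" "h = lin_comb (tw_mono k n mu) c"
    and d: "poly_coeffs n d" "f' = peval n d" "h' = lin_comb (tw_mono k n mu) d"
    by blast
  show ?case
    by (rule exI[of _ "\<lambda>kappa. c kappa + d kappa"])
       (simp add: c d poly_coeffs_add peval_eq_lin_comb lin_comb_add[OF c(1) d(1)] fun_eq_iff)
next
  case (coord f h m)
  then obtain c where c: "poly_coeffs n c" "f = peval n c" "h = lin_comb (tw_mono k n mu) c"
    by blast
  have len: "length kappa = n" if "c kappa \<noteq> 0" for kappa
    using that c(1) unfolding poly_coeffs_def by blast
  show ?case
  proof (intro exI[of _ "shift_coeffs n m c"] conjI ext)
    show "poly_coeffs n (shift_coeffs n m c)" by (rule poly_coeffs_shift[OF c(1) coord.hyps(2)])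
    fix x
    have "peval n (shift_coeffs n m c) x = lin_comb (\<lambda>kappa. mono n (raise_index m kappa)) c x"
      unfolding peval_eq_lin_comb by (rule lin_comb_shift[OF c(1) coord.hyps(2)])
    also have "\<dots> = lin_comb (\<lambda>kappa x. of_real (x m) * mono n kappa x) c x"
      by (rule lin_comb_cong) (rule mono_raise_index[OF len coord.hyps(2)])
    also have "\<dots> = of_real (x m) * f x"
      unfolding c(2) peval_def lin_comb_def by (simp add: sum_distrib_left mult.left_commute)
    finally show "of_real (x m) * f x = peval n (shift_coeffs n m c) x" by simp
    have "lin_comb (tw_mono k n mu) (shift_coeffs n m c) x
        = lin_comb (\<lambda>kappa. tw_mono k n mu (raise_index m kappa)) c x"
      by (rule lin_comb_shift[OF c(1) coord.hyps(2)])
    also have "\<dots> = lin_comb (\<lambda>kappa. tw_dunkl k n mu m (tw_mono k n mu kappa)) c x"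
      by (rule lin_comb_cong) (simp add: tw_dunkl_tw_mono[OF len coord.hyps(2)])
    also have "\<dots> = tw_dunkl k n mu m h x"
      unfolding c(3) lin_comb_def[abs_def]
      by (subst tw_dunkl_sum[OF Pol_cmult[OF tw_mono_Pol] coord.hyps(2)])
         (simp only: tw_dunkl_cmult[OF tw_mono_Pol coord.hyps(2)])
    finally show "tw_dunkl k n mu m h x = lin_comb (tw_mono k n mu) (shift_coeffs n m c) x" by simp
  qed
qed

text \<open>By \<open>peval_inj\<close>, the coefficients found through the derivation of
  \<open>tw_rel\<close> are the given ones, over which \<open>polyT\<close> sums.\<close>

lemma polyT_tw_rel:
  assumes c: "poly_coeffs n c" and rel: "tw_rel k n mu (peval n c) h" and x: "x \<in> off_axes n"
  shows "polyT k n c (Delta_pow n mu) x = Delta_pow n mu x * h (\<lambda>i. 1 / x i)"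
proof -
  obtain d where d: "poly_coeffs n d" "peval n c = peval n d" "h = lin_comb (tw_mono k n mu) d"
    using tw_rel_coeffs[OF rel] by blast
  have cd: "c = d" by (rule peval_inj[OF c d(1)]) (simp add: d(2))
  have "polyT k n c (Delta_pow n mu) x
      = (\<Sum>kappa\<in>{kappa. c kappa \<noteq> 0}. Delta_pow n mu x * (c kappa * tw_mono k n mu kappa (\<lambda>i. 1 / x i)))"
    unfolding polyT_def by (rule sum.cong) (simp_all add: dunkl_mono_Delta_pow[OF x] twist_def)
  then show ?thesis unfolding d(3) cd[symmetric] lin_comb_def by (simp add: sum_distrib_left)
qed

subsection \<open>Existence of the Jack polynomials and the theorem\<close>

lemma sw_sw_transpose:
  "sw a b (sw l j x) = sw (tau a b l) (tau a b j) (sw a b x)"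
  using sw_comp[of "tau a b" "tau a b l" "tau a b j" x]
  by (simp add: sw_eq[of a b])

lemma jackD_sw_other:
  assumes f: "f \<in> Pol n" and i: "Suc i < n" and j: "j < n" "j \<noteq> i" "j \<noteq> Suc i"
  shows "jackD k n j (\<lambda>x. f (sw i (Suc i) x)) x = jackD k n j f (sw i (Suc i) x)"
proof -
  let ?t = "tau i (Suc i)"
  let ?x = "sw i (Suc i) x"
  have tj: "?t j = j" using j by simp
  have d: "dunkl k n j (\<lambda>x. f (sw i (Suc i) x)) x = dunkl k n j f ?x"
    using dunkl_sw[OF _ i j(1) Pol_line_diff[OF f], of i k x] i tj by simp
  have inj: "inj_on ?t A" for A by (rule inj_on_inverseI[of _ ?t]) simp
  have "?t ` {j<..<n} = {j<..<n}"
  proof (rule endo_inj_surj)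
    show "?t ` {j<..<n} \<subseteq> {j<..<n}" using i j by (auto simp: tau_def)
  qed (simp_all add: inj)
  then have "(\<Sum>l\<in>{j<..<n}. f (sw l j ?x)) = (\<Sum>l\<in>?t ` {j<..<n}. f (sw l j ?x))" by (simp only:)
  also have "\<dots> = (\<Sum>l\<in>{j<..<n}. f (sw (?t l) j ?x))"
    by (simp add: sum.reindex[OF inj])
  also have "\<dots> = (\<Sum>l\<in>{j<..<n}. f (sw i (Suc i) (sw l j x)))"
    by (simp only: sw_sw_transpose[of i "Suc i" _ j x] tj)
  finally show ?thesis
    unfolding jackD_def d using j by (simp add: sw_def)
qed

text \<open>The relation of the degenerate affine Hecke algebra. The reflection sums of D_i and
  D_(i+1) correspond under s_i except for the summand s_i itself, which composes with s_i to the
  identity and leaves k f.\<close>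

lemma jackD_sw_left:
  assumes f: "f \<in> Pol n" and i: "Suc i < n"
  shows "jackD k n i (\<lambda>x. f (sw i (Suc i) x)) x = jackD k n (Suc i) f (sw i (Suc i) x) + of_real k * f x"
proof -
  let ?x = "sw i (Suc i) x"
  have d: "dunkl k n i (\<lambda>x. f (sw i (Suc i) x)) x = dunkl k n (Suc i) f ?x"
    using dunkl_sw[OF _ i i Pol_line_diff[OF f], of i k x] i by simp
  have "{i<..<n} = insert (Suc i) {Suc i<..<n}" using i by auto
  then have "(\<Sum>l\<in>{i<..<n}. f (sw i (Suc i) (sw l i x)))
      = f (sw i (Suc i) (sw (Suc i) i x)) + (\<Sum>l\<in>{Suc i<..<n}. f (sw i (Suc i) (sw l i x)))"
    by simp
  also have "sw i (Suc i) (sw (Suc i) i x) = x" by (simp add: sw_commute[of "Suc i" i])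
  also have "(\<Sum>l\<in>{Suc i<..<n}. f (sw i (Suc i) (sw l i x))) = (\<Sum>l\<in>{Suc i<..<n}. f (sw l (Suc i) ?x))"
  proof (rule sum.cong[OF refl])
    fix l assume "l \<in> {Suc i<..<n}"
    then have "tau i (Suc i) l = l" by simp
    then show "f (sw i (Suc i) (sw l i x)) = f (sw l (Suc i) ?x)"
      using sw_sw_transpose[of i "Suc i" l i x] by simp
  qed
  finally show ?thesis
    unfolding jackD_def d by (simp add: sw_def[of i "Suc i" x] distrib_left)
qed

text \<open>The previous relation for f composed with s_i, read at the reflected point.\<close>

lemma jackD_sw_right:
  assumes f: "f \<in> Pol n" and i: "Suc i < n"
  shows "jackD k n (Suc i) (\<lambda>x. f (sw i (Suc i) x)) x = jackD k n i f (sw i (Suc i) x) - of_real k * f x"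
  using jackD_sw_left[OF Pol_sw[OF f Suc_lessD[OF i] i] i, of k "sw i (Suc i) x"] by simp

text \<open>The entries contribute at least 1 and the ranks at least k.\<close>

lemma ebar_gap:
  assumes "k \<ge> 0" "i < length eta" "j < length eta" "eta ! j < eta ! i"
  shows "ebar k eta j + 1 + k \<le> ebar k eta i"
proof -
  have "rank_of eta i < rank_of eta j"
    using assms by (intro rank_of_mono) (auto simp: precedes_def)
  then have "real (rank_of eta i) + 1 \<le> real (rank_of eta j)" by simp
  from mult_left_mono[OF this assms(1)]
  have "k * real (rank_of eta i) + k \<le> k * real (rank_of eta j)" by (simp add: algebra_simps)
  moreover have "real (eta ! j) + 1 \<le> real (eta ! i)" using assms(4) by simp
  ultimately show ?thesis unfolding ebar_eq[OF assms(2)] ebar_eq[OF assms(3)] by linarith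
qed

lemma ebar_swap_list:
  assumes "length eta = n" "Suc i < n" "eta ! i \<noteq> eta ! Suc i" "j < n"
  shows "ebar k (swap_list i (Suc i) eta) j = ebar k eta (tau i (Suc i) j)"
proof -
  let ?t = "tau i (Suc i)"
  have tj: "?t j < n" using assms by (auto simp: tau_def)
  have "rank_of (swap_list i (Suc i) eta) = rank_of eta \<circ> ?t"
    using assms by (intro rank_of_swap_list) auto
  then show ?thesis
    using assms tj by (simp add: ebar_eq swap_list_nth)
qed

text \<open>The constant a for which s_i f + a f is again a joint eigenfunction: comparing the
  coefficients of f after applying D_i gives a (ebar_(i+1) - ebar_i) = k.\<close>

definition swap_coeff :: "real \<Rightarrow> nat list \<Rightarrow> nat \<Rightarrow> real" where
  "swap_coeff k eta i = k / (ebar k eta (Suc i) - ebar k eta i)"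

lemma abs_swap_coeff_less_1:
  assumes "k \<ge> 0" "length eta = n" "Suc i < n" "eta ! i \<noteq> eta ! Suc i"
  shows "\<bar>swap_coeff k eta i\<bar> < 1" "ebar k eta (Suc i) \<noteq> ebar k eta i"
proof -
  have gap: "1 + k \<le> \<bar>ebar k eta (Suc i) - ebar k eta i\<bar>"
  proof (cases "eta ! i < eta ! Suc i")
    case True
    then show ?thesis using ebar_gap[of k "Suc i" eta i] assms by simp
  next
    case False
    then show ?thesis using ebar_gap[of k i eta "Suc i"] assms by simp
  qed
  then show "ebar k eta (Suc i) \<noteq> ebar k eta i" using assms(1) by auto
  have "k < \<bar>ebar k eta (Suc i) - ebar k eta i\<bar>" using gap by simp
  then show "\<bar>swap_coeff k eta i\<bar> < 1"
    using assms(1) by (simp add: swap_coeff_def abs_divide)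
qed

lemma jack_eigen_swap:
  assumes k: "k \<ge> 0" and eta: "length eta = n" and i: "Suc i < n" and ne: "eta ! i \<noteq> eta ! Suc i"
    and f: "f \<in> Pol n" and eig: "jack_eigen k n eta f"
  shows "jack_eigen k n (swap_list i (Suc i) eta)
    (\<lambda>x. f (sw i (Suc i) x) + of_real (swap_coeff k eta i) * f x)"
  unfolding jack_eigen_def
proof (intro allI impI)
  fix j x assume j: "j < n"
  let ?a = "swap_coeff k eta i"
  let ?e = "\<lambda>j. complex_of_real (ebar k eta j)"
  have i': "i < n" using i by simp
  have D: "jackD k n j f y = ?e j * f y" if "j < n" for j y
    using eig that by (simp add: jack_eigen_def)
  have a: "?a * (ebar k eta (Suc i) - ebar k eta i) = k"
    using abs_swap_coeff_less_1(2)[OF k eta i ne] by (simp add: swap_coeff_def)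
  have "complex_of_real (?a * (ebar k eta (Suc i) - ebar k eta i)) = of_real k" by (simp only: a)
  \<comment> \<open>This one relation settles both j = i and j = Suc i.\<close>
  then have a': "of_real ?a * ?e (Suc i) = of_real ?a * ?e i + of_real k"
    by (simp add: algebra_simps)
  have split: "jackD k n j (\<lambda>x. f (sw i (Suc i) x) + of_real ?a * f x) x
      = jackD k n j (\<lambda>x. f (sw i (Suc i) x)) x + of_real ?a * (?e j * f x)"
    unfolding jackD_add[OF j Pol_sw[OF f i' i] Pol_cmult[OF f]] jackD_cmult[OF j f] D[OF j] ..
  consider "j = i" | "j = Suc i" | "j \<noteq> i" "j \<noteq> Suc i" by blast
  then show "jackD k n j (\<lambda>x. f (sw i (Suc i) x) + of_real ?a * f x) x
      = of_real (ebar k (swap_list i (Suc i) eta) j) * (f (sw i (Suc i) x) + of_real ?a * f x)"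
  proof cases
    case 1
    have "ebar k (swap_list i (Suc i) eta) j = ebar k eta (Suc i)"
      using ebar_swap_list[OF eta i ne j] 1 by simp
    moreover have "jackD k n j (\<lambda>x. f (sw i (Suc i) x)) x = ?e (Suc i) * f (sw i (Suc i) x) + of_real k * f x"
      unfolding 1 jackD_sw_left[OF f i] D[OF i] ..
    ultimately show ?thesis unfolding split using 1 arg_cong[OF a', of "\<lambda>z. z * f x"]
      by (simp add: algebra_simps)
  next
    case 2
    have "ebar k (swap_list i (Suc i) eta) j = ebar k eta i"
      using ebar_swap_list[OF eta i ne j] 2 by simp
    moreover have "jackD k n j (\<lambda>x. f (sw i (Suc i) x)) x = ?e i * f (sw i (Suc i) x) - of_real k * f x"
      unfolding 2 jackD_sw_right[OF f i] D[OF i'] ..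
    ultimately show ?thesis unfolding split using 2 arg_cong[OF a', of "\<lambda>z. z * f x"]
      by (simp add: algebra_simps)
  next
    case 3
    have "ebar k (swap_list i (Suc i) eta) j = ebar k eta j"
      using ebar_swap_list[OF eta i ne j] 3 by simp
    moreover have "jackD k n j (\<lambda>x. f (sw i (Suc i) x)) x = ?e j * f (sw i (Suc i) x)"
      unfolding jackD_sw_other[OF f i j 3] D[OF j] ..
    ultimately show ?thesis unfolding split by (simp add: algebra_simps)
  qed
qed

section \<open>The affine shift\<close>

definition rot :: "nat \<Rightarrow> nat \<Rightarrow> nat" where
  "rot n i = (if i = 0 then n - 1 else if i < n then i - 1 else i)"

text \<open>The exponent of x_(n-1) times the monomial x^eta evaluated at
  \<open>x \<circ> rot n\<close>, which is the point (x_(n-1), x_0, ..., x_(n-2)).\<close>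

definition affine_shift :: "nat list \<Rightarrow> nat list" where
  "affine_shift eta = tl eta @ [Suc (hd eta)]"

lemma rot_simps: "rot n 0 = n - 1" "Suc j < n \<Longrightarrow> rot n (Suc j) = j"
  by (simp_all add: rot_def)

lemma rot_less: "j < n \<Longrightarrow> rot n j < n"
  by (auto simp: rot_def)

lemma rot_inj_on: "inj_on (rot n) {..<n}"
  by (auto simp: inj_on_def rot_def split: if_splits)

lemma rot_permutes:
  assumes "0 < n"
  shows "rot n permutes {..<n}"
proof (rule bij_imp_permutes)
  show "bij_betw (rot n) {..<n} {..<n}"
    using rot_inj_on by (intro bij_betw_imageI endo_inj_surj) (auto simp: rot_less)
qed (use assms in \<open>auto simp: rot_def\<close>)

lemma affine_shift_nth_rot:
  assumes "j < length eta"
  shows "affine_shift eta ! rot (length eta) j = eta ! j + (if j = 0 then 1 else 0)"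
proof (cases j)
  case 0
  then show ?thesis using assms by (cases eta) (auto simp: affine_shift_def rot_def nth_append)
next
  case (Suc i)
  then show ?thesis using assms by (cases eta) (auto simp: affine_shift_def rot_def nth_append)
qed

lemma length_affine_shift [simp]: "0 < length eta \<Longrightarrow> length (affine_shift eta) = length eta"
  by (simp add: affine_shift_def)

lemma sum_list_affine_shift: "0 < length eta \<Longrightarrow> sum_list (affine_shift eta) = Suc (sum_list eta)"
  by (cases eta) (simp_all add: affine_shift_def)

text \<open>Moving the first entry to the end would make it lose its ties, but raising it by one
  compensates exactly: an entry is at most eta_0 iff it is smaller than eta_0 + 1.\<close>

lemma rank_of_affine_shift:
  assumes n: "length eta = n" and j: "j < n"
  shows "rank_of (affine_shift eta) (rot n j) = rank_of eta j"
proof -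
  have len: "length (affine_shift eta) = n" using n j by simp
  have nth: "affine_shift eta ! rot n i = eta ! i + (if i = 0 then 1 else 0)" if "i < n" for i
    using affine_shift_nth_rot[of i eta] n that by simp
  have iff: "precedes (affine_shift eta) (rot n i) (rot n j) \<longleftrightarrow> precedes eta i j" if i: "i < n" for i
    unfolding precedes_def nth[OF i] nth[OF j] using i j
    by (cases i; cases j) (auto simp: rot_simps)
  have "{i. i < n \<and> precedes (affine_shift eta) i (rot n j)} = rot n ` {i. i < n \<and> precedes eta i j}"
  proof (intro equalityI subsetI)
    fix p assume p: "p \<in> {i. i < n \<and> precedes (affine_shift eta) i (rot n j)}"
    then have "p \<in> rot n ` {..<n}" using permutes_image[OF rot_permutes] j by auto
    then obtain i where "i < n" "p = rot n i" by auto
    then show "p \<in> rot n ` {i. i < n \<and> precedes eta i j}" using p iff by auto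
  next
    fix p assume "p \<in> rot n ` {i. i < n \<and> precedes eta i j}"
    then show "p \<in> {i. i < n \<and> precedes (affine_shift eta) i (rot n j)}" using iff rot_less by auto
  qed
  moreover have "inj_on (rot n) {i. i < n \<and> precedes eta i j}"
    by (rule inj_on_subset[OF rot_inj_on]) auto
  ultimately have "card {i. i < n \<and> precedes (affine_shift eta) i (rot n j)} = card {i. i < n \<and> precedes eta i j}"
    by (simp add: card_image)
  then show ?thesis using n j len rot_less[OF j] by (simp add: rank_of_def)
qed

lemma ebar_affine_shift:
  assumes "length eta = n" "j < n"
  shows "ebar k (affine_shift eta) (rot n j) = ebar k eta j + (if j = 0 then 1 else 0)"
proof -
  have "rot n j < length (affine_shift eta)" using assms rot_less by simp
  then show ?thesis
    using assms affine_shift_nth_rot[of j eta] by (simp add: ebar_eq rank_of_affine_shift)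
qed

text \<open>The rank is unchanged while the entry grows by one, so one Pochhammer symbol gains its
  next factor mu - k rank + eta_0, which is mu + ebar_0.\<close>

lemma gen_poch_affine_shift:
  assumes n: "length eta = n" and pos: "0 < n"
  shows "gen_poch k n mu (dec_rearr (affine_shift eta))
    = (mu + of_real (ebar k eta 0)) * gen_poch k n mu (dec_rearr eta)"
proof -
  let ?F = "\<lambda>j. pochhammer (mu - of_real (k * real (rank_of eta j)))"
  have len: "length (affine_shift eta) = n" using n pos by simp
  have "gen_poch k n mu (dec_rearr (affine_shift eta))
      = (\<Prod>j<n. pochhammer (mu - of_real (k * real (rank_of (affine_shift eta) (rot n j)))) (affine_shift eta ! rot n j))"
    unfolding gen_poch_dec_rearr[OF len]
    by (subst prod.permute[OF rot_permutes[OF pos]]) (simp add: o_def)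
  also have "\<dots> = (\<Prod>j<n. ?F j (eta ! j + (if j = 0 then 1 else 0)))"
    using n by (intro prod.cong) (auto simp: rank_of_affine_shift affine_shift_nth_rot)
  also have "\<dots> = ?F 0 (Suc (eta ! 0)) * (\<Prod>j\<in>{..<n}-{0}. ?F j (eta ! j))"
    using pos by (subst prod.remove[of _ 0]) auto
  also have "?F 0 (Suc (eta ! 0)) = (mu + of_real (ebar k eta 0)) * ?F 0 (eta ! 0)"
    using pos n by (simp add: pochhammer_Suc ebar_eq algebra_simps)
  also have "(mu + of_real (ebar k eta 0)) * ?F 0 (eta ! 0) * (\<Prod>j\<in>{..<n}-{0}. ?F j (eta ! j))
      = (mu + of_real (ebar k eta 0)) * (\<Prod>j<n. ?F j (eta ! j))"
    using pos by (subst prod.remove[of "{..<n}" 0]) auto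
  finally show ?thesis unfolding gen_poch_dec_rearr[OF n] .
qed

lemma sw_rot:
  assumes "0 < n"
  shows "sw (rot n i) (rot n j) x \<circ> rot n = sw i j (x \<circ> rot n)"
  by (rule sw_comp[OF permutes_inj[OF rot_permutes[OF assms]]])

lemma sum_rot_0:
  assumes n: "0 < n"
  shows "(\<Sum>l\<in>{..<n}-{n-1}. f (sw (n-1) l x \<circ> rot n)) = (\<Sum>i\<in>{0<..<n}. f (sw i 0 (x \<circ> rot n)))"
proof -
  have inj: "inj_on (rot n) {0<..<n}" by (rule inj_on_subset[OF rot_inj_on]) auto
  have im: "rot n ` {0<..<n} = {..<n} - {n-1}"
  proof (intro equalityI subsetI)
    fix l assume "l \<in> {..<n} - {n-1}"
    then have "Suc l \<in> {0<..<n}" "l = rot n (Suc l)" by (auto simp: rot_def)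
    then show "l \<in> rot n ` {0<..<n}" by (rule image_eqI[rotated])
  qed (auto simp: rot_def)
  have "(\<Sum>l\<in>rot n ` {0<..<n}. f (sw (n-1) l x \<circ> rot n)) = (\<Sum>i\<in>{0<..<n}. f (sw (n-1) (rot n i) x \<circ> rot n))"
    by (simp add: sum.reindex[OF inj])
  also have "\<dots> = (\<Sum>i\<in>{0<..<n}. f (sw i 0 (x \<circ> rot n)))"
    using sw_rot[OF n, of 0 _ x] by (simp add: rot_simps sw_commute[of 0])
  finally show ?thesis unfolding im .
qed

text \<open>For j = 0 the reflection sum of the operator at position n-1 is empty, but the cross
  relation for x_(n-1) supplies all reflections, which rotate into those of D_0, and one extra f.
  For j > 0 the correction in moving x_(n-1) past the Dunkl operator cancels the summand l = n-1 of
  the reflection sum.\<close>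

lemma jackD_affine_shift:
  assumes f: "f \<in> Pol n" and n: "0 < n" and j: "j < n"
  shows "jackD k n (rot n j) (\<lambda>x. of_real (x (n-1)) * f (x \<circ> rot n)) x
    = of_real (x (n-1)) * (jackD k n j f (x \<circ> rot n) + (if j = 0 then f (x \<circ> rot n) else 0))"
proof -
  let ?g = "\<lambda>x. f (x \<circ> rot n)"
  let ?y = "x \<circ> rot n"
  have perm: "rot n permutes {..<n}" by (rule rot_permutes[OF n])
  have g: "?g \<in> Pol n" by (rule Pol_perm[OF f perm])
  have ld: "line_diff ?g x" by (rule Pol_line_diff[OF g])
  have T: "dunkl k n (rot n j) ?g x = dunkl k n j f ?y"
    by (rule dunkl_perm[OF perm j Pol_line_diff[OF f]])
  have n1: "n - 1 < n" using n by simp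
  show ?thesis
  proof (cases j)
    case 0
    have r: "rot n j = n - 1" using 0 by (simp add: rot_simps)
    have y0: "?y j = x (n-1)" using r by simp
    have emp: "{n-1<..<n} = {}" by auto
    have "jackD k n (n-1) (\<lambda>x. of_real (x (n-1)) * ?g x) x
        = of_real (x (n-1)) * (of_real (x (n-1)) * dunkl k n j f ?y + f ?y
            + of_real k * (\<Sum>l\<in>{..<n}-{n-1}. f (sw (n-1) l x \<circ> rot n)))
          + of_real (k * (1 - real n)) * (of_real (x (n-1)) * f ?y)"
      unfolding jackD_def emp dunkl_coord_self[OF n1 ld] using T r by simp
    also have "\<dots> = of_real (x (n-1)) * (jackD k n j f ?y + f ?y)"
      unfolding sum_rot_0[OF n] jackD_def y0 using 0 by (simp add: algebra_simps)
    finally show ?thesis using r 0 by simp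
  next
    case (Suc i)
    have i: "i < n - 1" "i < n" using Suc j by auto
    have r: "rot n j = i" using Suc j by (simp add: rot_simps)
    have yj: "?y j = x i" using r by simp
    have ne: "n - 1 \<noteq> i" using i by simp
    have "{i<..<n} = insert (n-1) {i<..<n-1}" using i by auto
    then have "(\<Sum>l\<in>{i<..<n}. of_real (sw l i x (n-1)) * ?g (sw l i x))
        = of_real (sw (n-1) i x (n-1)) * ?g (sw (n-1) i x)
          + (\<Sum>l\<in>{i<..<n-1}. of_real (sw l i x (n-1)) * ?g (sw l i x))"
      by simp
    also have "of_real (sw (n-1) i x (n-1)) * ?g (sw (n-1) i x) = of_real (x i) * ?g (sw i (n-1) x)"
    proof -
      have "sw (n-1) i x (n-1) = x i" using ne by (simp add: sw_def)
      then show ?thesis by (simp only: sw_commute[of "n-1" i])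
    qed
    also have "(\<Sum>l\<in>{i<..<n-1}. of_real (sw l i x (n-1)) * ?g (sw l i x))
        = (\<Sum>l\<in>{i<..<n-1}. of_real (x (n-1)) * f (sw (Suc l) j ?y))"
    proof (rule sum.cong[OF refl])
      fix l assume l: "l \<in> {i<..<n-1}"
      then have "Suc l < n" by auto
      then have "rot n (Suc l) = l" by (rule rot_simps)
      then have "sw l i x \<circ> rot n = sw (Suc l) j ?y"
        using sw_rot[OF n, of "Suc l" j x] r by simp
      moreover have "sw l i x (n-1) = x (n-1)" using l ne by (simp add: sw_def)
      ultimately show "of_real (sw l i x (n-1)) * ?g (sw l i x) = of_real (x (n-1)) * f (sw (Suc l) j ?y)"
        by (simp only:)
    qed
    also have "\<dots> = of_real (x (n-1)) * (\<Sum>l\<in>{i<..<n-1}. f (sw (Suc l) j ?y))"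
      by (simp add: sum_distrib_left)
    also have "(\<Sum>l\<in>{i<..<n-1}. f (sw (Suc l) j ?y)) = (\<Sum>l\<in>Suc ` {i<..<n-1}. f (sw l j ?y))"
      by (simp add: sum.reindex)
    also have "Suc ` {i<..<n-1} = {j<..<n}"
    proof (intro equalityI subsetI)
      fix l assume "l \<in> {j<..<n}"
      then have "l - 1 \<in> {i<..<n-1}" "l = Suc (l - 1)" using Suc by auto
      then show "l \<in> Suc ` {i<..<n-1}" by (rule image_eqI[rotated])
    qed (use Suc in auto)
    finally have s: "(\<Sum>l\<in>{i<..<n}. of_real (sw l i x (n-1)) * ?g (sw l i x))
      = of_real (x i) * ?g (sw i (n-1) x) + of_real (x (n-1)) * (\<Sum>l\<in>{j<..<n}. f (sw l j ?y))" .
    have "jackD k n i (\<lambda>x. of_real (x (n-1)) * ?g x) x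
        = of_real (x (n-1)) * jackD k n j f ?y"
      unfolding jackD_def s dunkl_coord_other[OF i(2) n1 ne ld] yj using T r
      by (simp add: algebra_simps)
    then show ?thesis using r Suc by simp
  qed
qed

text \<open>All other positions lie before n-1, but rotation places position 0 before all of them.
  So the full reflection sum becomes the one in D_0, and its n-1 identity terms become the shift
  k(1-n).\<close>

lemma tw_dunkl_rot:
  assumes f: "f \<in> Pol n" and n: "0 < n"
  shows "tw_dunkl k n mu (n-1) (\<lambda>y. f (y \<circ> rot n)) y
    = - (of_real (y (n-1)) * (mu * f (y \<circ> rot n) + jackD k n 0 f (y \<circ> rot n)))"
proof -
  let ?y = "y \<circ> rot n"
  have perm: "rot n permutes {..<n}" by (rule rot_permutes[OF n])
  have T: "dunkl k n (n-1) (\<lambda>y. f (y \<circ> rot n)) y = dunkl k n 0 f ?y"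
    using dunkl_perm[OF perm n Pol_line_diff[OF f], of k y] by (simp add: rot_simps)
  have "(\<Sum>l\<in>{..<n}-{n-1}. f ?y - f (sw (n-1) l y \<circ> rot n))
      = of_nat (n - 1) * f ?y - (\<Sum>i\<in>{0<..<n}. f (sw i 0 ?y))"
    unfolding sum_subtractf sum_rot_0[OF n] using n by simp
  moreover have "complex_of_nat (n - 1) = of_real (real n - 1)" using n by (simp add: of_nat_diff)
  ultimately have s: "(\<Sum>l\<in>{..<n}-{n-1}. f ?y - f (sw (n-1) l y \<circ> rot n))
      = of_real (real n - 1) * f ?y - (\<Sum>i\<in>{0<..<n}. f (sw i 0 ?y))" by (simp only:)
  have y0: "?y 0 = y (n-1)" by (simp add: rot_simps)
  show ?thesis
    unfolding tw_dunkl_def T s jackD_def y0 by (simp add: algebra_simps)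
qed

section \<open>Existence by induction on the degree\<close>

definition jack_image :: "real \<Rightarrow> nat \<Rightarrow> complex \<Rightarrow> nat list \<Rightarrow> complex" where
  "jack_image k n mu eta = (-1) ^ sum_list eta * gen_poch k n mu (dec_rearr eta)"

text \<open>Existence and the action of L are bundled so that one induction gives both. Nonvanishing
  is carried along because it is what makes normalisation possible.\<close>

definition is_jack :: "real \<Rightarrow> nat \<Rightarrow> complex \<Rightarrow> nat list \<Rightarrow> fn \<Rightarrow> bool" where
  "is_jack k n mu eta f \<longleftrightarrow> f \<noteq> (\<lambda>_. 0) \<and> jack_eigen k n eta f
     \<and> tw_rel k n mu f (\<lambda>y. jack_image k n mu eta * f y)"

lemma is_jack_zero:
  assumes "length eta = n" "sum_list eta = 0"
  shows "is_jack k n mu eta (\<lambda>_. 1)"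
proof -
  have z: "eta ! j = 0" if "j < n" for j using assms that by (simp add: sum_list_eq_0_iff)
  have "{i. i < n \<and> precedes eta i j} = {..<j}" if "j < n" for j
    using that z by (auto simp: precedes_def)
  then have rank: "rank_of eta j = j" if "j < n" for j using that assms by (simp add: rank_of_def)
  have "jack_eigen k n eta (\<lambda>_. 1)"
    unfolding jack_eigen_def
  proof (intro allI impI)
    fix j and x :: pt assume j: "j < n"
    have "jackD k n j (\<lambda>_. 1) x = of_real (k * (1 - real n) + k * real (n - Suc j))"
      by (simp add: jackD_def dunkl_const)
    also have "k * (1 - real n) + k * real (n - Suc j) = ebar k eta j"
      using j assms z rank by (simp add: ebar_eq of_nat_diff algebra_simps)
    finally show "jackD k n j (\<lambda>_. 1) x = of_real (ebar k eta j) * 1" by simp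
  qed
  moreover have "gen_poch k n mu (dec_rearr eta) = 1"
    unfolding gen_poch_dec_rearr[OF assms(1)] using z by simp
  then have "jack_image k n mu eta = 1" unfolding jack_image_def assms(2) by simp
  then have "tw_rel k n mu (\<lambda>_. 1) (\<lambda>y. jack_image k n mu eta * 1)"
    using tw_rel.const[of k n mu 1] by simp
  ultimately show ?thesis by (simp add: is_jack_def fun_eq_iff)
qed

lemma is_jack_swap:
  assumes k: "k \<ge> 0" and eta: "length eta = n" and i: "Suc i < n" and ne: "eta ! i \<noteq> eta ! Suc i"
    and J: "is_jack k n mu eta f"
  shows "is_jack k n mu (swap_list i (Suc i) eta)
    (\<lambda>x. f (sw i (Suc i) x) + of_real (swap_coeff k eta i) * f x)"
proof -
  let ?a = "swap_coeff k eta i"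
  let ?c = "jack_image k n mu eta"
  let ?g = "\<lambda>x. f (sw i (Suc i) x) + of_real ?a * f x"
  have i': "i < n" using i by simp
  have rel: "tw_rel k n mu f (\<lambda>y. ?c * f y)" using J by (simp add: is_jack_def)
  have f: "f \<in> Pol n" by (rule tw_rel_Pol(1)[OF rel])
  have "tw_rel k n mu (\<lambda>x. f (sw i (Suc i) x)) (\<lambda>x. ?c * f (sw i (Suc i) x))"
    using tw_rel_perm[OF transpose_permutes[OF i' i] rel] by (simp only: sw_eq)
  from tw_rel.add[OF this tw_rel_cmult[OF rel, of "of_real ?a"]]
  have "tw_rel k n mu ?g (\<lambda>y. ?c * ?g y)" by (simp only: distrib_left mult.left_commute)
  moreover have "jack_image k n mu (swap_list i (Suc i) eta) = ?c"
  proof -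
    have m: "mset (swap_list i (Suc i) eta) = mset eta" using eta i by simp
    then have "dec_rearr (swap_list i (Suc i) eta) = dec_rearr eta" by (simp add: dec_rearr_eq_iff)
    moreover have "sum_list (swap_list i (Suc i) eta) = sum_list eta"
      using m by (metis sum_mset_sum_list)
    ultimately show ?thesis by (simp only: jack_image_def)
  qed
  moreover have "jack_eigen k n (swap_list i (Suc i) eta) ?g"
    using J by (intro jack_eigen_swap k eta i ne f) (simp add: is_jack_def)
  moreover have "?g \<noteq> (\<lambda>_. 0)"
  proof
    assume "?g = (\<lambda>_. 0)"
    then have g0: "f (sw i (Suc i) x) = - (of_real ?a * f x)" for x
      by (simp add: fun_eq_iff eq_neg_iff_add_eq_0)
    \<comment> \<open>A vanishing result would mean s_i f = -a f. Applying s_i twice gives f = a^2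
      f, impossible for nonzero f since |a| < 1.\<close>
    have "f x = of_real (?a * ?a) * f x" for x
      using g0[of "sw i (Suc i) x"] g0[of x] by simp
    moreover have "?a * ?a \<noteq> 1"
      using abs_swap_coeff_less_1(1)[OF k eta i ne] by (auto simp: square_eq_1_iff)
    then have "complex_of_real (?a * ?a) \<noteq> 1" by (metis of_real_eq_1_iff)
    ultimately have "f x = 0" for x by (metis mult_cancel_right1)
    then show False using J by (auto simp: is_jack_def)
  qed
  ultimately show ?thesis by (simp add: is_jack_def)
qed

lemma is_jack_affine_shift:
  assumes eta: "length eta = n" and n: "0 < n" and J: "is_jack k n mu eta f"
  shows "is_jack k n mu (affine_shift eta) (\<lambda>x. of_real (x (n-1)) * f (x \<circ> rot n))"
proof -
  let ?c = "jack_image k n mu eta"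
  let ?g = "\<lambda>x. complex_of_real (x (n-1)) * f (x \<circ> rot n)"
  have perm: "rot n permutes {..<n}" by (rule rot_permutes[OF n])
  have rel: "tw_rel k n mu f (\<lambda>y. ?c * f y)" and eig: "jack_eigen k n eta f"
    using J by (auto simp: is_jack_def)
  have f: "f \<in> Pol n" by (rule tw_rel_Pol(1)[OF rel])
  have n1: "n - 1 < n" using n by simp
  have D: "jackD k n j f y = of_real (ebar k eta j) * f y" if "j < n" for j y
    using eig that by (simp add: jack_eigen_def)
  have "tw_dunkl k n mu (n-1) (\<lambda>y. ?c * f (y \<circ> rot n)) = (\<lambda>y. jack_image k n mu (affine_shift eta) * ?g y)"
  proof
    fix y
    have "tw_dunkl k n mu (n-1) (\<lambda>y. ?c * f (y \<circ> rot n)) y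
        = ?c * (- (of_real (y (n-1)) * (mu * f (y \<circ> rot n) + of_real (ebar k eta 0) * f (y \<circ> rot n))))"
      unfolding tw_dunkl_cmult[OF Pol_perm[OF f perm] n1] tw_dunkl_rot[OF f n] D[OF n] ..
    also have "\<dots> = jack_image k n mu (affine_shift eta) * ?g y"
      unfolding jack_image_def gen_poch_affine_shift[OF eta n] using eta n
      by (simp add: sum_list_affine_shift algebra_simps)
    finally show "tw_dunkl k n mu (n-1) (\<lambda>y. ?c * f (y \<circ> rot n)) y
        = jack_image k n mu (affine_shift eta) * ?g y" .
  qed
  with tw_rel.coord[OF tw_rel_perm[OF perm rel] n1]
  have "tw_rel k n mu ?g (\<lambda>y. jack_image k n mu (affine_shift eta) * ?g y)" by (simp only:)
  moreover have "jack_eigen k n (affine_shift eta) ?g"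
    unfolding jack_eigen_def
  proof (intro allI impI)
    fix p x assume "p < n"
    then have "p \<in> rot n ` {..<n}" using permutes_image[OF perm] by simp
    then obtain j where j: "j < n" "p = rot n j" by auto
    show "jackD k n p ?g x = of_real (ebar k (affine_shift eta) p) * ?g x"
      unfolding j(2) jackD_affine_shift[OF f n j(1)] ebar_affine_shift[OF eta j(1)] D[OF j(1)]
      by (simp add: algebra_simps)
  qed
  moreover have "?g \<noteq> (\<lambda>_. 0)"
  proof
    assume g0: "?g = (\<lambda>_. 0)"
    have "f = (\<lambda>_. 0)"
    proof (rule Pol_eq_off_axes[OF f Pol.const])
      fix x assume x: "x \<in> off_axes n"
      let ?z = "x \<circ> inv (rot n)"
      have "?z \<in> off_axes n" by (rule off_axes_perm[OF permutes_inv[OF perm] x])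
      then have "?z (n-1) \<noteq> 0" using n1 unfolding off_axes_def by blast
      moreover have "?z \<circ> rot n = x"
        using permutes_inv_o(2)[OF perm] by (simp add: comp_assoc)
      ultimately show "f x = 0" using fun_cong[OF g0, of ?z] by simp
    qed
    then show False using J by (simp add: is_jack_def)
  qed
  ultimately show ?thesis by (simp add: is_jack_def)
qed

text \<open>A positive entry is lowered by one and placed in front. The affine shift restores it at
  the end of the list, and adjacent swaps then restore the order.\<close>

lemma is_jack_exists:
  assumes k: "k \<ge> 0" and eta: "length eta = n"
  shows "\<exists>f. is_jack k n mu eta f"
  using eta
proof (induction "sum_list eta" arbitrary: eta)
  case 0
  then show ?case using is_jack_zero by metis
next
  case (Suc d)
  then have "\<not> (\<forall>a\<in>set eta. a = 0)" by (metis Zero_not_Suc sum_list_eq_0_iff)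
  then obtain a where "a \<in> set eta" "a \<noteq> 0" by blast
  then obtain xs ys b where eq: "eta = xs @ Suc b # ys" by (metis not0_implies_Suc split_list)
  let ?k = "b # xs @ ys"
  have len: "length ?k = n" "0 < n" using eq Suc.prems by auto
  have "sum_list ?k = d" using Suc.hyps(2) eq by simp
  then obtain f where "is_jack k n mu ?k f" using Suc.hyps(1)[of ?k] len by metis
  from is_jack_affine_shift[OF len this]
  have start: "\<exists>f. is_jack k n mu (affine_shift ?k) f" by blast
  show ?case
  proof (rule adjacent_swaps_connected[where Q = "\<lambda>eta. \<exists>f. is_jack k n mu eta f" and eta = "affine_shift ?k"])
    fix nu i assume nu: "length nu = n" "Suc i < n" "\<exists>f. is_jack k n mu nu f"
    show "\<exists>f. is_jack k n mu (swap_list i (Suc i) nu) f"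
    proof (cases "nu ! i = nu ! Suc i")
      case True
      have "swap_list i (Suc i) nu = nu"
        using nu True by (intro nth_equalityI) (auto simp: swap_list_nth tau_def)
      then show ?thesis using nu by simp
    next
      case False
      then show ?thesis using is_jack_swap[OF k nu(1,2) False] nu(3) by blast
    qed
  next
    show "length (affine_shift ?k) = n" using len by simp
    show "mset eta = mset (affine_shift ?k)" by (simp add: eq affine_shift_def)
  qed (rule start)
qed

text \<open>The function provided by \<open>is_jack_exists\<close> may depend on mu. Uniqueness
  identifies its normalised coefficients with \<open>E_coeff\<close>, which does not involve
  mu.\<close>

lemma E_coeff_props:
  assumes k: "k \<ge> 0" and eta: "length eta = n"
  shows "poly_coeffs n (E_coeff k n eta)" "jack_eigen k n eta (peval n (E_coeff k n eta))"
    "E_coeff k n eta eta = 1"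
    "tw_rel k n mu (peval n (E_coeff k n eta))
       (\<lambda>y. jack_image k n mu eta * peval n (E_coeff k n eta) y)"
proof -
  obtain f where J: "is_jack k n mu eta f" using is_jack_exists[OF assms] by blast
  then have rel: "tw_rel k n mu f (\<lambda>y. jack_image k n mu eta * f y)" by (simp add: is_jack_def)
  obtain c where c: "poly_coeffs n c" "f = peval n c" using tw_rel_coeffs[OF rel] by blast
  have eig: "jack_eigen k n eta (peval n c)" using J c(2) by (simp add: is_jack_def)
  have "c \<noteq> (\<lambda>_. 0)"
  proof
    assume "c = (\<lambda>_. 0)"
    then have "f = (\<lambda>_. 0)" using c(2) by (simp add: peval_def[abs_def])
    then show False using J by (simp add: is_jack_def)
  qed
  then obtain kappa where "c kappa \<noteq> 0" by (auto simp: fun_eq_iff)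
  then have ce: "c eta \<noteq> 0" by (rule jack_eigen_support(2)[OF k eta c(1) eig])
  let ?a = "1 / c eta"
  let ?d = "\<lambda>kappa. ?a * c kappa"
  have d: "poly_coeffs n ?d" by (rule poly_coeffs_cmult[OF c(1)])
  have pd: "peval n ?d = (\<lambda>x. ?a * f x)"
    unfolding c(2) peval_eq_lin_comb by (rule ext) (rule lin_comb_cmult)
  have fP: "f \<in> Pol n" by (rule tw_rel_Pol(1)[OF rel])
  have deig: "jack_eigen k n eta (peval n ?d)"
    unfolding pd jack_eigen_def
  proof (intro allI impI)
    fix j x assume j: "j < n"
    show "jackD k n j (\<lambda>x. ?a * f x) x = of_real (ebar k eta j) * (?a * f x)"
      unfolding jackD_cmult[OF j fP] using eig j c(2) by (simp add: jack_eigen_def)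
  qed
  have E: "E_coeff k n eta = ?d" by (rule E_coeff_eqI[OF k eta d deig]) (use ce in simp)
  show "poly_coeffs n (E_coeff k n eta)" unfolding E by (rule d)
  show "jack_eigen k n eta (peval n (E_coeff k n eta))" unfolding E by (rule deig)
  show "E_coeff k n eta eta = 1" unfolding E using ce by simp
  show "tw_rel k n mu (peval n (E_coeff k n eta))
       (\<lambda>y. jack_image k n mu eta * peval n (E_coeff k n eta) y)"
    unfolding E pd using tw_rel_cmult[OF rel, of ?a] by (simp only: mult.left_commute)
qed

section \<open>Symmetrisation\<close>

lemma poly_coeffs_symm: "poly_coeffs n c \<Longrightarrow> poly_coeffs n (symm_coeff n c)"
  unfolding symm_coeff_def by (intro poly_coeffs_sum poly_coeffs_perm) auto

lemma peval_perm:
  assumes c: "poly_coeffs n c" and s: "s permutes {..<n}"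
  shows "peval n (\<lambda>kappa. c (permute_list s kappa)) x = peval n c (x \<circ> s)"
proof -
  have "peval n (\<lambda>kappa. c (permute_list s kappa)) x
      = lin_comb (\<lambda>kappa. mono n (permute_list (inv s) kappa)) c x"
    unfolding peval_eq_lin_comb by (rule lin_comb_perm[OF c s])
  also have "\<dots> = lin_comb (\<lambda>kappa x. mono n kappa (x \<circ> s)) c x"
  proof (rule lin_comb_cong)
    fix kappa assume "c kappa \<noteq> 0"
    then have "length kappa = n" using c unfolding poly_coeffs_def by blast
    from mono_perm[OF s this] show "mono n (permute_list (inv s) kappa) x = mono n kappa (x \<circ> s)" by simp
  qed
  finally show ?thesis by (simp add: lin_comb_def peval_def)
qed

lemma peval_symm_coeff:
  assumes "poly_coeffs n c"
  shows "peval n (symm_coeff n c) x = (\<Sum>s\<in>{s. s permutes {..<n}}. peval n c (x \<circ> s))"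
proof -
  have "peval n (symm_coeff n c) x
      = (\<Sum>s\<in>{s. s permutes {..<n}}. peval n (\<lambda>kappa. c (permute_list s kappa)) x)"
    unfolding symm_coeff_def peval_eq_lin_comb
    by (rule lin_comb_sum[where n = n]) (use assms poly_coeffs_perm in blast)
  also have "\<dots> = (\<Sum>s\<in>{s. s permutes {..<n}}. peval n c (x \<circ> s))"
    by (rule sum.cong) (auto simp: peval_perm[OF assms])
  finally show ?thesis .
qed

lemma symm_coeff_swap:
  assumes "length lam = n" "i < n" "j < n"
  shows "symm_coeff n (\<lambda>kappa. c (swap_list i j kappa)) lam = symm_coeff n c lam"
proof -
  let ?t = "tau i j"
  have t: "?t permutes {..<n}" by (rule transpose_permutes[OF assms(2,3)])
  have "symm_coeff n c lam = (\<Sum>s\<in>{s. s permutes {..<n}}. c (permute_list (s \<circ> ?t) lam))"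
    unfolding symm_coeff_def by (rule sum_permutations_compose_right[OF t])
  also have "\<dots> = symm_coeff n (\<lambda>kappa. c (swap_list i j kappa)) lam"
    unfolding symm_coeff_def swap_list_def using permute_list_compose[of ?t lam] t assms(1) by simp
  finally show ?thesis by simp
qed

text \<open>Up to a nonzero factor, the symmetrised coefficient does not change along the orbit of \<open>lam\<close>;
  for an exponent of the orbit that is minimal with respect to \<open>prec\<close> it is a positive integer.\<close>
lemma symm_coeff_E_nonzero:
  assumes k: "k \<ge> 0" and lam: "length lam = n"
  shows "symm_coeff n (E_coeff k n lam) lam \<noteq> 0"
proof -
  define Q where "Q = (\<lambda>eta. \<exists>c. poly_coeffs n c \<and> jack_eigen k n eta (peval n c) \<and> symm_coeff n c lam \<noteq> 0)"
  let ?O = "{eta. mset eta = mset lam}"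
  have "finite ?O" by (rule perm_finite)
  moreover have "?O \<noteq> {}" by auto
  ultimately obtain m where m: "m \<in> ?O" "\<forall>x\<in>?O. x \<noteq> m \<longrightarrow> \<not> prec n x m"
    using Finite_Set.bex_min_element[OF _ prec_asymp prec_transp] by blast
  have lm: "length m = n" using m(1) lam by (metis mem_Collect_eq size_mset)
  let ?E = "E_coeff k n m"
  note E = E_coeff_props(1-3)[OF k lm]
  \<comment> \<open>By minimality of m no other exponent of the orbit occurs in E_m, so the
    symmetrised coefficient counts the permutations taking lam to m.\<close>
  have one: "?E (permute_list s lam) = (if permute_list s lam = m then 1 else 0)" if "s permutes {..<n}" for s
  proof (cases "permute_list s lam = m")
    case True then show ?thesis using E(3) by simp
  next
    case False
    have "permute_list s lam \<in> ?O" using that lam by simp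
    then have "\<not> prec n (permute_list s lam) m" using m(2) False by blast
    then show ?thesis using jack_eigen_support(1)[OF k lm E(1,2), of "permute_list s lam"] False by auto
  qed
  let ?S = "{s. s permutes {..<n}}"
  have fin: "finite ?S" by (rule finite_permutations) simp
  have "symm_coeff n ?E lam = (\<Sum>s\<in>?S. if permute_list s lam = m then 1 else 0)"
    unfolding symm_coeff_def by (rule sum.cong) (auto simp: one)
  also have "\<dots> = of_nat (card {s\<in>?S. permute_list s lam = m})"
    using fin by (simp add: sum.inter_filter[symmetric])
  finally have card: "symm_coeff n ?E lam = of_nat (card {s\<in>?S. permute_list s lam = m})" .
  obtain s where "s permutes {..<n}" "permute_list s lam = m"
    using mset_eq_permutation[of m lam] m(1) lam by auto
  then have "{s\<in>?S. permute_list s lam = m} \<noteq> {}" by blast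
  then have "card {s\<in>?S. permute_list s lam = m} \<noteq> 0" using fin by simp
  then have "symm_coeff n ?E lam \<noteq> 0" using card by simp
  then have "Q m" unfolding Q_def using E by blast
  have "Q lam"
  proof (rule adjacent_swaps_connected[where Q = Q and eta = m])
    fix eta i assume h: "length eta = n" "Suc i < n" "Q eta"
    then obtain c where c: "poly_coeffs n c" "jack_eigen k n eta (peval n c)" "symm_coeff n c lam \<noteq> 0"
      by (auto simp: Q_def)
    show "Q (swap_list i (Suc i) eta)"
    proof (cases "eta ! i = eta ! Suc i")
      case True
      have "swap_list i (Suc i) eta = eta"
        using h True by (intro nth_equalityI) (auto simp: swap_list_nth tau_def)
      then show ?thesis using h by simp
    next
      case False
      let ?a = "swap_coeff k eta i"
      let ?d = "\<lambda>kappa. c (swap_list i (Suc i) kappa) + of_real ?a * c kappa"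
      have t: "tau i (Suc i) permutes {..<n}"
        using h by (intro transpose_permutes) auto
      have c': "poly_coeffs n (\<lambda>kappa. c (swap_list i (Suc i) kappa))"
        unfolding swap_list_def by (rule poly_coeffs_perm[OF c(1) t])
      have ac: "poly_coeffs n (\<lambda>kappa. of_real ?a * c kappa)" by (rule poly_coeffs_cmult[OF c(1)])
      have "peval n ?d x = peval n c (sw i (Suc i) x) + of_real ?a * peval n c x" for x
      proof -
        have "peval n ?d x = peval n (\<lambda>kappa. c (swap_list i (Suc i) kappa)) x + of_real ?a * peval n c x"
          unfolding peval_eq_lin_comb lin_comb_add[OF c' ac] lin_comb_cmult ..
        then show ?thesis unfolding swap_list_def peval_perm[OF c(1) t] sw_eq .
      qed
      then have "peval n ?d = (\<lambda>x. peval n c (sw i (Suc i) x) + of_real ?a * peval n c x)" by (rule ext)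
      then have "jack_eigen k n (swap_list i (Suc i) eta) (peval n ?d)"
        using jack_eigen_swap[OF k h(1,2) False peval_Pol c(2)] by (simp only:)
      moreover have "poly_coeffs n ?d" by (rule poly_coeffs_add[OF c' ac])
      moreover have "symm_coeff n ?d lam = (1 + of_real ?a) * symm_coeff n c lam"
      proof -
        have "symm_coeff n ?d lam
            = symm_coeff n (\<lambda>kappa. c (swap_list i (Suc i) kappa)) lam + of_real ?a * symm_coeff n c lam"
          by (simp add: symm_coeff_def sum.distrib sum_distrib_left)
        then show ?thesis using symm_coeff_swap[OF lam, of i "Suc i" c] h by (simp add: distrib_right)
      qed
      \<comment> \<open>A swap step multiplies the symmetrised coefficient by 1 + a, which is
        positive as |a| < 1.\<close>
      moreover have "1 + ?a \<noteq> 0" using abs_swap_coeff_less_1(1)[OF k h(1,2) False] by linarith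
      then have "complex_of_real (1 + ?a) \<noteq> 0" by (simp only: of_real_eq_0_iff not_False_eq_True)
      then have "1 + complex_of_real ?a \<noteq> 0" by simp
      ultimately show ?thesis unfolding Q_def using c(3) by (metis mult_eq_0_iff)
    qed
  next
    show "length m = n" by (rule lm)
    show "mset lam = mset m" using m(1) by simp
    show "Q m" by (rule \<open>Q m\<close>)
  qed
  then obtain c where c: "poly_coeffs n c" "jack_eigen k n lam (peval n c)" "symm_coeff n c lam \<noteq> 0"
    by (auto simp: Q_def)
  note L = E_coeff_props(1-3)[OF k lam]
  let ?d = "\<lambda>kappa. c lam * E_coeff k n lam kappa"
  have pd: "peval n ?d = (\<lambda>x. c lam * peval n (E_coeff k n lam) x)"
    unfolding peval_eq_lin_comb by (rule ext) (rule lin_comb_cmult)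
  have "jack_eigen k n lam (peval n ?d)"
    unfolding pd jack_eigen_def
  proof (intro allI impI)
    fix j x assume j: "j < n"
    show "jackD k n j (\<lambda>x. c lam * peval n (E_coeff k n lam) x) x
        = of_real (ebar k lam j) * (c lam * peval n (E_coeff k n lam) x)"
      unfolding jackD_cmult[OF j peval_Pol] using L(2) j by (simp add: jack_eigen_def)
  qed
  \<comment> \<open>The eigenfunction reached along the orbit is c lam times E_lam, so its nonzero
    symmetrised coefficient forces that of E_lam to be nonzero.\<close>
  from jack_eigen_unique[OF k lam c(1) poly_coeffs_cmult[OF L(1)] c(2) this] L(3)
  have "c = ?d" by simp
  then have "symm_coeff n c lam = c lam * symm_coeff n (E_coeff k n lam) lam"
    unfolding symm_coeff_def sum_distrib_left by metis
  then show ?thesis using c(3) by auto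
qed

lemma P_coeff_eq:
  assumes k: "k \<ge> 0" and lam: "length lam = n"
  shows "P_coeff k n lam
    = (\<lambda>kappa. (1 / symm_coeff n (E_coeff k n lam) lam) * symm_coeff n (E_coeff k n lam) kappa)"
  unfolding P_coeff_def
proof (rule the_equality)
  let ?s = "symm_coeff n (E_coeff k n lam)"
  have nz: "?s lam \<noteq> 0" by (rule symm_coeff_E_nonzero[OF assms])
  show "(\<exists>a. (\<lambda>kappa. (1 / ?s lam) * ?s kappa) = (\<lambda>kappa. a * ?s kappa)) \<and> (1 / ?s lam) * ?s lam = 1"
    using nz by (intro conjI exI[of _ "1 / ?s lam"]) simp_all
  fix c assume c: "(\<exists>a. c = (\<lambda>kappa. a * ?s kappa)) \<and> c lam = 1"
  then obtain a where a: "c = (\<lambda>kappa. a * ?s kappa)" by blast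
  then have "a * ?s lam = 1" using c by simp
  then have "a = 1 / ?s lam" using nz by (simp add: field_simps)
  then show "c = (\<lambda>kappa. (1 / ?s lam) * ?s kappa)" using a by simp
qed

theorem theorem3p3:
  fixes k :: real and n :: nat and mu :: complex and x :: "nat \<Rightarrow> real"
  assumes "k \<ge> 0" and "\<forall>i<n. x i \<noteq> 0"
  shows "(\<forall>eta. length eta = n \<longrightarrow>
           polyT k n (E_coeff k n eta) (Delta_pow n mu) x =
           (-1) ^ sum_list eta * gen_poch k n mu (dec_rearr eta)
             * peval n (E_coeff k n eta) (\<lambda>i. 1 / x i) * Delta_pow n mu x)
       \<and> (\<forall>lam. length lam = n \<and> sorted_wrt (\<ge>) lam \<longrightarrow>
           polyT k n (P_coeff k n lam) (Delta_pow n mu) x =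
           (-1) ^ sum_list lam * gen_poch k n mu lam
             * peval n (P_coeff k n lam) (\<lambda>i. 1 / x i) * Delta_pow n mu x)"
proof (intro conjI allI impI)
  have x: "x \<in> off_axes n" using assms(2) by (simp add: off_axes_def)
  fix eta :: "nat list" assume eta: "length eta = n"
  show "polyT k n (E_coeff k n eta) (Delta_pow n mu) x =
      (-1) ^ sum_list eta * gen_poch k n mu (dec_rearr eta)
        * peval n (E_coeff k n eta) (\<lambda>i. 1 / x i) * Delta_pow n mu x"
    using polyT_tw_rel[OF E_coeff_props(1,4)[OF assms(1) eta] x]
    by (simp add: jack_image_def mult_ac)
next
  have x: "x \<in> off_axes n" using assms(2) by (simp add: off_axes_def)
  fix lam :: "nat list" assume lam: "length lam = n \<and> sorted_wrt (\<ge>) lam"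
  then have len: "length lam = n" and dec: "dec_rearr lam = lam"
    by (auto intro: dec_rearr_eqI)
  let ?c = "E_coeff k n lam"
  let ?a = "1 / symm_coeff n ?c lam"
  let ?j = "jack_image k n mu lam"
  note E = E_coeff_props[OF assms(1) len]
  have coeffs: "poly_coeffs n (P_coeff k n lam)"
    unfolding P_coeff_eq[OF assms(1) len] by (intro poly_coeffs_cmult poly_coeffs_symm E(1))
  have P: "peval n (P_coeff k n lam) = (\<lambda>x. ?a * (\<Sum>s\<in>{s. s permutes {..<n}}. peval n ?c (x \<circ> s)))"
    unfolding P_coeff_eq[OF assms(1) len] peval_eq_lin_comb lin_comb_cmult[abs_def]
    unfolding peval_eq_lin_comb[symmetric] peval_symm_coeff[OF E(1)] ..
  \<comment> \<open>Since L commutes with permutations, every permuted copy of E_lam acquires the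
    same scalar, which then factors out of the symmetrisation.\<close>
  have "tw_rel k n mu (\<lambda>x. \<Sum>s\<in>{s. s permutes {..<n}}. peval n ?c (x \<circ> s))
      (\<lambda>x. \<Sum>s\<in>{s. s permutes {..<n}}. ?j * peval n ?c (x \<circ> s))"
    by (rule tw_rel_sum) (use tw_rel_perm[OF _ E(4)] in blast)
  from tw_rel_cmult[OF this, of ?a]
  have "tw_rel k n mu (peval n (P_coeff k n lam)) (\<lambda>y. ?j * peval n (P_coeff k n lam) y)"
    unfolding P by (simp only: sum_distrib_left[symmetric] mult.left_commute)
  from polyT_tw_rel[OF coeffs this x]
  show "polyT k n (P_coeff k n lam) (Delta_pow n mu) x =
      (-1) ^ sum_list lam * gen_poch k n mu lam
        * peval n (P_coeff k n lam) (\<lambda>i. 1 / x i) * Delta_pow n mu x"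
    by (simp add: jack_image_def dec mult_ac)
qed

end
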